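(* Suppose that $a,b\in{\mathbb Q}^2$ with $a\neq0$, $a_1\pm a_2\not\in\mathbb Z$, $M\in\mathbb N_{\geq2}$, and $(\gamma_M a,\gamma_M b)\sim(a,b)$ or both $(\gamma_M a,\gamma_M b)\sim(a^*,b^* )$ and $(\gamma_M a^*,\gamma_M b^* )\sim(a,b)$ hold. Then $S_{a,b;M}=F^+$ for a Maass waveform $F$ of eigenvalue $1/4$ on a congruence subgroup of $\operatorname{SL}_2(\mathbb Z)$.
   Context: Let $q=e^{2\pi i\tau}$, $\tau=u+iv\in\mathbb H$, $e(w):=e^{2\pi i w}$. For $M\in\mathbb N_{\ge2}$ and $a=(a_1,a_2),b=(b_1,b_2)\in\mathbb Q^2$ with $a_1\pm a_2\notin\mathbb Z$, define $S_{a,b;M}(\tau):=\Big(\sum_{n\pm \nu\geq-\lfloor a_1\pm a_2\rfloor}+\sum_{n\pm\nu<-\lfloor a_1\pm a_2\rfloor}\Big)e\big((M+1)b_1n-(M-1)b_2\nu\big)q^{\frac12((M+1)(n+a_1)^2-(M-1)(\nu+a_2)^2)}$ (sum over $n,\nu\in\mathbb Z$, both sign conditions holding simultaneously). Let $\gamma_M:=\begin{pmatrix}M&M-1\\ M+1&M\end{pmatrix}$, and for $x=(x_1,x_2)$ let $x^*:=(-x_1,x_2)$. Let $A=\begin{pmatrix}M+1&0\\0&1-M\end{pmatrix}$, $Q(r)=\frac12 r^TAr$, and $B(r,\mu):=r^TA\mu$. Write $(a,b)\sim(\alpha,\beta)$ if $a\pm\alpha\in\mathbb Z^2$ and $b\pm\beta=:\mu\in\mathbb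 Z^2$ with $B(a,\mu)\in\mathbb Z$ (the two $\pm$ with the same sign). A Maass waveform on a congruence subgroup $\Gamma$ (possibly with multiplier) with eigenvalue $\lambda$ is a smooth $F:\mathbb H\to\mathbb C$ invariant under $\Gamma$, of at most polynomial growth at the cusps, with $\Delta F=\lambda F$ where $\Delta=-v^2(\partial_u^2+\partial_v^2)$. If $F$ has eigenvalue $1/4$, is cuspidal at $i\infty$, and has Fourier expansion $F(\tau)=v^{1/2}\sum_{n\neq0}A(n)K_0(2\pi|n|v/N)e(nu/N)$, then $F^+(\tau):=\sum_{n>0}A(n)q^{n/N}$. *)

theory Defs
  imports "HOL-Analysis.Analysis" "HOL-Algebra.Group"
begin

definition upper_half_plane :: "complex set" where
  "upper_half_plane = {\<tau>. Im \<tau> > 0}"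

definition SL2Z :: "(int ^ 2 ^ 2) monoid" where
  "SL2Z = \<lparr>carrier = {g. det g = 1}, mult = (**), one = mat 1\<rparr>"

definition principal_congruence_subgroup :: "nat \<Rightarrow> (int ^ 2 ^ 2) set" where
  "principal_congruence_subgroup N =
     {g \<in> carrier SL2Z. \<forall>i j. int N dvd (g - mat 1) $ i $ j}"

definition congruence_subgroup :: "(int ^ 2 ^ 2) set \<Rightarrow> bool" where
  "congruence_subgroup \<Gamma> \<longleftrightarrow>
     subgroup \<Gamma> SL2Z \<and> (\<exists>N\<ge>1. principal_congruence_subgroup N \<subseteq> \<Gamma>)"

definition moebius :: "int ^ 2 ^ 2 \<Rightarrow> complex \<Rightarrow> complex" where
  "moebius g \<tau> = (of_int (g $ 1 $ 1) * \<tau> + of_int (g $ 1 $ 2)) /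
                 (of_int (g $ 2 $ 1) * \<tau> + of_int (g $ 2 $ 2))"

text \<open>Partial derivatives with respect to \<open>u = Re \<tau>\<close> and \<open>v = Im \<tau>\<close>; the
  derivative is the real one on \<open>\<complex> = \<real>\<^sup>2\<close>, not the holomorphic one.\<close>

definition partial_u :: "(complex \<Rightarrow> complex) \<Rightarrow> complex \<Rightarrow> complex" where
  "partial_u F \<tau> = frechet_derivative F (at \<tau>) 1"

definition partial_v :: "(complex \<Rightarrow> complex) \<Rightarrow> complex \<Rightarrow> complex" where
  "partial_v F \<tau> = frechet_derivative F (at \<tau>) \<i>"

primrec Ck_on_uhp :: "nat \<Rightarrow> (complex \<Rightarrow> complex) \<Rightarrow> bool" where
  "Ck_on_uhp 0 F \<longleftrightarrow> continuous_on upper_half_plane F"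
| "Ck_on_uhp (Suc k) F \<longleftrightarrow> F differentiable_on upper_half_plane \<and>
     Ck_on_uhp k (partial_u F) \<and> Ck_on_uhp k (partial_v F)"

definition smooth_on_uhp :: "(complex \<Rightarrow> complex) \<Rightarrow> bool" where
  "smooth_on_uhp F \<longleftrightarrow> (\<forall>k. Ck_on_uhp k F)"

definition hyperbolic_laplacian :: "(complex \<Rightarrow> complex) \<Rightarrow> complex \<Rightarrow> complex" where
  "hyperbolic_laplacian F \<tau> =
     - (of_real (Im \<tau>))\<^sup>2 * (partial_u (partial_u F) \<tau> + partial_v (partial_v F) \<tau>)"

definition multiplier :: "(int ^ 2 ^ 2) set \<Rightarrow> (int ^ 2 ^ 2 \<Rightarrow> complex) \<Rightarrow> bool" where
  "multiplier \<Gamma> \<epsilon> \<longleftrightarrow> (\<forall>g\<in>\<Gamma>. cmod (\<epsilon> g) = 1) \<and> (\<forall>g\<in>\<Gamma>. \<forall>h\<in>\<Gamma>. \<epsilon> (g ** h) = \<epsilon> g * \<epsilon> h)"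

text \<open>Every cusp of \<open>\<Gamma>\<close> is the image of \<open>i\<infinity>\<close> under some \<open>g \<in> SL\<^sub>2(\<int>)\<close>.\<close>

definition polynomial_growth_at_cusps :: "(complex \<Rightarrow> complex) \<Rightarrow> bool" where
  "polynomial_growth_at_cusps F \<longleftrightarrow>
     (\<forall>g\<in>carrier SL2Z. \<exists>C y0. \<exists>k::nat. y0 > 0 \<and>
        (\<forall>\<tau>. Im \<tau> \<ge> y0 \<longrightarrow> cmod (F (moebius g \<tau>)) \<le> C * Im \<tau> ^ k))"

definition maass_waveform ::
  "(int ^ 2 ^ 2) set \<Rightarrow> complex \<Rightarrow> (complex \<Rightarrow> complex) \<Rightarrow> bool" where
  "maass_waveform \<Gamma> ev F \<longleftrightarrow>
     smooth_on_uhp F \<and>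
     (\<exists>\<epsilon>. multiplier \<Gamma> \<epsilon> \<and>
        (\<forall>g\<in>\<Gamma>. \<forall>\<tau>\<in>upper_half_plane. F (moebius g \<tau>) = \<epsilon> g * F \<tau>)) \<and>
     polynomial_growth_at_cusps F \<and>
     (\<forall>\<tau>\<in>upper_half_plane. hyperbolic_laplacian F \<tau> = ev * F \<tau>)"

definition ee :: "complex \<Rightarrow> complex" where
  "ee w = exp (2 * of_real pi * \<i> * w)"

text \<open>The modified Bessel function of the second kind of order 0, for \<open>x > 0\<close>.\<close>

definition bessel_K0 :: "real \<Rightarrow> real" where
  "bessel_K0 x = (LBINT t:{0..}. exp (- x * cosh t))"

text \<open>Cuspidality at \<open>i\<infinity>\<close> is the absence of an \<open>n = 0\<close> term.\<close>

definition cuspidal_fourier_expansion ::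
  "(complex \<Rightarrow> complex) \<Rightarrow> nat \<Rightarrow> (int \<Rightarrow> complex) \<Rightarrow> bool" where
  "cuspidal_fourier_expansion F N A \<longleftrightarrow> N > 0 \<and>
     (\<forall>\<tau>\<in>upper_half_plane.
        ((\<lambda>n. of_real (sqrt (Im \<tau>)) * (A n *
              of_real (bessel_K0 (2 * pi * \<bar>real_of_int n\<bar> * Im \<tau> / real N)) *
              ee (of_real (real_of_int n * Re \<tau> / real N)))) has_sum F \<tau>) {n. n \<noteq> 0})"

text \<open>\<open>maass_plus_part F G\<close> says \<open>G = F\<^sup>+\<close> on the upper half-plane. The
  coefficients \<open>A(n)\<close> are determined by \<open>F\<close> and \<open>N\<close>, and replacing \<open>N\<close> by a
  multiple does not change the resulting series in \<open>q\<close>, so there is at most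
  one such \<open>G\<close> on the upper half-plane.\<close>

definition maass_plus_part :: "(complex \<Rightarrow> complex) \<Rightarrow> (complex \<Rightarrow> complex) \<Rightarrow> bool" where
  "maass_plus_part F G \<longleftrightarrow>
     (\<exists>N A. cuspidal_fourier_expansion F N A \<and>
        (\<forall>\<tau>\<in>upper_half_plane.
           ((\<lambda>n. A n * ee (of_int n * \<tau> / of_nat N)) has_sum G \<tau>) {n. n > 0}))"

definition gamma_mat :: "nat \<Rightarrow> rat ^ 2 ^ 2" where
  "gamma_mat M = vector [vector [of_nat M, of_nat M - 1],
                         vector [of_nat M + 1, of_nat M]]"

definition A_mat :: "nat \<Rightarrow> rat ^ 2 ^ 2" where
  "A_mat M = vector [vector [of_nat M + 1, 0],
                     vector [0, 1 - of_nat M]]"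

definition B_form :: "nat \<Rightarrow> rat ^ 2 \<Rightarrow> rat ^ 2 \<Rightarrow> rat" where
  "B_form M r \<mu> = (\<Sum>i\<in>UNIV. r $ i * (A_mat M *v \<mu>) $ i)"

definition star_vec :: "rat ^ 2 \<Rightarrow> rat ^ 2" where
  "star_vec x = vector [- (x $ 1), x $ 2]"

definition integral_vec :: "rat ^ 2 \<Rightarrow> bool" where
  "integral_vec x \<longleftrightarrow> (\<forall>i. x $ i \<in> \<int>)"

fun sim :: "nat \<Rightarrow> (rat ^ 2) \<times> (rat ^ 2) \<Rightarrow> (rat ^ 2) \<times> (rat ^ 2) \<Rightarrow> bool" where
  "sim M (a, b) (\<alpha>, \<beta>) \<longleftrightarrow>
     (\<exists>s\<in>{1, -1}. integral_vec (a + s *s \<alpha>) \<and>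
        (let \<mu> = b + s *s \<beta> in integral_vec \<mu> \<and> B_form M a \<mu> \<in> \<int>))"

definition S_term :: "rat ^ 2 \<Rightarrow> rat ^ 2 \<Rightarrow> nat \<Rightarrow> complex \<Rightarrow> int \<times> int \<Rightarrow> complex" where
  "S_term a b M \<tau> = (\<lambda>(n, \<nu>).
     ee (of_rat ((of_nat M + 1) * b $ 1 * of_int n - (of_nat M - 1) * b $ 2 * of_int \<nu>)) *
     ee (of_rat (1 / 2 * ((of_nat M + 1) * (of_int n + a $ 1)\<^sup>2 -
                         (of_nat M - 1) * (of_int \<nu> + a $ 2)\<^sup>2)) * \<tau>))"

definition S_series :: "rat ^ 2 \<Rightarrow> rat ^ 2 \<Rightarrow> nat \<Rightarrow> complex \<Rightarrow> complex" where
  "S_series a b M \<tau> =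
     (\<Sum>\<^sub>\<infinity>p \<in> {(n, \<nu>). n + \<nu> \<ge> - \<lfloor>a $ 1 + a $ 2\<rfloor> \<and> n - \<nu> \<ge> - \<lfloor>a $ 1 - a $ 2\<rfloor>}.
        S_term a b M \<tau> p) +
     (\<Sum>\<^sub>\<infinity>p \<in> {(n, \<nu>). n + \<nu> < - \<lfloor>a $ 1 + a $ 2\<rfloor> \<and> n - \<nu> < - \<lfloor>a $ 1 - a $ 2\<rfloor>}.
        S_term a b M \<tau> p)"

end

theory Submission
  imports Defs "HOL-Complex_Analysis.Complex_Analysis" "HOL-Probability.Probability"
begin

text \<open>
  Attach to a function \<open>C\<close> on \<open>\<int>\<^sup>2\<close>, periodic modulo \<open>(P, R)\<close>, the theta function in which the
  indefinite form \<open>m\<^sup>2/P - n\<^sup>2/R\<close> is paired with its majorant moved by a hyperbolic rotation (boost) of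
  parameter \<open>t\<close>. By Poisson summation \<open>SL\<^sub>2(\<int>)\<close> acts on these theta functions through a unitary action
  on the periodic functions; elements of \<open>\<Gamma>(2PR)\<close> act by operators that commute with the finite
  Heisenberg group, hence by scalars. The automorphism \<open>\<gamma>\<^sub>M\<close> is the boost of parameter
  \<open>T = arcosh M\<close>. If \<open>C\<close> is \<open>\<gamma>\<^sub>M\<close>-invariant, integrate the theta function over one period of \<open>t\<close>.
  The result is a Maass form of eigenvalue \<open>1/4\<close>, because applying \<open>\<Delta> - 1/4\<close> to the kernel gives a
  \<open>t\<close>-derivative, whose boundary values cancel; unfolding along the orbits of \<open>\<gamma>\<^sub>M\<close> produces the
  \<open>K\<^sub>0\<close>-expansion. Every \<open>\<gamma>\<^sub>M\<close>-orbit of positive norm meets the cone of Zwegers' sum once, up to the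
  boundary, so the plus part is a sum over that cone. For \<open>C\<close> one takes the character of the coset
  of \<open>a\<close> attached to \<open>b\<close>, symmetrised under \<open>-1\<close> and \<open>*\<close>: the cone is stable under both, the
  relation on \<open>(a, b)\<close> makes \<open>C\<close> invariant, and \<open>a\<^sub>1 \<plusminus> a\<^sub>2 \<notin> \<int>\<close> makes it vanish on the boundary of the cone.
\<close>

section \<open>Gaussian sums\<close>

text \<open>Signature (1,1) decides the shape of the argument. Under inversion the square roots of
  \<open>\<tau>\<close> and \<open>cnj \<tau>\<close> combine to \<open>cmod \<tau>\<close>, so the
  factor \<open>sqrt (Im \<tau>)\<close> yields weight zero and no theta multiplier has to be
  tracked. The form is anisotropic, because M^2 - 1 is not a square for M >= 2; hence the majorant
  of a nonzero vector has a unique minimum in t, and its kernel is integrable over the whole line,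
  which is where K_0 comes from. At the zero vector the kernel is constant and that integral
  diverges, so the unfolding asks for \<open>C (0, 0) = 0\<close>. On the boundary of the cone the
  unfolding counts positive vectors with weight one half, the strict cone with weight zero; the
  vanishing of \<open>C\<close> there reconciles the two. At level \<open>2 * P * R\<close> the
  half-integral phases of the Heisenberg operators disappear, and \<open>K\<close> is even so that
  translation of \<open>\<tau>\<close> preserves periodicity. The character on the level subgroup is
  read off from values of the lift, which makes it multiplicative without comparing choices of
  operators.\<close>

lemma summable_on_exp_neg_int_abs_int: "(\<lambda>n::int. exp (- \<bar>real_of_int n\<bar>)) summable_on UNIV"
proof -
  have nat: "(\<lambda>n::nat. exp (- real n)) summable_on UNIV"
  proof (rule norm_summable_imp_summable_on)
    have "summable (\<lambda>n. exp (-1::real) ^ n)"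
      by (rule summable_geometric) auto
    then show "summable (\<lambda>n. norm (exp (- real n)))"
      by (simp add: exp_of_nat_mult[symmetric])
  qed
  have 1: "(\<lambda>n::int. exp (- \<bar>real_of_int n\<bar>)) summable_on range int"
    by (subst summable_on_reindex) (use nat in \<open>auto simp: o_def inj_on_def\<close>)
  have 2: "(\<lambda>n::int. exp (- \<bar>real_of_int n\<bar>)) summable_on range (\<lambda>k. - int k)"
    by (subst summable_on_reindex) (use nat in \<open>auto simp: o_def inj_on_def\<close>)
  have 3: "range int \<union> range (\<lambda>k. - int k) = UNIV"
  proof -
    have "x \<in> range int \<union> range (\<lambda>k. - int k)" for x
      by (cases x rule: int_cases2) auto
    then show ?thesis by blast
  qed
  show ?thesis using summable_on_union[OF 1 2] unfolding 3 .
qed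

text \<open>Completing the square with \<open>B + 1\<close> in place of \<open>B\<close> leaves a
  factor that decays geometrically in the absolute value of n.\<close>

lemma summable_on_gaussian_int:
  fixes e B :: real
  assumes "e > 0"
  shows "(\<lambda>n::int. exp (- e * (of_int n)\<^sup>2 + B * \<bar>of_int n\<bar>)) summable_on UNIV"
proof (rule summable_on_comparison_test)
  show "(\<lambda>n::int. exp ((B+1)\<^sup>2 / (4*e)) * exp (- \<bar>real_of_int n\<bar>)) summable_on UNIV"
    by (intro summable_on_cmult_right summable_on_exp_neg_int_abs_int)
  fix n :: int
  define y where "y = \<bar>real_of_int n\<bar>"
  have "0 \<le> e * (y - (B+1)/(2*e))\<^sup>2" using assms by simp
  also have "\<dots> = e * y\<^sup>2 - (B+1) * y + (B+1)\<^sup>2/(4*e)"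
    using assms by (simp add: field_simps power2_eq_square)
  finally have "- e * y\<^sup>2 + B * y \<le> (B+1)\<^sup>2/(4*e) - y" by (simp add: algebra_simps)
  then show "exp (- e * (of_int n)\<^sup>2 + B * \<bar>of_int n\<bar>) \<le> exp ((B+1)\<^sup>2 / (4*e)) * exp (- \<bar>real_of_int n\<bar>)"
    unfolding exp_add[symmetric] by (simp add: y_def)
qed auto

text \<open>Jacobi's theta function. Keeping both parameters as free complex numbers allows analytic
  continuation in either of them.\<close>

definition gauss_sum :: "complex \<Rightarrow> complex \<Rightarrow> complex" where
  "gauss_sum \<alpha> \<beta> = (\<Sum>\<^sub>\<infinity>n::int. exp (- \<alpha> * (of_int n)\<^sup>2 + \<beta> * of_int n))"

lemma norm_gauss_term:
  assumes "Re \<alpha> \<ge> e" "norm \<beta> \<le> B"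
  shows "norm (exp (- \<alpha> * (of_int n)\<^sup>2 + \<beta> * of_int n)) \<le> exp (- e * (of_int n)\<^sup>2 + B * \<bar>of_int n\<bar>)"
proof -
  have "Re (- \<alpha> * (of_int n)\<^sup>2 + \<beta> * of_int n) = - Re \<alpha> * (of_int n)\<^sup>2 + Re \<beta> * of_int n"
    by (simp flip: of_int_power)
  moreover have "Re \<alpha> * (of_int n)\<^sup>2 \<ge> e * (of_int n)\<^sup>2"
    using assms by (intro mult_right_mono) auto
  moreover have "Re \<beta> * of_int n \<le> B * \<bar>of_int n\<bar>"
  proof -
    have "Re \<beta> * of_int n \<le> \<bar>Re \<beta>\<bar> * \<bar>of_int n\<bar>" by (metis abs_ge_self abs_mult)
    also have "\<dots> \<le> B * \<bar>of_int n\<bar>"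
      using assms(2) abs_Re_le_cmod[of \<beta>] by (intro mult_right_mono) auto
    finally show ?thesis .
  qed
  ultimately show ?thesis by simp
qed

lemma abs_summable_gauss_sum:
  assumes "Re \<alpha> > 0"
  shows "(\<lambda>n::int. norm (exp (- \<alpha> * (of_int n)\<^sup>2 + \<beta> * of_int n))) summable_on UNIV"
  by (rule summable_on_comparison_test[OF summable_on_gaussian_int[OF assms, of "norm \<beta>"]])
     (use norm_gauss_term[of "Re \<alpha>" \<alpha> \<beta> "norm \<beta>"] in auto)

text \<open>On a closed ball \<open>Re \<alpha>\<close> attains a positive minimum and
  \<open>norm \<beta>\<close> a maximum, so a single Gaussian majorant serves the Weierstrass test
  on the whole ball.\<close>

lemma holomorphic_on_gauss_sum:
  assumes "open S" "\<alpha> holomorphic_on S" "\<beta> holomorphic_on S" and pos: "\<And>w. w \<in> S \<Longrightarrow> Re (\<alpha> w) > 0"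
  shows "(\<lambda>w. gauss_sum (\<alpha> w) (\<beta> w)) holomorphic_on S"
proof -
  have "(\<lambda>w. gauss_sum (\<alpha> w) (\<beta> w)) field_differentiable (at z)" if zS: "z \<in> S" for z
  proof -
    obtain r where r: "r > 0" "cball z r \<subseteq> S"
      using bspec[OF iffD1[OF open_contains_cball \<open>open S\<close>] zS] by auto
    have ca: "continuous_on (cball z r) \<alpha>" and cb: "continuous_on (cball z r) \<beta>"
      using assms(2,3) r(2) by (metis holomorphic_on_imp_continuous_on continuous_on_subset)+
    have "\<exists>x\<in>cball z r. \<forall>y\<in>cball z r. Re (\<alpha> x) \<le> Re (\<alpha> y)"
      using r by (intro continuous_attains_inf continuous_intros ca) auto
    then obtain x0 where x0: "x0 \<in> cball z r" "\<And>y. y \<in> cball z r \<Longrightarrow> Re (\<alpha> x0) \<le> Re (\<alpha> y)"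
      by (elim bexE) (simp add: that)
    have "\<exists>x\<in>cball z r. \<forall>y\<in>cball z r. norm (\<beta> y) \<le> norm (\<beta> x)"
      using r by (intro continuous_attains_sup continuous_intros cb) auto
    then obtain x1 where x1: "x1 \<in> cball z r" "\<And>y. y \<in> cball z r \<Longrightarrow> norm (\<beta> y) \<le> norm (\<beta> x1)"
      by (elim bexE) (simp add: that)
    have e0: "Re (\<alpha> x0) > 0" using pos[of x0] x0(1) r(2) by auto
    have ul: "uniform_limit (cball z r)
            (\<lambda>X w. \<Sum>n\<in>X. exp (- \<alpha> w * (of_int n)\<^sup>2 + \<beta> w * of_int n))
            (\<lambda>w. \<Sum>\<^sub>\<infinity>n. exp (- \<alpha> w * (of_int n)\<^sup>2 + \<beta> w * of_int n)) (finite_subsets_at_top UNIV)"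
      by (rule Weierstrass_m_test_general[OF _ summable_on_gaussian_int[OF e0, of "norm (\<beta> x1)"]])
         (rule norm_gauss_term[OF x0(2) x1(2)])
    have hol: "(\<lambda>w. \<Sum>n\<in>X. exp (- \<alpha> w * (of_int n)\<^sup>2 + \<beta> w * of_int n)) holomorphic_on S" for X
      by (intro holomorphic_intros assms)
    have "ball z r \<subseteq> S" using ball_subset_cball r(2) by (rule order_trans)
    then have cX: "continuous_on (cball z r) (\<lambda>w. \<Sum>n\<in>X. exp (- \<alpha> w * (of_int n)\<^sup>2 + \<beta> w * of_int n)) \<and>
        (\<lambda>w. \<Sum>n\<in>X. exp (- \<alpha> w * (of_int n)\<^sup>2 + \<beta> w * of_int n)) holomorphic_on ball z r" for X
      using holomorphic_on_imp_continuous_on[OF holomorphic_on_subset[OF hol[of X] r(2)]] holomorphic_on_subset[OF hol[of X]] by simp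
    obtain "(\<lambda>w. gauss_sum (\<alpha> w) (\<beta> w)) holomorphic_on ball z r"
      unfolding gauss_sum_def
      by (rule holomorphic_uniform_limit[OF always_eventually ul]) (use cX in simp_all)
    then show ?thesis using r by (intro holomorphic_on_imp_differentiable_at[of _ "ball z r"]) auto
  qed
  then show ?thesis unfolding holomorphic_on_def by (auto intro: field_differentiable_at_within)
qed

text \<open>With \<open>E z = exp (2 * pi * \<i> * z)\<close>, the function \<open>f - f 0\<close>
  equals \<open>h * (E - 1)\<close> for a holomorphic \<open>h\<close>, since in the unit disc
  \<open>E - 1\<close> has only one zero, a simple one at the origin. Multiplication by
  \<open>E\<close> shifts Fourier coefficients by one, so the coefficients of \<open>f\<close> are
  differences of consecutive coefficients of \<open>h\<close>, up to the constant
  \<open>f 0\<close>. Symmetric partial sums telescope, and the coefficients of \<open>h\<close>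
  tend to zero.\<close>

lemma fourier_series_at_0:
  fixes f :: "complex \<Rightarrow> complex" and c :: "int \<Rightarrow> complex"
  assumes hol: "f holomorphic_on ball 0 1"
    and per: "f (1/2) = f (-1/2)"
    and c: "\<And>n. c n = integral {-1/2..1/2} (\<lambda>x. f (of_real x) * exp (-2 * of_real pi * \<i> * of_int n * of_real x))"
    and sm: "c summable_on UNIV"
  shows "(\<Sum>\<^sub>\<infinity>n. c n) = f 0"
proof -
  define p where "p = (\<lambda>z. if z = 0 then deriv f 0 else (f z - f 0) / (z - 0))"
  define E where "E = (\<lambda>z::complex. exp (2 * pi * \<i> * z))"
  define q where "q = (\<lambda>z. if z = 0 then deriv E 0 else (E z - E 0) / (z - 0))"
  define h where "h = (\<lambda>z. p z / q z)"
  have holE: "E holomorphic_on ball 0 1" unfolding E_def by (intro holomorphic_intros)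
  have pq: "p holomorphic_on ball 0 1" "q holomorphic_on ball 0 1"
    unfolding p_def q_def by (intro pole_lemma_open hol holE open_ball)+
  have dE: "deriv E 0 = 2 * pi * \<i>"
    unfolding E_def by (rule DERIV_imp_deriv) (auto intro!: derivative_eq_intros)
  have q0: "q z \<noteq> 0" if "z \<in> ball 0 1" for z
  proof (cases "z = 0")
    case False
    have "E z \<noteq> 1"
    proof
      assume "E z = 1"
      then obtain k :: int where k: "Im (2 * pi * \<i> * z) = of_int (2 * k) * pi" "Re (2*pi*\<i>*z) = 0"
        unfolding E_def exp_eq_1 by auto
      then have "Re z = of_int k" "Im z = 0" by auto
      then have z: "z = of_int k" by (simp add: complex_eq_iff)
      with that have "\<bar>k\<bar> < 1" by (simp add: dist_norm flip: of_int_abs)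
      with z False show False by auto
    qed
    with False show ?thesis by (simp add: q_def E_def)
  qed (simp add: q_def dE)
  have hh: "h holomorphic_on ball 0 1" unfolding h_def using pq q0 by (intro holomorphic_intros) auto
  have fh: "f z - f 0 = h z * (E z - 1)" if "z \<in> ball 0 1" for z
  proof (cases "z = 0")
    case False
    have "q z * z = E z - 1" "p z * z = f z - f 0" using False by (auto simp: p_def q_def E_def)
    moreover have "p z = h z * q z" using q0[OF that] by (simp add: h_def)
    ultimately show ?thesis by (metis mult.assoc)
  qed (simp add: E_def)
  have sub: "of_real x \<in> ball (0::complex) 1" if "x \<in> {-1/2..1/2}" for x
    using that by (auto simp: dist_norm)
  have conth: "continuous_on {-1/2..1/2} (\<lambda>x::real. h (of_real x))"
    by (rule continuous_on_compose2[OF holomorphic_on_imp_continuous_on[OF hh] continuous_on_of_real[OF continuous_on_id]])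
       (use sub in auto)
  have contf: "continuous_on {-1/2..1/2} (\<lambda>x::real. f (of_real x))"
    by (rule continuous_on_compose2[OF holomorphic_on_imp_continuous_on[OF hol] continuous_on_of_real[OF continuous_on_id]])
       (use sub in auto)
  have contdh: "continuous_on {-1/2..1/2} (\<lambda>x::real. deriv h (of_real x))"
    by (rule continuous_on_compose2[OF holomorphic_on_imp_continuous_on[OF holomorphic_deriv[OF hh]] continuous_on_of_real[OF continuous_on_id]])
       (use sub in auto)
  define e where "e = (\<lambda>(n::int) (x::real). exp (-2 * pi * \<i> * of_int n * of_real x))"
  have conte: "continuous_on A (e n)" for A n unfolding e_def by (intro continuous_intros)
  have normE: "norm (e n x) = 1" for n x unfolding e_def by simp
  define d where "d = (\<lambda>n. integral {-1/2..1/2} (\<lambda>x. h (of_real x) * e n x))"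
  have int_e: "integral {-1/2..1/2} (e n) = (if n = 0 then 1 else 0)" for n
  proof (cases "n = 0")
    case False
    have D: "(e n has_integral (\<lambda>x. e n x / (-2*pi*\<i>* of_int n)) (1/2) - (\<lambda>x. e n x / (-2*pi*\<i>* of_int n)) (-1/2)) {-1/2..1/2}"
    proof (rule fundamental_theorem_of_calculus)
      fix x :: real
      have 2: "((\<lambda>z. exp (-2 * pi * \<i> * of_int n * z) / (-2*pi*\<i>* of_int n)) has_field_derivative e n x) (at (of_real x))"
        by (rule DERIV_cong[OF DERIV_cdivide], (rule derivative_eq_intros refl)+) (use False in \<open>simp add: e_def\<close>)
      show "((\<lambda>x. e n x / (-2*pi*\<i>* of_int n)) has_vector_derivative e n x) (at x within {-1/2..1/2})"
        using has_vector_derivative_real_field[OF 2] by (simp add: e_def)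
    qed simp
    have "e n (1/2) = e n (-1/2)"
    proof -
      have "e n (-1/2) = e n (1/2) * exp (2 * of_int n * pi * \<i>)"
        unfolding e_def exp_add[symmetric] by (simp add: field_simps)
      also have "exp (2 * of_int n * pi * \<i>) = (1::complex)"
        using exp_integer_2pi[of "of_int n"] by simp
      finally show ?thesis by simp
    qed
    with D show ?thesis using False by (simp add: integral_unique)
  qed (simp add: e_def)
  have cn: "c n = integral {-1/2..1/2} (\<lambda>x. f (of_real x) * e n x)" for n by (simp add: c e_def)
  have tel: "c n - (if n = 0 then f 0 else 0) = d (n - 1) - d n" for n
  proof -
    have "c n - (if n = 0 then f 0 else 0) = integral {-1/2..1/2} (\<lambda>x. f (of_real x) * e n x) - f 0 * integral {-1/2..1/2} (e n)"
      by (simp only: int_e cn) auto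
    also have "\<dots> = integral {-1/2..1/2} (\<lambda>x. f (of_real x) * e n x - f 0 * e n x)"
      by (subst integral_diff) (auto intro!: integrable_continuous_interval continuous_intros contf[simplified] conte simp: integral_mult_right)
    also have "\<dots> = integral {-1/2..1/2} (\<lambda>x. h (of_real x) * e (n-1) x - h (of_real x) * e n x)"
    proof (rule integral_cong)
      fix x :: real assume x: "x \<in> {-1/2..1/2}"
      have "e (n-1) x = E (of_real x) * e n x"
        by (simp add: e_def E_def exp_add[symmetric] algebra_simps)
      then show "f (of_real x) * e n x - f 0 * e n x = h (of_real x) * e (n-1) x - h (of_real x) * e n x"
        using arg_cong[OF fh[OF sub[OF x]], of "\<lambda>y. y * e n x"] by (simp add: algebra_simps)
    qed
    also have "\<dots> = d (n-1) - d n" unfolding d_def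
      by (subst integral_diff) (auto intro!: integrable_continuous_interval continuous_intros conth[simplified] conte)
    finally show ?thesis .
  qed
  \<comment> \<open>Integration by parts: one derivative of \<open>h\<close> gives decay of order
    1/n, and boundary values of \<open>h\<close> only enter the constant.\<close>
  have "\<exists>B. \<forall>n. of_int \<bar>n\<bar> * norm (d n) \<le> (B::real)"
  proof -
    define B1 where "B1 = norm (h (1/2)) + norm (h (-1/2))"
    have "\<exists>B2. \<forall>x\<in>{-1/2..1/2}. norm (deriv h (of_real x)) \<le> B2"
    proof -
      have "bounded ((\<lambda>x::real. deriv h (of_real x)) ` {-1/2..1/2})"
        by (intro compact_imp_bounded compact_continuous_image contdh) auto
      then show ?thesis by (auto simp: bounded_iff)
    qed
    then obtain B2 where B2: "\<And>x. x\<in>{-1/2..1/2} \<Longrightarrow> norm (deriv h (of_real x)) \<le> B2" by blast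
    have "of_int \<bar>n\<bar> * norm (d n) \<le> B1 + B2" for n
    proof -
      have alg: "z = J - G" if "J - z = G" for G J z :: complex
        using that by (simp add: algebra_simps)
      let ?g = "\<lambda>x. h (of_real x) * e n x"
      let ?g' = "\<lambda>x::real. deriv h (of_real x) * e n x + (-2*pi*\<i>* of_int n) * (h (of_real x) * e n x)"
      have "(?g' has_integral ?g (1/2) - ?g (-1/2)) {-1/2..1/2}"
      proof (rule fundamental_theorem_of_calculus)
        fix x :: real assume x: "x \<in> {-1/2..1/2}"
        have 1: "(h has_field_derivative deriv h (of_real x)) (at (of_real x))"
          using hh sub[OF x] by (meson holomorphic_derivI open_ball)
        have 2: "((\<lambda>z. h z * exp (-2 * pi * \<i> * of_int n * z)) has_field_derivative ?g' x) (at (of_real x))"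
          by (rule derivative_eq_intros 1 refl)+ (simp add: e_def algebra_simps)
        show "(?g has_vector_derivative ?g' x) (at x within {-1/2..1/2})"
          using has_vector_derivative_real_field[OF 2] by (simp add: e_def)
      qed simp
      then have I: "integral {-1/2..1/2} ?g' = ?g (1/2) - ?g (-1/2)" by (rule integral_unique)
      have "integral {-1/2..1/2} ?g' = integral {-1/2..1/2} (\<lambda>x. deriv h (of_real x) * e n x) + (-2*pi*\<i>* of_int n) * d n"
        unfolding d_def
        by (subst integral_add) (auto intro!: integrable_continuous_interval continuous_intros contdh[simplified] conth[simplified] conte simp del: mult_minus_left minus_mult_left)
      then have eq: "(2*pi*\<i>* of_int n) * d n = integral {-1/2..1/2} (\<lambda>x. deriv h (of_real x) * e n x) - (?g (1/2) - ?g (-1/2))"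
        using I by (intro alg) simp
      have "norm (integral {-1/2..1/2} (\<lambda>x. deriv h (of_real x) * e n x)) \<le> B2 * (1/2 - (-1/2))"
        by (rule integral_bound) (auto intro!: continuous_intros contdh[simplified] conte B2 simp: norm_mult normE)
      moreover have "norm (?g (1/2) - ?g (-1/2)) \<le> B1"
        unfolding B1_def by (rule order_trans[OF norm_triangle_ineq4]) (simp add: norm_mult normE)
      ultimately have "norm ((2*pi*\<i>* of_int n) * d n) \<le> B2 + B1"
        unfolding eq by (intro order_trans[OF norm_triangle_ineq4]) auto
      moreover have "norm ((2*pi*\<i>* of_int n) * d n) = 2 * pi * (of_int \<bar>n\<bar> * norm (d n))"
        by (simp add: norm_mult)
      moreover have "1 * (of_int \<bar>n\<bar> * norm (d n)) \<le> 2 * pi * (of_int \<bar>n\<bar> * norm (d n))"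
        using pi_gt3 by (intro mult_right_mono) auto
      ultimately show ?thesis by linarith
    qed
    then show ?thesis by (intro exI allI)
  qed
  then obtain B where "\<forall>n. of_int \<bar>n\<bar> * norm (d n) \<le> (B::real)" ..
  then have B: "of_int \<bar>n\<bar> * norm (d n) \<le> B" for n by (rule spec)
  have lim0: "(\<lambda>k. d (s k)) \<longlonglongrightarrow> 0" if "\<And>k::nat. \<bar>s k\<bar> \<ge> int k + 0" for s
  proof (rule tendsto_0_le[where K=1])
    show "(\<lambda>k. B / real k) \<longlonglongrightarrow> 0" by real_asymp
    show "\<forall>\<^sub>F k in sequentially. norm (d (s k)) \<le> norm (B / real k) * 1"
    proof (rule eventually_mono[OF eventually_gt_at_top[of 0]])
      fix k :: nat assume k: "0 < k"
      have "real k * norm (d (s k)) \<le> of_int \<bar>s k\<bar> * norm (d (s k))"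
        using that[of k] by (intro mult_right_mono[OF _ norm_ge_zero]) linarith
      with B[of "s k"] have "real k * norm (d (s k)) \<le> B" by linarith
      then show "norm (d (s k)) \<le> norm (B / real k) * 1" using k
        by (simp add: pos_le_divide_eq mult.commute)
    qed
  qed
  have part: "(\<Sum>n\<in>{-int N..int N}. c n) = f 0 + d (- int N - 1) - d (int N)" for N
  proof -
    have "(\<Sum>n\<in>{-int N..int N}. c n - (if n = 0 then f 0 else 0)) = d (- int N - 1) - d (int N)"
      unfolding tel
    proof (induction N)
      case (Suc N)
      have s: "{-int (Suc N)..int (Suc N)} = insert (int (Suc N)) (insert (-int (Suc N)) {-int N..int N})" by auto
      have s2: "- int (Suc N) = - int N - 1" "int (Suc N) = int N + 1" by auto
      show ?case unfolding s by (simp add: Suc s2 del: of_nat_Suc)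
    qed (simp add: minus_diff_commute)
    then show ?thesis by (simp add: sum_subtractf algebra_simps)
  qed
  have "(\<lambda>N. (\<Sum>n\<in>{-int N..int N}. c n)) \<longlonglongrightarrow> (\<Sum>\<^sub>\<infinity>n. c n)"
  proof -
    have "filterlim (\<lambda>N. {-int N..int N}) (finite_subsets_at_top UNIV) sequentially"
      unfolding filterlim_finite_subsets_at_top
    proof (intro allI impI)
      fix X :: "int set" assume X: "finite X \<and> X \<subseteq> UNIV"
      then obtain m where m: "\<And>x. x \<in> X \<Longrightarrow> \<bar>x\<bar> \<le> m" 
        using that[of "Max (abs ` X)"] by auto
      show "\<forall>\<^sub>F N in sequentially. finite {-int N..int N} \<and> X \<subseteq> {-int N..int N} \<and> {-int N..int N} \<subseteq> UNIV"
        by (rule eventually_mono[OF eventually_ge_at_top[of "nat m"]]) (use m in \<open>force simp: nat_le_iff abs_le_iff\<close>)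
    qed
    with has_sum_infsum[OF sm] show ?thesis unfolding has_sum_def by (rule filterlim_compose)
  qed
  moreover have "(\<lambda>N. (\<Sum>n\<in>{-int N..int N}. c n)) \<longlonglongrightarrow> f 0 + 0 - 0"
    unfolding part by (intro tendsto_intros lim0) auto
  ultimately show ?thesis using LIMSEQ_unique by fastforce
qed

section \<open>Interchange of sums and integrals\<close>

lemma integrable_count_space_iff:
  fixes f :: "'a \<Rightarrow> 'b :: {banach, second_countable_topology}"
  shows "integrable (count_space A) f \<longleftrightarrow> (\<lambda>i. norm (f i)) summable_on A"
  using abs_summable_equivalent[of f A] by (simp add: Infinite_Set_Sum.abs_summable_on_def)

lemma integral_count_space_infsum:
  fixes f :: "'a \<Rightarrow> 'b :: {banach, second_countable_topology}"
  assumes "(\<lambda>i. norm (f i)) summable_on A"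
  shows "(\<integral>i. f i \<partial>count_space A) = (\<Sum>\<^sub>\<infinity>i\<in>A. f i)"
  using infsetsum_infsum[of f A] assms abs_summable_equivalent[of f A] by (simp add: infsetsum_def)

text \<open>Fubini's theorem for the counting measure times \<open>M\<close>, from summability of
  the L1 norms. The pointwise hypothesis in the last claim turns the inner integral over the
  counting measure into an \<open>infsum\<close> at every point.\<close>

lemma
  fixes f :: "'a :: countable \<Rightarrow> 'b \<Rightarrow> 'c :: {banach, second_countable_topology}"
  assumes "sigma_finite_measure M" and int: "\<And>i. integrable M (f i)"
    and sm: "(\<lambda>i. \<integral>x. norm (f i x) \<partial>M) summable_on UNIV"
  shows integrable_count_space_pair: "integrable (count_space UNIV \<Otimes>\<^sub>M M) (\<lambda>(i, x). f i x)" (is ?A)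
    and integral_count_space_pair: "(\<integral>z. (\<lambda>(i, x). f i x) z \<partial>(count_space UNIV \<Otimes>\<^sub>M M)) = (\<Sum>\<^sub>\<infinity>i. \<integral>x. f i x \<partial>M)" (is ?B)
    and summable_integrals: "(\<lambda>i. norm (\<integral>x. f i x \<partial>M)) summable_on UNIV" (is ?C)
    and infsum_integral_swap: "(\<And>x. x \<in> space M \<Longrightarrow> (\<lambda>i. norm (f i x)) summable_on UNIV) \<Longrightarrow>
      (\<Sum>\<^sub>\<infinity>i. \<integral>x. f i x \<partial>M) = (\<integral>x. (\<Sum>\<^sub>\<infinity>i. f i x) \<partial>M)" 
proof -
  interpret M: sigma_finite_measure M by fact
  interpret C: sigma_finite_measure "count_space (UNIV :: 'a set)"
    by (rule sigma_finite_measure_count_space)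
  interpret P: pair_sigma_finite "count_space (UNIV :: 'a set)" M ..
  show A: ?A
  proof (rule P.Fubini_integrable)
    show "(\<lambda>(i, x). f i x) \<in> borel_measurable (count_space UNIV \<Otimes>\<^sub>M M)"
      using int by (intro measurable_pair_measure_countable1) auto
    show "integrable (count_space UNIV) (\<lambda>i. \<integral>x. norm (case (i, x) of (i, x) \<Rightarrow> f i x) \<partial>M)"
      using sm by (simp add: integrable_count_space_iff)
    show "AE i in count_space UNIV. integrable M (\<lambda>x. case (i, x) of (i, x) \<Rightarrow> f i x)"
      using int by simp
  qed
  show C: ?C
    by (rule summable_on_comparison_test[OF sm]) auto
  show B: ?B
    using P.integral_fst'[OF A] integral_count_space_infsum[OF C] by simp
  show "(\<Sum>\<^sub>\<infinity>i. \<integral>x. f i x \<partial>M) = (\<integral>x. (\<Sum>\<^sub>\<infinity>i. f i x) \<partial>M)" if pw: "\<And>x. x \<in> space M \<Longrightarrow> (\<lambda>i. norm (f i x)) summable_on UNIV"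
  proof -
    have "(\<integral>x. (\<Sum>\<^sub>\<infinity>i. f i x) \<partial>M) = (\<integral>x. (\<integral>i. f i x \<partial>count_space UNIV) \<partial>M)"
      by (rule Bochner_Integration.integral_cong) (auto simp: integral_count_space_infsum pw)
    also have "\<dots> = (\<integral>z. (\<lambda>(i, x). f i x) z \<partial>(count_space UNIV \<Otimes>\<^sub>M M))"
      by (rule P.integral_snd[OF A])
    finally show ?thesis using B by simp
  qed
qed

text \<open>Half-open tiles partition the line exactly; the closed ones of the statement differ from
  them by null sets. With T = 1 this periodises a Gaussian, with T = arcosh M it unfolds the
  integral over one period of the boost.\<close>

lemma has_sum_integral_tiles:
  fixes g :: "real \<Rightarrow> 'c :: {banach, second_countable_topology}"
  assumes g: "integrable lborel g" and T: "T > 0"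
  shows "(\<lambda>k::int. norm (LINT t:{c + of_int k * T..c + (of_int k + 1) * T}|lborel. g t)) summable_on UNIV"
    and "(\<Sum>\<^sub>\<infinity>k::int. (LINT t:{c + of_int k * T..c + (of_int k + 1) * T}|lborel. g t)) = (LINT t|lborel. g t)"
proof -
  define A where "A = (\<lambda>k::int. {c + of_int k * T..<c + (of_int k + 1) * T})"
  have Asets: "A k \<in> sets lborel" for k by (simp add: A_def)
  have A_iff: "t \<in> A k \<longleftrightarrow> k = \<lfloor>(t - c) / T\<rfloor>" for t k
    using T by (auto simp: A_def eq_commute[of k] floor_eq_iff field_simps)
  define f where "f = (\<lambda>k t. indicat_real (A k) t *\<^sub>R g t)"
  have int_f: "integrable lborel (f k)" for k
    unfolding f_def using Asets by (intro integrable_mult_indicator g) simp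
  have sum_ind: "(\<Sum>k\<in>F. indicat_real (A k) t) \<le> 1" if "finite F" for F t
  proof -
    have "(\<Sum>k\<in>F. indicat_real (A k) t) = (\<Sum>k\<in>F. if k = \<lfloor>(t - c) / T\<rfloor> then 1 else 0)"
      by (rule sum.cong) (auto simp: A_iff indicator_def)
    also have "\<dots> \<le> 1" using that by simp
    finally show ?thesis .
  qed
  have sm: "(\<lambda>k. \<integral>t. norm (f k t) \<partial>lborel) summable_on UNIV"
  proof (rule nonneg_bdd_above_summable_on)
    show "bdd_above (sum (\<lambda>k. \<integral>t. norm (f k t) \<partial>lborel) ` {F. F \<subseteq> UNIV \<and> finite F})"
    proof (rule bdd_aboveI2)
      fix F :: "int set" assume F: "F \<in> {F. F \<subseteq> UNIV \<and> finite F}"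
      have "(\<Sum>k\<in>F. \<integral>t. norm (f k t) \<partial>lborel) = (\<integral>t. (\<Sum>k\<in>F. norm (f k t)) \<partial>lborel)"
        using int_f by (subst Bochner_Integration.integral_sum) auto
      also have "\<dots> \<le> (\<integral>t. norm (g t) \<partial>lborel)"
      proof (rule integral_mono)
        fix t
        have "(\<Sum>k\<in>F. norm (f k t)) = (\<Sum>k\<in>F. indicat_real (A k) t) * norm (g t)"
          by (simp add: f_def sum_distrib_right)
        also have "\<dots> \<le> 1 * norm (g t)" using F by (intro mult_right_mono sum_ind) auto
        finally show "(\<Sum>k\<in>F. norm (f k t)) \<le> norm (g t)" by simp
      qed (use int_f g in auto)
      finally show "(\<Sum>k\<in>F. \<integral>t. norm (f k t) \<partial>lborel) \<le> (\<integral>t. norm (g t) \<partial>lborel)" .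
    qed
  qed simp
  have single: "((\<lambda>k. f k t) has_sum g t) UNIV" for t
    by (rule has_sum_finite_neutralI[of "{\<lfloor>(t - c) / T\<rfloor>}"]) (auto simp: f_def indicator_def A_iff)
  have pw: "(\<lambda>k. norm (f k t)) summable_on UNIV" for t
    by (rule has_sum_imp_summable[OF has_sum_finite_neutralI[of "{\<lfloor>(t - c) / T\<rfloor>}"]])
       (auto simp: f_def indicator_def A_iff)
  have eq: "(\<integral>t. f k t \<partial>lborel) = (LINT t:{c + of_int k * T..c + (of_int k + 1) * T}|lborel. g t)" for k
    unfolding set_lebesgue_integral_def
  proof (rule integral_cong_AE)
    show "f k \<in> borel_measurable lborel" using int_f by auto
    show "(\<lambda>x. indicat_real {c + real_of_int k * T..c + (real_of_int k + 1) * T} x *\<^sub>R g x) \<in> borel_measurable lborel"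
      using g by (intro borel_measurable_scaleR borel_measurable_indicator) auto
    have "AE t in lborel. t \<noteq> c + (of_int k + 1) * T" by (rule AE_lborel_singleton)
    then show "AE x in lborel. f k x = indicat_real {c + real_of_int k * T..c + (real_of_int k + 1) * T} x *\<^sub>R g x"
      by eventually_elim (auto simp: f_def A_def indicator_def)
  qed
  show "(\<lambda>k::int. norm (LINT t:{c + of_int k * T..c + (of_int k + 1) * T}|lborel. g t)) summable_on UNIV"
    using summable_integrals[OF lborel.sigma_finite_measure_axioms int_f sm] by (simp add: eq)
  show "(\<Sum>\<^sub>\<infinity>k::int. (LINT t:{c + of_int k * T..c + (of_int k + 1) * T}|lborel. g t)) = (LINT t|lborel. g t)"
    using infsum_integral_swap[OF lborel.sigma_finite_measure_axioms int_f sm pw] single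
    by (simp add: eq has_sum_iff)
qed

section \<open>The Gaussian integral and the one-variable theta transformation\<close>

text \<open>Both claims reduce to the characteristic function of the standard normal law by the
  substitution \<open>s * (x + z)\<close> with s^2 = 2 pi / a.\<close>

lemma
  fixes a z :: real and n :: int
  assumes a: "a > 0"
  defines "g \<equiv> (\<lambda>x. of_real (exp (- pi * (x + z)\<^sup>2 / a)) * exp (-2 * pi * \<i> * of_int n * of_real x))"
  shows integrable_gaussian_fourier: "integrable lborel g"
    and integral_gaussian_fourier: "(LINT x|lborel. g x) = of_real (sqrt a) * exp (2 * pi * \<i> * of_int n * z) * of_real (exp (- pi * a * (of_int n)\<^sup>2))"
proof -
  define s where "s = sqrt (2 * pi / a)"
  define t where "t = - 2 * pi * of_int n / s"
  define h where "h = (\<lambda>x. std_normal_density x *\<^sub>R exp (\<i> * of_real (t * x)))"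
  have s: "s > 0" "s\<^sup>2 = 2 * pi / a" using a by (auto simp: s_def)
  have h_int: "integrable lborel h"
    unfolding h_def
    by (rule Bochner_Integration.integrable_bound[OF integrable_normal_density[of 1 0]]) auto
  have h_val: "(LINT x|lborel. h x) = exp (- (t\<^sup>2) / 2)"
    using char_std_normal_distribution
    by (simp add: fun_eq_iff char_def h_def integral_density normal_density_nonneg)
  have gh: "g x = of_real (sqrt (2 * pi)) * exp (2 * pi * \<i> * of_int n * z) * h (s * z + s * x)" for x
  proof -
    have 1: "std_normal_density (s * z + s * x) = exp (- pi * (x + z)\<^sup>2 / a) / sqrt (2 * pi)"
    proof -
      have "(s * z + s * x)\<^sup>2 = (2 * pi / a) * (x + z)\<^sup>2"
        unfolding s(2)[symmetric] by (simp add: power2_eq_square algebra_simps)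
      then show ?thesis by (simp add: std_normal_density_def)
    qed
    have 2: "t * (s * z + s * x) = - 2 * pi * of_int n * (z + x)"
      using s by (simp add: t_def field_simps)
    have "h (s * z + s * x) = of_real (exp (- pi * (x + z)\<^sup>2 / a)) / of_real (sqrt (2 * pi)) * exp (\<i> * of_real (- 2 * pi * of_int n * (z + x)))"
      unfolding h_def 1 2 by (simp add: scaleR_conv_of_real)
    moreover have "exp (2 * pi * \<i> * of_int n * z) * exp (\<i> * of_real (- 2 * pi * of_int n * (z + x))) = exp (-2 * pi * \<i> * of_int n * of_real x)"
      by (simp add: exp_add[symmetric] algebra_simps)
    ultimately show ?thesis
      using pi_gt_zero by (simp add: g_def mult_ac)
  qed
  have gh': "g = (\<lambda>x. of_real (sqrt (2 * pi)) * exp (2 * pi * \<i> * of_int n * z) * h (s * z + s * x))"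
    using gh by blast
  show "integrable lborel g" unfolding gh'
    using s h_int by (intro integrable_mult_right lborel_integrable_real_affine) auto
  have "(LINT x|lborel. h x) = s * (LINT x|lborel. h (s * z + s * x))"
    using lborel_integral_real_affine[of s h "s * z"] s by (simp add: scaleR_conv_of_real)
  then have "(LINT x|lborel. h (s * z + s * x)) = exp (- (t\<^sup>2) / 2) / s"
    using s h_val by (simp add: field_simps)
  then have "(LINT x|lborel. g x) = of_real (sqrt (2 * pi)) * exp (2 * pi * \<i> * of_int n * z) * (exp (- (t\<^sup>2) / 2) / s)"
    unfolding gh' by simp
  moreover have "t\<^sup>2 / 2 = pi * a * (of_int n)\<^sup>2"
    using s a by (simp add: t_def power_divide power_mult_distrib) (simp add: power2_eq_square)
  moreover have "sqrt (2 * pi) / s = sqrt a" using a by (simp add: s_def real_sqrt_divide)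
  moreover have "of_real (sqrt (2 * pi)) * w * (of_real y / s) = of_real (sqrt (2 * pi) / s) * w * of_real y" for w :: complex and y
    by simp
  ultimately show "(LINT x|lborel. g x) = of_real (sqrt a) * exp (2 * pi * \<i> * of_int n * z) * of_real (exp (- pi * a * (of_int n)\<^sup>2))"
    by simp
qed

lemma gauss_sum_shift:
  fixes a w :: complex
  assumes "Re a > 0"
  shows "exp (- of_real pi * w\<^sup>2 / a) * gauss_sum (of_real pi / a) (- 2 * of_real pi * w / a) = (\<Sum>\<^sub>\<infinity>m::int. exp (- of_real pi * (of_int m + w)\<^sup>2 / a))"
    and "(\<lambda>m::int. norm (exp (- of_real pi * (of_int m + w)\<^sup>2 / a))) summable_on UNIV"
proof -
  have eq: "exp (- of_real pi * (of_int m + w)\<^sup>2 / a) = exp (- of_real pi * w\<^sup>2 / a) * exp (- (of_real pi / a) * (of_int m)\<^sup>2 + (- 2 * of_real pi * w / a) * of_int m)" for m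
  proof -
    have a: "a \<noteq> 0" using assms by auto
    show ?thesis unfolding exp_add[symmetric] using a
      by (intro arg_cong[of _ _ exp]) (simp add: field_simps power2_eq_square)
  qed
  show "exp (- of_real pi * w\<^sup>2 / a) * gauss_sum (of_real pi / a) (- 2 * of_real pi * w / a) = (\<Sum>\<^sub>\<infinity>m::int. exp (- of_real pi * (of_int m + w)\<^sup>2 / a))"
    unfolding eq gauss_sum_def by (rule infsum_cmult_right'[symmetric])
  have "Re (of_real pi / a) > 0"
    using assms by (simp add: Re_divide sum_power2_gt_zero_iff)
  from abs_summable_gauss_sum[OF this]
  show "(\<lambda>m::int. norm (exp (- of_real pi * (of_int m + w)\<^sup>2 / a))) summable_on UNIV"
    unfolding eq norm_mult by (intro summable_on_cmult_right)
qed

text \<open>Poisson summation: the periodised Gaussian \<open>f\<close> extends holomorphically, its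
  Fourier coefficients unfold to Gaussian integrals over the whole line, and its Fourier series is
  evaluated at the origin.\<close>

lemma gauss_sum_transformation_real:
  fixes a z :: real
  assumes a: "a > 0"
  shows "exp (- of_real pi * (of_real z)\<^sup>2 / of_real a) * gauss_sum (of_real pi / of_real a) (- 2 * of_real pi * of_real z / of_real a)
    = of_real (sqrt a) * gauss_sum (of_real pi * of_real a) (2 * of_real pi * \<i> * of_real z)"
proof -
  define f where "f = (\<lambda>\<zeta>::complex. exp (- of_real pi * (\<zeta> + of_real z)\<^sup>2 / of_real a) * gauss_sum (of_real pi / of_real a) (- 2 * of_real pi * (\<zeta> + of_real z) / of_real a))"
  have f_sum: "f \<zeta> = (\<Sum>\<^sub>\<infinity>m::int. exp (- of_real pi * (of_int m + (\<zeta> + of_real z))\<^sup>2 / of_real a))" for \<zeta>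
    unfolding f_def by (rule gauss_sum_shift) (use a in simp)
  have hol: "f holomorphic_on ball 0 1"
    unfolding f_def using a by (intro holomorphic_intros holomorphic_on_gauss_sum) auto
  have per: "f (1/2) = f (-1/2)"
  proof -
    have "f (-1/2) = (\<Sum>\<^sub>\<infinity>m::int. exp (- of_real pi * (of_int (m + 1) + (-1/2 + of_real z))\<^sup>2 / of_real a))"
      unfolding f_sum by (rule infsum_reindex_bij_witness[of _ "\<lambda>m. m + 1" "\<lambda>m. m - 1"]) auto
    also have "\<dots> = f (1/2)"
      unfolding f_sum by (intro infsum_cong) (simp add: algebra_simps)
    finally show ?thesis by simp
  qed
  define c where "c = (\<lambda>n::int. of_real (sqrt a) * exp (2 * pi * \<i> * of_int n * z) * of_real (exp (- pi * a * (of_int n)\<^sup>2)))"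
  have cn: "c n = integral {-1/2..1/2} (\<lambda>x. f (of_real x) * exp (-2 * of_real pi * \<i> * of_int n * of_real x))" for n
  proof -
    define g where "g = (\<lambda>x. of_real (exp (- pi * (x + z)\<^sup>2 / a)) * exp (-2 * pi * \<i> * of_int n * of_real x))"
    have g: "integrable lborel g" and gval: "(LINT x|lborel. g x) = c n"
      unfolding g_def c_def by (rule integrable_gaussian_fourier[OF a], rule integral_gaussian_fourier[OF a])
    define F where "F = (\<lambda>m x. indicat_real {-1/2..1/2} x *\<^sub>R g (x + of_int m))"
    \<comment> \<open>Integer translations change the Gaussian only: the exponential has period
      one.\<close>
    have gm: "g (x + of_int m) = exp (- of_real pi * (of_int m + (of_real x + of_real z))\<^sup>2 / of_real a) * exp (-2 * of_real pi * \<i> * of_int n * of_real x)" for x m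
    proof -
      have "exp (-2 * of_real pi * \<i> * of_int n * of_real (x + of_int m)) = exp (-2 * of_real pi * \<i> * of_int n * of_real x) * exp (2 * of_int (- n * m) * of_real pi * \<i>)"
        by (simp add: exp_add[symmetric] algebra_simps)
      also have "exp (2 * of_int (- n * m) * of_real pi * \<i>) = (1::complex)"
        using exp_integer_2pi[of "of_int (- n * m)"] by simp
      finally show ?thesis unfolding g_def by (simp add: exp_of_real[symmetric] add_ac)
    qed
    have shift: "(LINT t:{-1/2 + of_int m * 1..-1/2 + (of_int m + 1) * 1}|lborel. h t)
         = (\<integral>x. indicat_real {-1/2..1/2} x *\<^sub>R h (x + of_int m) \<partial>lborel)" for m :: int and h :: "real \<Rightarrow> 'x::{banach, second_countable_topology}"
      unfolding set_lebesgue_integral_def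
      by (subst lborel_integral_real_affine[of 1 _ "of_int m"])
         (auto intro!: Bochner_Integration.integral_cong simp: indicator_def add_ac)
    have intF: "integrable lborel (F m)" for m
      unfolding F_def using lborel_integrable_real_affine[OF g, of 1 "of_int m"]
      by (intro integrable_mult_indicator) (auto simp: add_ac)
    have smF: "(\<lambda>m. \<integral>x. norm (F m x) \<partial>lborel) summable_on UNIV"
    proof -
      have "(\<integral>x. norm (F m x) \<partial>lborel) = norm (LINT t:{-1/2 + of_int m * 1..-1/2 + (of_int m + 1) * 1}|lborel. norm (g t))" for m
        unfolding shift by (simp add: F_def)
      then show ?thesis
        using has_sum_integral_tiles(1)[of "\<lambda>t. norm (g t)" 1 "-1/2"] g by simp
    qed
    have pwF: "(\<lambda>m. norm (F m x)) summable_on UNIV" for x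
      unfolding F_def norm_scaleR gm norm_mult
      by (intro summable_on_cmult_right summable_on_cmult_left gauss_sum_shift(2)) (use a in simp)
    have "c n = (\<Sum>\<^sub>\<infinity>m::int. (LINT t:{-1/2 + of_int m * 1..-1/2 + (of_int m + 1) * 1}|lborel. g t))"
      using has_sum_integral_tiles(2)[OF g, of 1 "-1/2"] gval by simp
    also have "\<dots> = (\<Sum>\<^sub>\<infinity>m::int. \<integral>x. F m x \<partial>lborel)" unfolding shift F_def ..
    also have "\<dots> = (\<integral>x. (\<Sum>\<^sub>\<infinity>m. F m x) \<partial>lborel)"
      by (rule infsum_integral_swap[OF lborel.sigma_finite_measure_axioms intF smF pwF])
    also have "\<dots> = (LINT x:{-1/2..1/2}|lborel. f (of_real x) * exp (-2 * of_real pi * \<i> * of_int n * of_real x))"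
      unfolding set_lebesgue_integral_def
    proof (rule Bochner_Integration.integral_cong)
      fix x :: real
      show "(\<Sum>\<^sub>\<infinity>m. F m x) = indicat_real {- 1/2..1/2} x *\<^sub>R (f (of_real x) * exp (-2 * of_real pi * \<i> * of_int n * of_real x))"
        unfolding F_def gm f_sum infsum_scaleR_right by (simp add: infsum_cmult_left')
    qed simp
    also have "\<dots> = integral {-1/2..1/2} (\<lambda>x. f (of_real x) * exp (-2 * of_real pi * \<i> * of_int n * of_real x))"
    proof (rule set_borel_integral_eq_integral)
      have "continuous_on {-1/2..1/2} (\<lambda>x::real. f (of_real x) * exp (-2 * of_real pi * \<i> * of_int n * of_real x))"
        by (intro continuous_intros continuous_on_compose2[OF holomorphic_on_imp_continuous_on[OF hol] continuous_on_of_real[OF continuous_on_id]])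
           auto
      then show "set_integrable lborel {-1/2..1/2} (\<lambda>x. f (of_real x) * exp (-2 * of_real pi * \<i> * of_int n * of_real x))"
        by (intro borel_integrable_atLeastAtMost') 
    qed
    finally show ?thesis .
  qed
  have c_eq: "c n = of_real (sqrt a) * exp (- (of_real pi * of_real a) * (of_int n)\<^sup>2 + (2 * of_real pi * \<i> * of_real z) * of_int n)" for n
    unfolding c_def exp_of_real[symmetric] by (simp add: exp_add[symmetric] algebra_simps)
  have "c summable_on UNIV"
    unfolding c_eq[abs_def] using a
    by (intro summable_on_cmult_right abs_summable_summable[OF abs_summable_gauss_sum]) simp
  from fourier_series_at_0[OF hol per cn this]
  have "f 0 = (\<Sum>\<^sub>\<infinity>n. c n)" ..
  then show ?thesis
    by (simp add: f_def c_eq infsum_cmult_right' gauss_sum_def)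
qed

text \<open>Two analytic continuations: in \<open>z\<close> from the real line while
  \<open>a\<close> is positive, then in \<open>a\<close> from the positive axis to the right
  half-plane, where \<open>csqrt\<close> is the holomorphic square root that is positive on that
  axis.\<close>

theorem gauss_sum_transformation:
  fixes a z :: complex
  assumes a: "Re a > 0"
  shows "gauss_sum (of_real pi * a) (2 * of_real pi * \<i> * z) = (\<Sum>\<^sub>\<infinity>m::int. exp (- of_real pi * (of_int m + z)\<^sup>2 / a)) / csqrt a"
proof -
  have real_a: "exp (- of_real pi * z\<^sup>2 / of_real a) * gauss_sum (of_real pi / of_real a) (- 2 * of_real pi * z / of_real a)
    = of_real (sqrt a) * gauss_sum (of_real pi * of_real a) (2 * of_real pi * \<i> * z)" if a: "a > 0" for a :: real and z :: complex
  proof -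
    have lim: "(0::complex) islimpt \<real>"
    proof (rule islimptI)
      fix T :: "complex set" assume T: "0 \<in> T" "open T"
      then obtain e where e: "e > 0" "cball 0 e \<subseteq> T" using open_contains_cball_eq[OF T(2), rule_format] T(1) by auto
      then show "\<exists>y\<in>\<real>. y \<in> T \<and> y \<noteq> 0" by (intro bexI[of _ "of_real e"]) auto
    qed
    define G where "G = (\<lambda>z::complex. exp (- of_real pi * z\<^sup>2 / of_real a) * gauss_sum (of_real pi / of_real a) (- 2 * of_real pi * z / of_real a)
        - of_real (sqrt a) * gauss_sum (of_real pi * of_real a) (2 * of_real pi * \<i> * z))"
    have "G z = 0"
    proof (rule analytic_continuation[of G UNIV \<real> 0])
      show "G holomorphic_on UNIV" unfolding G_def
        using a by (intro holomorphic_intros holomorphic_on_gauss_sum) auto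
      show "G z = 0" if "z \<in> \<real>" for z :: complex
        using that gauss_sum_transformation_real[OF a] by (auto simp: G_def elim!: Reals_cases)
    qed (use lim in auto)
    then show ?thesis by (simp add: G_def)
  qed
  define S where "S = {w. Re w > 0}"
  define U where "U = complex_of_real ` {0<..}"
  define G where "G = (\<lambda>a::complex. exp (- of_real pi * z\<^sup>2 / a) * gauss_sum (of_real pi / a) (- 2 * of_real pi * z / a)
        - csqrt a * gauss_sum (of_real pi * a) (2 * of_real pi * \<i> * z))"
  have "G a = 0"
  proof (rule analytic_continuation[of G S U 1])
    have S: "open S" "convex S" unfolding S_def by (rule open_halfspace_Re_gt, rule convex_halfspace_Re_gt)
    have nz: "w \<noteq> 0" "w \<notin> \<real>\<^sub>\<le>\<^sub>0" "Re (of_real pi / w) > 0" if "w \<in> S" for w :: complex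
      using that by (auto simp: S_def Re_divide complex_nonpos_Reals_iff sum_power2_gt_zero_iff)
    show "open S" "connected S" using S convex_connected by auto
    show "G holomorphic_on S" unfolding G_def
      using S nz by (intro holomorphic_intros holomorphic_on_gauss_sum) (auto simp: S_def)
    show "G w = 0" if "w \<in> U" for w
      using that real_a by (auto simp: G_def U_def)
    show "1 islimpt U"
    proof (rule islimptI)
      fix T :: "complex set" assume T: "1 \<in> T" "open T"
      then obtain e where e: "e > 0" "cball 1 e \<subseteq> T" using open_contains_cball_eq[OF T(2), rule_format] T(1) by auto
      then show "\<exists>y\<in>U. y \<in> T \<and> y \<noteq> 1"
        by (intro bexI[of _ "of_real (1 + e)"]) (auto simp: U_def dist_norm intro!: image_eqI[of _ _ "1 + e"])
    qed
    show "U \<subseteq> S" "1 \<in> S" "a \<in> S" using a by (auto simp: U_def S_def)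
  qed
  moreover have "csqrt a \<noteq> 0" using a by auto
  ultimately show ?thesis using gauss_sum_shift(1)[OF a, of z] by (simp add: G_def eq_divide_eq mult.commute)
qed

section \<open>Poisson summation for Gaussians in two variables\<close>

lemma summable_on_gaussian_int_shift:
  fixes e z :: real
  assumes "e > 0"
  shows "(\<lambda>n::int. exp (- e * (of_int n + z)\<^sup>2)) summable_on UNIV"
proof -
  have "Re (of_real (pi / e)) > 0" using assms by simp
  from gauss_sum_shift(2)[OF this, of "of_real z"]
  moreover have "- of_real pi * (of_int n + of_real z)\<^sup>2 / of_real (pi / e) = complex_of_real (- e * (of_int n + z)\<^sup>2)" for n
    using assms by (simp add: field_simps)
  ultimately have "(\<lambda>n::int. norm (exp (of_real (- e * (of_int n + z)\<^sup>2) :: complex))) summable_on UNIV"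
    by (simp only:)
  then show ?thesis unfolding norm_exp_eq_Re Re_complex_of_real .
qed

lemma summable_on_pair_prod:
  fixes f :: "'a \<Rightarrow> real" and g :: "'b \<Rightarrow> real"
  assumes "f summable_on UNIV" "g summable_on UNIV" "\<And>x. f x \<ge> 0" "\<And>y. g y \<ge> 0"
  shows "(\<lambda>(x, y). f x * g y) summable_on UNIV"
proof -
  have "(\<lambda>z. norm (f (fst z) * g (snd z))) summable_on (SIGMA x:UNIV. UNIV)"
    by (rule Infinite_Sum.abs_summable_on_Sigma_iff[where f="\<lambda>z. f (fst z) * g (snd z)", THEN iffD2])
       (use assms in \<open>auto simp: infsum_cmult_right' abs_mult infsum_nonneg intro!: summable_on_cmult_right summable_on_cmult_left\<close>)
  then show ?thesis using assms by (simp add: case_prod_unfold abs_mult)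
qed

text \<open>Determinant over trace bounds the smaller eigenvalue from below, because the larger one
  is at most the trace.\<close>

lemma quadratic_form_ge:
  fixes A B C x y :: real
  assumes "A > 0" "C > 0" "A * C > B\<^sup>2"
  shows "A * x\<^sup>2 + 2 * B * x * y + C * y\<^sup>2 \<ge> (A * C - B\<^sup>2) / (A + C) * (x\<^sup>2 + y\<^sup>2)"
proof -
  define e where "e = (A * C - B\<^sup>2) / (A + C)"
  have e: "e * (A + C) = A * C - B\<^sup>2" using assms by (simp add: e_def)
  have "A * (A + C) - e * (A + C) = A\<^sup>2 + B\<^sup>2" by (simp add: e) (simp add: power2_eq_square algebra_simps)
  then have "(A - e) * (A + C) > 0" using assms by (simp add: algebra_simps add_pos_nonneg)
  then have Ae: "A - e > 0" using assms by (simp add: zero_less_mult_iff)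
  have "(A - e) * (A * x\<^sup>2 + 2 * B * x * y + C * y\<^sup>2 - e * (x\<^sup>2 + y\<^sup>2)) = ((A - e) * x + B * y)\<^sup>2 + (A * C - B\<^sup>2 - e * (A + C) + e\<^sup>2) * y\<^sup>2"
    by (simp add: power2_eq_square algebra_simps)
  also have "\<dots> = ((A - e) * x + B * y)\<^sup>2 + e\<^sup>2 * y\<^sup>2" by (simp add: e)
  also have "\<dots> \<ge> 0" by simp
  finally show ?thesis using Ae unfolding e_def[symmetric] by (simp add: zero_le_mult_iff)
qed

lemma summable_on_gaussian_int2:
  fixes A B C z w :: real
  assumes "A > 0" "C > 0" "A * C > B\<^sup>2"
  shows "(\<lambda>(m::int, n::int). exp (- (A * (of_int m + z)\<^sup>2 + 2 * B * (of_int m + z) * (of_int n + w) + C * (of_int n + w)\<^sup>2))) summable_on UNIV"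
proof -
  define e where "e = (A * C - B\<^sup>2) / (A + C)"
  have e: "e > 0" using assms by (simp add: e_def)
  show ?thesis
  proof (rule summable_on_comparison_test)
    show "(\<lambda>(m::int, n::int). exp (- e * (of_int m + z)\<^sup>2) * exp (- e * (of_int n + w)\<^sup>2)) summable_on UNIV"
      by (intro summable_on_pair_prod summable_on_gaussian_int_shift e) auto
    fix x :: "int \<times> int"
    show "(case x of (m, n) \<Rightarrow> exp (- (A * (of_int m + z)\<^sup>2 + 2 * B * (of_int m + z) * (of_int n + w) + C * (of_int n + w)\<^sup>2)))
      \<le> (case x of (m, n) \<Rightarrow> exp (- e * (of_int m + z)\<^sup>2) * exp (- e * (of_int n + w)\<^sup>2))"
      using quadratic_form_ge[OF assms, of "of_int (fst x) + z" "of_int (snd x) + w"]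
      by (simp add: case_prod_beta exp_add[symmetric] e_def algebra_simps)
  qed (auto simp: case_prod_beta)
qed

text \<open>Both roots lie in the sector where the imaginary part is smaller in absolute value than
  the real part, so their product has positive real part and cannot be the negative root of
  \<open>D\<close>.\<close>

lemma csqrt_mult_positive:
  assumes "Re a > 0" "D > 0"
  shows "csqrt a * csqrt (of_real D / a) = of_real (sqrt D)"
proof -
  have dom: "\<bar>Im (csqrt x)\<bar> < Re (csqrt x)" if "Re x > 0" for x
  proof -
    have "Re x = Re ((csqrt x)\<^sup>2)" by simp
    also have "\<dots> = (Re (csqrt x))\<^sup>2 - (Im (csqrt x))\<^sup>2" by (simp only: Re_power2)
    finally have "(Im (csqrt x))\<^sup>2 < (Re (csqrt x))\<^sup>2" using that by linarith
    then show ?thesis using Re_csqrt[of x] by (auto intro: power2_less_imp_less)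
  qed
  have d: "Re (of_real D / a) > 0" using assms by (simp add: Re_divide sum_power2_gt_zero_iff)
  define P where "P = csqrt a * csqrt (of_real D / a)"
  have "a \<noteq> 0" using assms by auto
  then have "P\<^sup>2 = of_real D" by (simp add: P_def power_mult_distrib)
  also have "\<dots> = (of_real (sqrt D))\<^sup>2" using assms by (simp flip: of_real_power)
  finally have "P = of_real (sqrt D) \<or> P = - of_real (sqrt D)" by (simp add: power2_eq_iff)
  moreover have "Re P > 0"
  proof -
    have "Im (csqrt a) * Im (csqrt (of_real D / a)) \<le> \<bar>Im (csqrt a)\<bar> * \<bar>Im (csqrt (of_real D / a))\<bar>"
      by (metis abs_ge_self abs_mult)
    also have "\<dots> < Re (csqrt a) * Re (csqrt (of_real D / a))"
      using dom[OF assms(1)] dom[OF d] by (intro mult_strict_mono') auto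
    finally show ?thesis by (simp only: P_def times_complex.sel)
  qed
  ultimately show ?thesis using assms unfolding P_def[symmetric] by auto
qed

text \<open>The one-variable formula is applied twice. The sum over m turns the cross term into the
  imaginary shift i b n; completing the square then leaves n with the coefficient
  \<open>d = D / a\<close>, which is c - b^2 / a. Absolute convergence of the half-transformed
  series \<open>h\<close> allows the change of order in between.\<close>

lemma poisson_summation_gaussian2:
  fixes a c :: complex and b z w D :: real
  assumes a: "Re a > 0" and c: "Re c > 0" and pos: "Re a * Re c > b\<^sup>2" and D: "D > 0" and ac: "a * c = of_real (D + b\<^sup>2)"
  shows "(\<Sum>\<^sub>\<infinity>(m::int, n::int). exp (- of_real pi * (a * of_int m ^ 2 + 2 * b * of_int m * of_int n + c * of_int n ^ 2)) *
      exp (2 * of_real pi * \<i> * (of_int m * of_real z + of_int n * of_real w)))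
    = (\<Sum>\<^sub>\<infinity>(k::int, l::int). exp (- of_real pi * (c * (of_int k + z)\<^sup>2 - 2 * b * (of_int k + z) * (of_int l + w) + a * (of_int l + w)\<^sup>2) / D)) / of_real (sqrt D)"
    (is "(\<Sum>\<^sub>\<infinity>(m, n). ?L m n) = (\<Sum>\<^sub>\<infinity>(k, l). ?R k l) / _")
proof -
  define d where "d = of_real D / a"
  have a0: "a \<noteq> 0" using a by auto
  have d: "Re d > 0" using a D by (simp add: d_def Re_divide sum_power2_gt_zero_iff)
  have c_eq: "c = of_real (D + b\<^sup>2) / a" using ac a0 by (simp add: field_simps)
  define h where "h = (\<lambda>k n. exp (- of_real pi * ((of_int k + of_real z + \<i> * b * of_int n)\<^sup>2 / a + c * of_int n ^ 2)) * exp (2 * of_real pi * \<i> * of_int n * of_real w))"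
  have S1: "(\<lambda>(m, n). ?L m n) summable_on UNIV \<times> UNIV"
  proof (rule abs_summable_summable)
    have "(\<lambda>z. norm (case z of (m, n) \<Rightarrow> ?L m n)) = (\<lambda>(m::int, n::int). exp (- (pi * Re a * (of_int m + 0)\<^sup>2 + 2 * (pi * b) * (of_int m + 0) * (of_int n + 0) + pi * Re c * (of_int n + 0)\<^sup>2)))"
      by (auto simp: fun_eq_iff norm_mult algebra_simps simp flip: of_int_power)
    moreover have "(\<lambda>(m::int, n::int). exp (- (pi * Re a * (of_int m + 0)\<^sup>2 + 2 * (pi * b) * (of_int m + 0) * (of_int n + 0) + pi * Re c * (of_int n + 0)\<^sup>2))) summable_on UNIV"
      using a c pos by (intro summable_on_gaussian_int2) (auto simp: power_mult_distrib power2_eq_square)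
    ultimately show "(\<lambda>z. norm (case z of (m, n) \<Rightarrow> ?L m n)) summable_on UNIV \<times> UNIV" by simp
  qed
  have S2: "(\<lambda>(k, n). h k n) summable_on UNIV \<times> UNIV"
  proof (rule abs_summable_summable)
    define p q where "p = Re (1 / a)" and "q = Im (1 / a)"
    have inva: "1 / a = of_real p + \<i> * of_real q" by (simp add: p_def q_def complex_eq_iff)
    have p: "p > 0" using a by (simp add: p_def Re_divide sum_power2_gt_zero_iff)
    \<comment> \<open>Definiteness of the form in the exponent of \<open>norm (h k n)\<close>. As
      p^2 + q^2 is the inverse square of \<open>cmod a\<close>, it is the hypothesis
      \<open>pos\<close> divided by the square of \<open>cmod a\<close>.\<close>
    have pq: "p * (Re c - p * b\<^sup>2) > (- q * b)\<^sup>2"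
    proof -
      have n2: "(cmod a)\<^sup>2 > 0" using a0 by simp
      have "p\<^sup>2 + q\<^sup>2 = (cmod (1 / a))\<^sup>2" by (simp add: cmod_power2 p_def q_def)
      also have "\<dots> = 1 / (cmod a)\<^sup>2" by (simp add: norm_divide power_divide)
      finally have e1: "p\<^sup>2 + q\<^sup>2 = 1 / (cmod a)\<^sup>2" .
      have e2: "p = Re a / (cmod a)\<^sup>2" by (simp add: p_def Re_divide cmod_power2)
      have "b\<^sup>2 / (cmod a)\<^sup>2 < Re a * Re c / (cmod a)\<^sup>2" using pos n2 by (intro divide_strict_right_mono)
      then have "b\<^sup>2 * (p\<^sup>2 + q\<^sup>2) < p * Re c" unfolding e1 unfolding e2 by simp
      then show ?thesis by (simp add: power2_eq_square algebra_simps)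
    qed
    have "(q * b)\<^sup>2 \<ge> 0" by simp
    with pq have "p * (Re c - p * b\<^sup>2) > 0" by (metis le_less_trans zero_le_power2)
    then have C: "Re c - p * b\<^sup>2 > 0" using p by (simp add: zero_less_mult_iff)
    have nh: "norm (h k n) = exp (- (pi * p * (of_int k + z)\<^sup>2 + 2 * (pi * (- q * b)) * (of_int k + z) * (of_int n + 0) + pi * (Re c - p * b\<^sup>2) * (of_int n + 0)\<^sup>2))" for k n
    proof -
      have "(of_int k + of_real z + \<i> * b * of_int n)\<^sup>2 / a = (of_int k + of_real z + \<i> * b * of_int n)\<^sup>2 * (1 / a)" by simp
      also have "\<dots> = (of_real ((of_int k + z)\<^sup>2 - b\<^sup>2 * (of_int n)\<^sup>2) + \<i> * of_real (2 * (of_int k + z) * b * of_int n)) * (of_real p + \<i> * of_real q)"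
        unfolding inva by (simp add: power2_eq_square algebra_simps)
      finally have "Re ((of_int k + of_real z + \<i> * b * of_int n)\<^sup>2 / a) = ((of_int k + z)\<^sup>2 - b\<^sup>2 * (of_int n)\<^sup>2) * p - 2 * (of_int k + z) * b * of_int n * q"
        by simp
      moreover have "Re (c * of_int n ^ 2) = Re c * (of_int n)\<^sup>2" by (simp flip: of_int_power)
      moreover have "norm (h k n) = exp (- pi * (Re ((of_int k + of_real z + \<i> * b * of_int n)\<^sup>2 / a) + Re (c * of_int n ^ 2)))"
        by (simp add: h_def norm_mult)
      ultimately show ?thesis by (simp only:) (simp add: algebra_simps)
    qed
    have "(\<lambda>z. norm (case z of (k, n) \<Rightarrow> h k n)) = (\<lambda>(k, n). exp (- (pi * p * (of_int k + z)\<^sup>2 + 2 * (pi * (- q * b)) * (of_int k + z) * (of_int n + 0) + pi * (Re c - p * b\<^sup>2) * (of_int n + 0)\<^sup>2)))"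
      using nh by (auto simp only: fun_eq_iff split: prod.splits)
    moreover have "(\<lambda>(k::int, n::int). exp (- (pi * p * (of_int k + z)\<^sup>2 + 2 * (pi * (- q * b)) * (of_int k + z) * (of_int n + 0) + pi * (Re c - p * b\<^sup>2) * (of_int n + 0)\<^sup>2))) summable_on UNIV"
    proof (rule summable_on_gaussian_int2)
      show "(pi * (- q * b))\<^sup>2 < pi * p * (pi * (Re c - p * b\<^sup>2))"
        using mult_strict_left_mono[OF pq, of "pi * pi"] by (simp add: power_mult_distrib power2_eq_square mult_ac)
    qed (use p C in auto)
    ultimately show "(\<lambda>z. norm (case z of (k, n) \<Rightarrow> h k n)) summable_on UNIV \<times> UNIV" by simp
  qed
  have S3: "(\<lambda>(k, l). ?R k l) summable_on UNIV \<times> UNIV"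
  proof (rule abs_summable_summable)
    have "(\<lambda>z. norm (case z of (k, l) \<Rightarrow> ?R k l)) = (\<lambda>(k::int, l::int). exp (- (pi * Re c / D * (of_int k + z)\<^sup>2 + 2 * (- pi * b / D) * (of_int k + z) * (of_int l + w) + pi * Re a / D * (of_int l + w)\<^sup>2)))"
    proof (intro ext, clarify)
      fix k l :: int
      define x y where "x = of_int k + z" and "y = of_int l + w"
      have xy: "of_int k + of_real z = complex_of_real x" "of_int l + of_real w = complex_of_real y" by (auto simp: x_def y_def)
      show "norm (?R k l) = exp (- (pi * Re c / D * (of_int k + z)\<^sup>2 + 2 * (- pi * b / D) * (of_int k + z) * (of_int l + w) + pi * Re a / D * (of_int l + w)\<^sup>2))"
        unfolding xy x_def[symmetric] y_def[symmetric] using D by (simp add: field_simps flip: of_real_power of_real_mult)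
    qed
    moreover have "(\<lambda>(k::int, l::int). exp (- (pi * Re c / D * (of_int k + z)\<^sup>2 + 2 * (- pi * b / D) * (of_int k + z) * (of_int l + w) + pi * Re a / D * (of_int l + w)\<^sup>2))) summable_on UNIV"
    proof (rule summable_on_gaussian_int2)
      have "b\<^sup>2 * (pi * pi / (D * D)) < Re a * Re c * (pi * pi / (D * D))"
        using pos D by (intro mult_strict_right_mono) auto
      then show "(- pi * b / D)\<^sup>2 < pi * Re c / D * (pi * Re a / D)"
        by (simp add: power2_eq_square mult_ac)
    qed (use a c D in auto)
    ultimately show "(\<lambda>z. norm (case z of (k, l) \<Rightarrow> ?R k l)) summable_on UNIV \<times> UNIV" by simp
  qed
  have inner1: "(\<Sum>\<^sub>\<infinity>m. ?L m n) = (\<Sum>\<^sub>\<infinity>k. h k n) / csqrt a" for n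
  proof -
    have "?L m n = exp (- of_real pi * c * of_int n ^ 2) * exp (2 * of_real pi * \<i> * of_int n * of_real w) * exp (- (of_real pi * a) * (of_int m)\<^sup>2 + (2 * of_real pi * \<i> * (of_real z + \<i> * b * of_int n)) * of_int m)" for m
      by (simp add: exp_add[symmetric] algebra_simps)
    then have "(\<Sum>\<^sub>\<infinity>m. ?L m n) = exp (- of_real pi * c * of_int n ^ 2) * exp (2 * of_real pi * \<i> * of_int n * of_real w) * gauss_sum (of_real pi * a) (2 * of_real pi * \<i> * (of_real z + \<i> * b * of_int n))"
      by (simp only: infsum_cmult_right' gauss_sum_def)
    also have "\<dots> = (exp (- of_real pi * c * of_int n ^ 2) * exp (2 * of_real pi * \<i> * of_int n * of_real w) * (\<Sum>\<^sub>\<infinity>k::int. exp (- of_real pi * (of_int k + (of_real z + \<i> * b * of_int n))\<^sup>2 / a))) / csqrt a"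
      by (simp only: gauss_sum_transformation[OF a] times_divide_eq_right)
    also have "exp (- of_real pi * c * of_int n ^ 2) * exp (2 * of_real pi * \<i> * of_int n * of_real w) * (\<Sum>\<^sub>\<infinity>k::int. exp (- of_real pi * (of_int k + (of_real z + \<i> * b * of_int n))\<^sup>2 / a))
       = (\<Sum>\<^sub>\<infinity>k. h k n)"
      unfolding infsum_cmult_right'[symmetric] h_def
      by (intro infsum_cong) (simp add: exp_add[symmetric] algebra_simps)
    finally show ?thesis .
  qed
  have inner2: "(\<Sum>\<^sub>\<infinity>n. h k n) = (\<Sum>\<^sub>\<infinity>l. ?R k l) / csqrt d" for k
  proof -
    define \<kappa> where "\<kappa> = complex_of_int k + of_real z"
    have "h k n = exp (- of_real pi * \<kappa>\<^sup>2 / a) * exp (- (of_real pi * d) * (of_int n)\<^sup>2 + (2 * of_real pi * \<i> * (of_real w - b * \<kappa> / a)) * of_int n)" for n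
    proof -
      have "(\<kappa> + \<i> * b * of_int n)\<^sup>2 / a + c * of_int n ^ 2 = \<kappa>\<^sup>2 / a + d * of_int n ^ 2 + 2 * \<i> * (b * \<kappa> / a) * of_int n"
        unfolding c_eq d_def using a0 by (simp add: field_simps power2_eq_square)
      then show ?thesis
        unfolding h_def \<kappa>_def[symmetric] by (simp add: exp_add[symmetric] algebra_simps)
    qed
    then have "(\<Sum>\<^sub>\<infinity>n. h k n) = exp (- of_real pi * \<kappa>\<^sup>2 / a) * gauss_sum (of_real pi * d) (2 * of_real pi * \<i> * (of_real w - b * \<kappa> / a))"
      by (simp only: infsum_cmult_right' gauss_sum_def)
    also have "\<dots> = (exp (- of_real pi * \<kappa>\<^sup>2 / a) * (\<Sum>\<^sub>\<infinity>l::int. exp (- of_real pi * (of_int l + (of_real w - b * \<kappa> / a))\<^sup>2 / d))) / csqrt d"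
      by (simp only: gauss_sum_transformation[OF d] times_divide_eq_right)
    also have "exp (- of_real pi * \<kappa>\<^sup>2 / a) * (\<Sum>\<^sub>\<infinity>l::int. exp (- of_real pi * (of_int l + (of_real w - b * \<kappa> / a))\<^sup>2 / d)) = (\<Sum>\<^sub>\<infinity>l. ?R k l)"
      unfolding infsum_cmult_right'[symmetric]
    proof (intro infsum_cong)
      fix l :: int
      define \<mu> where "\<mu> = complex_of_int l + of_real w"
      have D0: "complex_of_real D \<noteq> 0" using D by simp
      have "\<kappa>\<^sup>2 / a + (\<mu> - b * \<kappa> / a)\<^sup>2 / d = (c * \<kappa>\<^sup>2 - 2 * b * \<kappa> * \<mu> + a * \<mu>\<^sup>2) / D"
        unfolding c_eq d_def using a0 D0 by (simp add: field_simps power2_eq_square)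
      moreover have "- of_real pi * \<kappa>\<^sup>2 / a + - of_real pi * (\<mu> - b * \<kappa> / a)\<^sup>2 / d = - of_real pi * (\<kappa>\<^sup>2 / a + (\<mu> - b * \<kappa> / a)\<^sup>2 / d)"
        by (simp add: distrib_left)
      moreover have "of_int l + (of_real w - b * \<kappa> / a) = \<mu> - b * \<kappa> / a" by (simp add: \<mu>_def)
      ultimately show "exp (- of_real pi * \<kappa>\<^sup>2 / a) * exp (- of_real pi * (of_int l + (of_real w - b * \<kappa> / a))\<^sup>2 / d) = ?R k l"
        by (simp only: exp_add[symmetric] times_divide_eq_right) (simp add: \<kappa>_def \<mu>_def)
    qed
    finally show ?thesis .
  qed
  have "(\<Sum>\<^sub>\<infinity>(m, n). ?L m n) = (\<Sum>\<^sub>\<infinity>m. \<Sum>\<^sub>\<infinity>n. ?L m n)"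
    using infsum_Sigma'_banach[OF S1] by simp
  also have "\<dots> = (\<Sum>\<^sub>\<infinity>n. \<Sum>\<^sub>\<infinity>m. ?L m n)" by (rule infsum_swap_banach[OF S1])
  also have "\<dots> = (\<Sum>\<^sub>\<infinity>n. \<Sum>\<^sub>\<infinity>k. h k n) / csqrt a"
    unfolding inner1 divide_inverse by (rule infsum_cmult_left')
  also have "(\<Sum>\<^sub>\<infinity>n. \<Sum>\<^sub>\<infinity>k. h k n) = (\<Sum>\<^sub>\<infinity>k. \<Sum>\<^sub>\<infinity>n. h k n)" by (rule infsum_swap_banach[OF S2, symmetric])
  also have "\<dots> = (\<Sum>\<^sub>\<infinity>k. \<Sum>\<^sub>\<infinity>l. ?R k l) / csqrt d"
    unfolding inner2 divide_inverse by (rule infsum_cmult_left')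
  also have "(\<Sum>\<^sub>\<infinity>k. \<Sum>\<^sub>\<infinity>l. ?R k l) = (\<Sum>\<^sub>\<infinity>(k, l). ?R k l)"
    using infsum_Sigma'_banach[OF S3] by simp
  finally show ?thesis using csqrt_mult_positive[OF a D] by (simp add: d_def mult.commute)
qed

section \<open>Theta functions and the finite Weil representation\<close>

definition boost1 :: "real \<Rightarrow> real \<Rightarrow> real \<Rightarrow> real \<Rightarrow> real \<Rightarrow> real" where
  "boost1 p r t x y = x / sqrt p * cosh t + y / sqrt r * sinh t"

definition boost2 :: "real \<Rightarrow> real \<Rightarrow> real \<Rightarrow> real \<Rightarrow> real \<Rightarrow> real" where
  "boost2 p r t x y = x / sqrt p * sinh t + y / sqrt r * cosh t"

text \<open>The kernel of Siegel's theta function in signature (1,1): \<open>\<tau>\<close> goes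
  with the positive and \<open>cnj \<tau>\<close> with the negative direction determined by the
  boost \<open>t\<close>.\<close>

definition kern :: "real \<Rightarrow> real \<Rightarrow> complex \<Rightarrow> real \<Rightarrow> real \<Rightarrow> real \<Rightarrow> complex" where
  "kern p r \<tau> t x y = exp (of_real pi * \<i> * (\<tau> * of_real ((boost1 p r t x y)\<^sup>2) - cnj \<tau> * of_real ((boost2 p r t x y)\<^sup>2)))"

lemma boost_diff_squares:
  assumes "p > 0" "r > 0"
  shows "(boost1 p r t x y)\<^sup>2 - (boost2 p r t x y)\<^sup>2 = x\<^sup>2 / p - y\<^sup>2 / r"
proof -
  have "(boost1 p r t x y)\<^sup>2 - (boost2 p r t x y)\<^sup>2 = ((x / sqrt p)\<^sup>2 - (y / sqrt r)\<^sup>2) * ((cosh t)\<^sup>2 - (sinh t)\<^sup>2)"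
    by (simp add: boost1_def boost2_def power2_eq_square algebra_simps)
  also have "\<dots> = x\<^sup>2 / p - y\<^sup>2 / r"
    using assms by (simp add: power_divide cosh_square_eq)
  finally show ?thesis .
qed

lemma boost_sum_squares:
  assumes "p > 0" "r > 0"
  shows "(boost1 p r t x y)\<^sup>2 + (boost2 p r t x y)\<^sup>2 = (x\<^sup>2 / p + y\<^sup>2 / r) * cosh (2 * t) + 2 * (x * y / sqrt (p * r)) * sinh (2 * t)"
proof -
  have "(boost1 p r t x y)\<^sup>2 + (boost2 p r t x y)\<^sup>2 = ((x / sqrt p)\<^sup>2 + (y / sqrt r)\<^sup>2) * ((cosh t)\<^sup>2 + (sinh t)\<^sup>2) + 2 * ((x / sqrt p) * (y / sqrt r)) * (2 * sinh t * cosh t)"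
    by (simp add: boost1_def boost2_def power2_eq_square algebra_simps)
  also have "(cosh t)\<^sup>2 + (sinh t)\<^sup>2 = cosh (2 * t)" by (simp add: cosh_double)
  also have "2 * sinh t * cosh t = sinh (2 * t)" by (simp add: sinh_double)
  finally show ?thesis using assms by (simp add: power_divide real_sqrt_mult)
qed

lemma kern_eq:
  assumes "p > 0" "r > 0"
  shows "kern p r \<tau> t x y = exp (\<i> * of_real (pi * Re \<tau> * (x\<^sup>2 / p - y\<^sup>2 / r)) - of_real (pi * Im \<tau> * ((boost1 p r t x y)\<^sup>2 + (boost2 p r t x y)\<^sup>2)))"
proof -
  have "of_real pi * \<i> * (\<tau> * of_real A - cnj \<tau> * of_real B) = \<i> * of_real (pi * Re \<tau> * (A - B)) - of_real (pi * Im \<tau> * (A + B))" for A B :: real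
    by (simp add: complex_eq_iff algebra_simps)
  then show ?thesis unfolding kern_def boost_diff_squares[OF assms, symmetric, of _ _ t] by (simp only:)
qed

lemma norm_kern:
  assumes "p > 0" "r > 0"
  shows "norm (kern p r \<tau> t x y) = exp (- pi * Im \<tau> * ((boost1 p r t x y)\<^sup>2 + (boost2 p r t x y)\<^sup>2))"
  by (simp add: kern_eq[OF assms])

lemma kern_quadratic:
  assumes "p > 0" "r > 0"
  shows "kern p r \<tau> t x y = exp (- of_real pi * ((of_real (Im \<tau> * cosh (2 * t)) - \<i> * of_real (Re \<tau>)) / of_real p * of_real (x\<^sup>2)
     + 2 * of_real (Im \<tau> * sinh (2 * t) / sqrt (p * r)) * of_real x * of_real y + (of_real (Im \<tau> * cosh (2 * t)) + \<i> * of_real (Re \<tau>)) / of_real r * of_real (y\<^sup>2)))"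
  unfolding kern_eq[OF assms] boost_sum_squares[OF assms]
  by (rule arg_cong[of _ _ exp]) (use assms in \<open>simp add: complex_eq_iff algebra_simps\<close>)

lemma summable_on_kern:
  assumes pr: "p > 0" "r > 0" and "Im \<tau> > 0"
  shows "(\<lambda>(m::int, n::int). norm (kern p r \<tau> t (of_int m) (of_int n))) summable_on UNIV"
proof -
  define A where "A = pi * Im \<tau> * cosh (2 * t) / p"
  define B where "B = pi * Im \<tau> * sinh (2 * t) / sqrt (p * r)"
  define C where "C = pi * Im \<tau> * cosh (2 * t) / r"
  have "(cosh (2 * t))\<^sup>2 > (sinh (2 * t))\<^sup>2" by (simp add: cosh_square_eq)
  then have "(pi * Im \<tau>)\<^sup>2 / (p * r) * (cosh (2 * t))\<^sup>2 > (pi * Im \<tau>)\<^sup>2 / (p * r) * (sinh (2 * t))\<^sup>2"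
    using assms by (intro mult_strict_left_mono) auto
  then have "A * C > B\<^sup>2" using assms
    by (simp add: A_def B_def C_def power_divide power_mult_distrib power2_eq_square mult_ac)
  moreover have "A > 0" "C > 0" using assms by (auto simp: A_def C_def)
  ultimately have "(\<lambda>(m::int, n::int). exp (- (A * (of_int m + 0)\<^sup>2 + 2 * B * (of_int m + 0) * (of_int n + 0) + C * (of_int n + 0)\<^sup>2))) summable_on UNIV"
    by (intro summable_on_gaussian_int2)
  moreover have "norm (kern p r \<tau> t x y) = exp (- (A * (x + 0)\<^sup>2 + 2 * B * (x + 0) * (y + 0) + C * (y + 0)\<^sup>2))" for x y
    unfolding norm_kern[OF pr] boost_sum_squares[OF pr]
    by (rule arg_cong[of _ _ exp]) (simp add: A_def B_def C_def algebra_simps)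
  ultimately show ?thesis by simp
qed

lemma ee_add: "ee (a + b) = ee a * ee b" by (simp add: ee_def exp_add distrib_left)

text \<open>In the normal form of \<open>kern_quadratic\<close> the determinant a c - b^2 is the
  square of \<open>cmod \<tau>\<close> over p r, because cosh^2 - sinh^2 = 1. It is real and
  positive, so the two-variable formula applies and inversion brings in no complex square
  root.\<close>

lemma kern_poisson:
  assumes p: "p > 0" and r: "r > 0" and v: "Im \<tau> > 0"
  shows "(\<Sum>\<^sub>\<infinity>(m::int, n::int). kern p r \<tau> t (of_int m) (of_int n) * ee (of_real (of_int m * h / p - of_int n * h' / r)))
    = (\<Sum>\<^sub>\<infinity>(k::int, l::int). kern p r (- 1 / \<tau>) t (h + p * of_int k) (h' - r * of_int l)) * of_real (sqrt (p * r) / cmod \<tau>)"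
proof -
  define a where "a = (of_real (Im \<tau> * cosh (2 * t)) - \<i> * of_real (Re \<tau>)) / complex_of_real p"
  define c where "c = (of_real (Im \<tau> * cosh (2 * t)) + \<i> * of_real (Re \<tau>)) / complex_of_real r"
  define b where "b = Im \<tau> * sinh (2 * t) / sqrt (p * r)"
  define D where "D = (cmod \<tau>)\<^sup>2 / (p * r)"
  have n0: "(cmod \<tau>)\<^sup>2 > 0" "cmod \<tau> > 0" using v by auto
  have ch: "(cosh (2 * t))\<^sup>2 = (sinh (2 * t))\<^sup>2 + 1" by (simp add: cosh_square_eq)
  have D: "D > 0" using p r n0 by (simp add: D_def)
  have a: "Re a > 0" and c: "Re c > 0" using p r v by (auto simp: a_def c_def)
  have pos: "Re a * Re c > b\<^sup>2"
  proof -
    have "(Im \<tau>)\<^sup>2 / (p * r) * (cosh (2 * t))\<^sup>2 > (Im \<tau>)\<^sup>2 / (p * r) * (sinh (2 * t))\<^sup>2"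
      using p r v by (intro mult_strict_left_mono) (auto simp: ch)
    then show ?thesis using p r by (simp add: a_def b_def c_def power_divide power_mult_distrib power2_eq_square mult_ac)
  qed
  have Db: "D + b\<^sup>2 = ((Im \<tau> * cosh (2 * t))\<^sup>2 + (Re \<tau>)\<^sup>2) / (p * r)"
  proof -
    have "b\<^sup>2 = (Im \<tau> * sinh (2 * t))\<^sup>2 / (p * r)" using p r by (simp add: b_def power_divide)
    then show ?thesis by (simp add: D_def cmod_power2 power_mult_distrib ch add_divide_distrib distrib_left)
  qed
  have ac: "a * c = of_real (D + b\<^sup>2)"
  proof -
    have "(of_real s - \<i> * of_real u) * (of_real s + \<i> * of_real u) = complex_of_real (s\<^sup>2 + u\<^sup>2)" for s u :: real
      by (simp add: power2_eq_square algebra_simps)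
    from this[of "Im \<tau> * cosh (2 * t)" "Re \<tau>"] show ?thesis
      unfolding Db a_def c_def by (simp only: times_divide_times_eq of_real_divide of_real_mult)
  qed
  define s where "s = complex_of_real (Im \<tau> * cosh (2 * t))"
  define u where "u = \<i> * complex_of_real (Re \<tau>)"
  have as: "a = (s - u) / p" and cs: "c = (s + u) / r" by (auto simp: a_def c_def s_def u_def)
  have tau': "Im (- 1 / \<tau>) = Im \<tau> / (cmod \<tau>)\<^sup>2" "Re (- 1 / \<tau>) = - Re \<tau> / (cmod \<tau>)\<^sup>2"
    by (simp_all add: Re_divide Im_divide cmod_power2)
  \<comment> \<open>The form has Gram matrix diag(1/p, -1/r); its inverse diag(p, -r) carries points
    of the dual sum to arguments of the kernel.\<close>
  have dual: "kern p r (- 1 / \<tau>) t (p * x) (- r * y) = exp (- of_real pi * (c * x\<^sup>2 - 2 * b * x * y + a * y\<^sup>2) / D)" for x y :: real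
  proof -
    define N where "N = complex_of_real ((cmod \<tau>)\<^sup>2)"
    have N: "N \<noteq> 0" using n0 unfolding N_def by simp
    have D': "complex_of_real D = N / (of_real p * of_real r)" by (simp add: D_def N_def)
    define q where "q = complex_of_real (sqrt (p * r))"
    have q: "q \<noteq> 0" "q * q = of_real p * of_real r" using p r by (auto simp: q_def simp flip: of_real_mult)
    have pr0: "complex_of_real p \<noteq> 0" "complex_of_real r \<noteq> 0" using p r by auto
    have 1: "(of_real (Im (- 1 / \<tau>) * cosh (2 * t)) - \<i> * of_real (Re (- 1 / \<tau>))) / of_real p * of_real ((p * x)\<^sup>2) = c * of_real (x\<^sup>2) / D"
    proof -
      have e: "of_real (Im (- 1 / \<tau>) * cosh (2 * t)) - \<i> * of_real (Re (- 1 / \<tau>)) = (s + u) / N"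
        unfolding tau' s_def u_def N_def by (simp add: add_divide_distrib)
      then show ?thesis unfolding e D' cs using pr0 N by (simp add: field_simps power2_eq_square)
    qed
    have 2: "(of_real (Im (- 1 / \<tau>) * cosh (2 * t)) + \<i> * of_real (Re (- 1 / \<tau>))) / of_real r * of_real ((- r * y)\<^sup>2) = a * of_real (y\<^sup>2) / D"
    proof -
      have e: "of_real (Im (- 1 / \<tau>) * cosh (2 * t)) + \<i> * of_real (Re (- 1 / \<tau>)) = (s - u) / N"
        unfolding tau' s_def u_def N_def by (simp add: diff_divide_distrib)
      then show ?thesis unfolding e D' as using pr0 N by (simp add: field_simps power2_eq_square)
    qed
    have 3: "2 * of_real (Im (- 1 / \<tau>) * sinh (2 * t) / sqrt (p * r)) * of_real (p * x) * of_real (- r * y) = - (2 * b * x * y) / complex_of_real D"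
    proof -
      have "2 * of_real (Im (- 1 / \<tau>) * sinh (2 * t) / sqrt (p * r)) * of_real (p * x) * of_real (- r * y) = complex_of_real (- (2 * b * x * y) / D)"
        unfolding of_real_mult[symmetric] of_real_numeral[where 'a=complex, symmetric] of_real_eq_iff tau' b_def D_def using p r n0
        by (simp add: field_simps)
      then show ?thesis by simp
    qed
    show ?thesis unfolding kern_quadratic[OF p r] 1 2 3
      by (rule arg_cong[of _ _ exp]) (simp add: add_divide_distrib diff_divide_distrib algebra_simps)
  qed
  have "(\<Sum>\<^sub>\<infinity>(m::int, n::int). kern p r \<tau> t (of_int m) (of_int n) * ee (of_real (of_int m * h / p - of_int n * h' / r)))
     = (\<Sum>\<^sub>\<infinity>(m::int, n::int). exp (- of_real pi * (a * of_int m ^ 2 + 2 * b * of_int m * of_int n + c * of_int n ^ 2)) *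
      exp (2 * of_real pi * \<i> * (of_int m * of_real (h / p) + of_int n * of_real (- h' / r))))"
  proof (rule infsum_cong, clarify)
    fix m n :: int
    show "kern p r \<tau> t (of_int m) (of_int n) * ee (of_real (of_int m * h / p - of_int n * h' / r)) =
       exp (- of_real pi * (a * of_int m ^ 2 + 2 * b * of_int m * of_int n + c * of_int n ^ 2)) *
      exp (2 * of_real pi * \<i> * (of_int m * of_real (h / p) + of_int n * of_real (- h' / r)))"
      unfolding kern_quadratic[OF p r] a_def[symmetric] c_def[symmetric] b_def[symmetric] ee_def
      by simp
  qed
  also have "\<dots> = (\<Sum>\<^sub>\<infinity>(k::int, l::int). exp (- of_real pi * (c * (of_int k + h / p)\<^sup>2 - 2 * b * (of_int k + h / p) * (of_int l + - h' / r) + a * (of_int l + - h' / r)\<^sup>2) / D)) / of_real (sqrt D)"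
    by (rule poisson_summation_gaussian2[OF a c pos D ac])
  also have "(\<Sum>\<^sub>\<infinity>(k::int, l::int). exp (- of_real pi * (c * (of_int k + h / p)\<^sup>2 - 2 * b * (of_int k + h / p) * (of_int l + - h' / r) + a * (of_int l + - h' / r)\<^sup>2) / D))
      = (\<Sum>\<^sub>\<infinity>(k::int, l::int). kern p r (- 1 / \<tau>) t (h + p * of_int k) (h' - r * of_int l))"
  proof (rule infsum_cong, clarify)
    fix k l :: int
    have e: "h + p * of_int k = p * (of_int k + h / p)" "h' - r * of_int l = - r * (of_int l + - h' / r)"
      using p r by (auto simp: field_simps)
    show "exp (- of_real pi * (c * (of_int k + h / p)\<^sup>2 - 2 * b * (of_int k + h / p) * (of_int l + - h' / r) + a * (of_int l + - h' / r)\<^sup>2) / D) = kern p r (- 1 / \<tau>) t (h + p * of_int k) (h' - r * of_int l)"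
      unfolding e dual by simp
  qed
  also have "sqrt D = cmod \<tau> / sqrt (p * r)" by (simp add: D_def real_sqrt_divide)
  finally show ?thesis by (simp add: field_simps)
qed

section \<open>Characters, Heisenberg operators and the Weil representation\<close>

definition ex :: "real \<Rightarrow> complex" where "ex x = ee (of_real x)"

lemma ex_add: "ex (x + y) = ex x * ex y" by (simp add: ex_def ee_add)
lemma ex_cis: "ex x = cis (2 * pi * x)" by (simp add: ex_def ee_def cis_conv_exp mult_ac)
lemma norm_ex [simp]: "norm (ex x) = 1" by (simp add: ex_cis)
lemma cnj_ex: "cnj (ex x) = ex (- x)" by (simp add: ex_cis cis_cnj)
lemma ex_0 [simp]: "ex 0 = 1" by (simp add: ex_cis)
lemma ex_eq_1_iff: "ex x = 1 \<longleftrightarrow> x \<in> \<int>"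
proof -
  have "ex x = 1 \<longleftrightarrow> (\<exists>n::int. 2 * pi * x = of_int (2 * n) * pi)"
    unfolding ex_cis cis_conv_exp exp_eq_1 by simp
  also have "\<dots> \<longleftrightarrow> (\<exists>n::int. x = of_int n)"
    by (intro ex_cong1) (auto simp: field_simps)
  finally show ?thesis by (auto elim!: Ints_cases)
qed
lemma ex_int_cancel: "x - y \<in> \<int> \<Longrightarrow> ex x = ex y"
  using ex_add[of "x - y" y] ex_eq_1_iff[of "x - y"] by simp

definition periodic2 :: "nat \<Rightarrow> nat \<Rightarrow> (int \<times> int \<Rightarrow> complex) \<Rightarrow> bool" where
  "periodic2 P R C \<longleftrightarrow> (\<forall>m n. C (m + int P, n) = C (m, n) \<and> C (m, n + int R) = C (m, n))"

definition rbox :: "nat \<Rightarrow> nat \<Rightarrow> (int \<times> int) set" where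
  "rbox P R = {0..<int P} \<times> {0..<int R}"

definition chi :: "nat \<Rightarrow> nat \<Rightarrow> int \<times> int \<Rightarrow> int \<times> int \<Rightarrow> complex" where
  "chi P R z w = ex (of_int (fst z) * of_int (fst w) / P - of_int (snd z) * of_int (snd w) / R)"

text \<open>The factor in front compensates the \<open>cmod \<tau>\<close> of
  \<open>kern_poisson\<close>, so that inversion acts with weight zero.\<close>

definition theta :: "nat \<Rightarrow> nat \<Rightarrow> (int \<times> int \<Rightarrow> complex) \<Rightarrow> complex \<Rightarrow> real \<Rightarrow> complex" where
  "theta P R C \<tau> t = of_real (sqrt (Im \<tau>)) * (\<Sum>\<^sub>\<infinity>z. C z * kern P R \<tau> t (of_int (fst z)) (of_int (snd z)))"

text \<open>Translation by \<open>x\<close> composed with modulation by \<open>y\<close>. The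
  symmetric phase x y / 2 lets SL_2(Z) act linearly on the pair (x, y), with no further phase in the
  commutation rules.\<close>

definition heis :: "nat \<Rightarrow> nat \<Rightarrow> int \<times> int \<Rightarrow> int \<times> int \<Rightarrow> (int \<times> int \<Rightarrow> complex) \<Rightarrow> int \<times> int \<Rightarrow> complex" where
  "heis P R x y C = (\<lambda>w. ex ((of_int (fst x) * of_int (fst y) / 2 + of_int (fst y) * of_int (fst w)) / P
      - (of_int (snd x) * of_int (snd y) / 2 + of_int (snd y) * of_int (snd w)) / R) * C (fst w + fst x, snd w + snd x))"

definition sqnorm :: "nat \<Rightarrow> nat \<Rightarrow> (int \<times> int \<Rightarrow> complex) \<Rightarrow> real" where
  "sqnorm P R C = (\<Sum>z\<in>rbox P R. (cmod (C z))\<^sup>2)"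

text \<open>Together with the unitary finite Fourier transform \<open>weil_S\<close>, these
  operators generate the Weil representation of the quadratic form m^2 / P - n^2 / R.\<close>

definition weil_T :: "nat \<Rightarrow> nat \<Rightarrow> int \<Rightarrow> (int \<times> int \<Rightarrow> complex) \<Rightarrow> int \<times> int \<Rightarrow> complex" where
  "weil_T P R k C = (\<lambda>w. ex (of_int k * ((of_int (fst w))\<^sup>2 / (2 * P) - (of_int (snd w))\<^sup>2 / (2 * R))) * C w)"

definition weil_S :: "nat \<Rightarrow> nat \<Rightarrow> (int \<times> int \<Rightarrow> complex) \<Rightarrow> int \<times> int \<Rightarrow> complex" where
  "weil_S P R C = (\<lambda>w. (\<Sum>z\<in>rbox P R. C z * chi P R z w) / of_real (sqrt (P * R)))"

definition mob :: "int \<Rightarrow> int \<Rightarrow> int \<Rightarrow> int \<Rightarrow> complex \<Rightarrow> complex" where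
  "mob a b c d \<tau> = (of_int a * \<tau> + of_int b) / (of_int c * \<tau> + of_int d)"

text \<open>The last clause, the commutation rule with the Heisenberg operators, is what determines \<open>U\<close> up
  to a scalar.\<close>

definition intertwiner :: "nat \<Rightarrow> nat \<Rightarrow> int \<Rightarrow> int \<Rightarrow> int \<Rightarrow> int \<Rightarrow> ((int \<times> int \<Rightarrow> complex) \<Rightarrow> int \<times> int \<Rightarrow> complex) \<Rightarrow> bool" where
  "intertwiner P R a b c d U \<longleftrightarrow> a * d - b * c = 1 \<and>
     (\<forall>C. periodic2 P R C \<longrightarrow> periodic2 P R (U C)) \<and>
     (\<forall>C D. U (\<lambda>w. C w + D w) = (\<lambda>w. U C w + U D w)) \<and>
     (\<forall>k C. U (\<lambda>w. k * C w) = (\<lambda>w. k * U C w)) \<and>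
     (\<forall>C. periodic2 P R C \<longrightarrow> sqnorm P R (U C) = sqnorm P R C) \<and>
     (\<forall>C \<tau> t. periodic2 P R C \<longrightarrow> Im \<tau> > 0 \<longrightarrow> theta P R C (mob a b c d \<tau>) t = theta P R (U C) \<tau> t) \<and>
     (\<forall>C x y x' y'. periodic2 P R C \<longrightarrow> U (heis P R (x, x') (y, y') C) =
        heis P R (a * x - c * y, a * x' - c * y') (- b * x + d * y, - b * x' + d * y') (U C))"

lemma finite_rbox [simp]: "finite (rbox P R)" by (simp add: rbox_def)

lemma card_rbox: "card (rbox P R) = P * R" by (simp add: rbox_def)

lemma periodic_int_mult:
  fixes f :: "int \<Rightarrow> 'a"
  assumes "\<And>m. f (m + p) = f m"
  shows "f (m + p * k) = f m"
proof -
  have nat: "f (m + p * int j) = f m" for j m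
  proof (induction j)
    case (Suc j)
    have "f (m + p * int (Suc j)) = f ((m + p * int j) + p)" by (simp add: algebra_simps)
    then show ?case using Suc assms by simp
  qed simp
  show ?thesis
  proof (cases "k \<ge> 0")
    case True then show ?thesis using nat[of m "nat k"] by simp
  next
    case False then show ?thesis using nat[of "m + p * k" "nat (- k)"] by simp
  qed
qed

lemma sum_periodic_shift:
  fixes f :: "int \<Rightarrow> 'a::comm_monoid_add"
  assumes "p > 0" and per: "\<And>m. f (m + p) = f m"
  shows "(\<Sum>m\<in>{0..<p}. f (m + x)) = (\<Sum>m\<in>{0..<p}. f m)"
proof (rule sum.reindex_bij_witness[of _ "\<lambda>m. (m - x) mod p" "\<lambda>m. (m + x) mod p"])
  fix m
  have "f ((m + x) mod p + p * ((m + x) div p)) = f ((m + x) mod p)"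
    by (rule periodic_int_mult[of f p, OF per])
  then show "f ((m + x) mod p) = f (m + x)" by simp
qed (use assms in \<open>auto simp: mod_diff_left_eq mod_add_left_eq\<close>)

lemma sum_rbox_shift:
  fixes f :: "int \<times> int \<Rightarrow> 'a::comm_monoid_add"
  assumes "P > 0" "R > 0" and per: "\<And>m n. f (m + int P, n) = f (m, n)" "\<And>m n. f (m, n + int R) = f (m, n)"
  shows "(\<Sum>z\<in>rbox P R. f (fst z + x, snd z + y)) = (\<Sum>z\<in>rbox P R. f z)"
proof -
  have "(\<Sum>z\<in>rbox P R. f (fst z + x, snd z + y)) = (\<Sum>m\<in>{0..<int P}. \<Sum>n\<in>{0..<int R}. f (m + x, n + y))"
    by (simp add: rbox_def sum.cartesian_product case_prod_unfold)
  also have "\<dots> = (\<Sum>m\<in>{0..<int P}. \<Sum>n\<in>{0..<int R}. f (m + x, n))"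
    using assms by (intro sum.cong refl sum_periodic_shift) auto
  also have "\<dots> = (\<Sum>m\<in>{0..<int P}. \<Sum>n\<in>{0..<int R}. f (m, n))"
    using assms by (intro sum_periodic_shift[of "int P" "\<lambda>m. \<Sum>n\<in>{0..<int R}. f (m, n)"]) auto
  finally show ?thesis by (simp add: rbox_def sum.cartesian_product)
qed

lemma sum_ex_orthogonal:
  assumes "P > 0"
  shows "(\<Sum>m\<in>{0..<int P}. ex (of_int k * of_int m / P)) = (if int P dvd k then of_nat P else 0)"
proof (cases "int P dvd k")
  case True
  then obtain j where "k = int P * j" by blast
  then have "ex (of_int k * of_int m / P) = 1" for m :: int
    using assms by (simp add: ex_eq_1_iff) 
  then show ?thesis using True by simp
next
  case False
  have ne: "ex (of_int k / P) \<noteq> 1"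
  proof
    assume "ex (of_int k / P) = 1"
    then obtain j :: int where "of_int k / real P = of_int j" unfolding ex_eq_1_iff by (auto elim: Ints_cases)
    then have "real_of_int k = real_of_int (j * int P)" using assms by (simp add: field_simps)
    then have "k = j * int P" by linarith
    then show False using False by simp
  qed
  define S where "S = (\<Sum>m\<in>{0..<int P}. ex (of_int k * of_int m / P))"
  have "S = (\<Sum>m\<in>{0..<int P}. ex (of_int k * of_int (m + 1) / P))"
    unfolding S_def using assms
    by (intro sum_periodic_shift[symmetric] ex_int_cancel) (auto simp: field_simps)
  also have "\<dots> = ex (of_int k / P) * S"
    unfolding S_def sum_distrib_left
    by (intro sum.cong refl) (simp add: ex_add[symmetric] add_divide_distrib distrib_left add.commute)
  finally have "S = 0" using ne by simp
  then show ?thesis using False S_def by simp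
qed

lemma chi_add: "chi P R (z1 + x1, z2 + x2) w = chi P R (z1, z2) w * chi P R (x1, x2) w"
  unfolding chi_def ex_add[symmetric]
  by (rule arg_cong[of _ _ ex]) (simp add: add_divide_distrib algebra_simps)

lemma chi_swap: "chi P R z w = chi P R w z" by (simp add: chi_def mult.commute)

lemma chi_periodic:
  assumes "P > 0" "R > 0"
  shows "chi P R (m + int P, n) w = chi P R (m, n) w" "chi P R (m, n + int R) w = chi P R (m, n) w"
proof -
  have "of_int (m + int P) * of_int (fst w) / real P - y - (of_int m * of_int (fst w) / real P - y) = real_of_int (fst w)" for y
    using assms by (simp add: field_simps)
  then have "of_int (m + int P) * of_int (fst w) / real P - y - (of_int m * of_int (fst w) / real P - y) \<in> \<int>" for y
    by simp
  from ex_int_cancel[OF this] show "chi P R (m + int P, n) w = chi P R (m, n) w" by (simp add: chi_def)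
  have "y - of_int (n + int R) * of_int (snd w) / real R - (y - of_int n * of_int (snd w) / real R) = real_of_int (- snd w)" for y
    using assms by (simp add: field_simps)
  then have "y - of_int (n + int R) * of_int (snd w) / real R - (y - of_int n * of_int (snd w) / real R) \<in> \<int>" for y
    by simp
  from ex_int_cancel[OF this] show "chi P R (m, n + int R) w = chi P R (m, n) w" by (simp add: chi_def)
qed

lemma sum_chi:
  assumes "P > 0" "R > 0"
  shows "(\<Sum>w\<in>rbox P R. chi P R z w) = (if int P dvd fst z \<and> int R dvd snd z then of_nat (P * R) else 0)"
proof -
  have "(\<Sum>w\<in>rbox P R. chi P R z w) = (\<Sum>m\<in>{0..<int P}. ex (of_int (fst z) * of_int m / P)) * (\<Sum>n\<in>{0..<int R}. ex (of_int (- snd z) * of_int n / R))"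
    by (simp add: rbox_def chi_def sum_product sum.cartesian_product case_prod_unfold ex_add[symmetric])
  then show ?thesis using sum_ex_orthogonal[OF assms(1), of "fst z"] sum_ex_orthogonal[OF assms(2), of "- snd z"] by simp
qed

lemma periodic2_mult:
  assumes "periodic2 P R C"
  shows "C (m + int P * k, n + int R * l) = C (m, n)"
  using assms periodic_int_mult[of "\<lambda>m. C (m, n + int R * l)" "int P" m k] periodic_int_mult[of "\<lambda>n. C (m, n)" "int R" n l]
  by (simp add: periodic2_def)

lemma periodic2_mod:
  assumes "periodic2 P R C"
  shows "C (m mod int P, n mod int R) = C (m, n)"
  using periodic2_mult[OF assms, of "m mod int P" "m div int P" "n mod int R" "n div int R"] by simp

lemma periodic2_bounded:
  assumes "periodic2 P R C" "P > 0" "R > 0"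
  shows "\<exists>B\<ge>0. \<forall>z. cmod (C z) \<le> B"
proof (intro exI conjI allI)
  show "0 \<le> (\<Sum>z\<in>rbox P R. cmod (C z))" by (simp add: sum_nonneg)
  fix z :: "int \<times> int"
  define w where "w = (fst z mod int P, snd z mod int R)"
  have "w \<in> rbox P R" using assms by (simp add: w_def rbox_def)
  then have "cmod (C w) \<le> (\<Sum>z\<in>rbox P R. cmod (C z))" by (intro member_le_sum) auto
  then show "cmod (C z) \<le> (\<Sum>z\<in>rbox P R. cmod (C z))"
    using periodic2_mod[OF assms(1), of "fst z" "snd z"] by (simp add: w_def)
qed

lemma abs_summable_theta:
  assumes "periodic2 P R C" "P > 0" "R > 0" "Im \<tau> > 0"
  shows "(\<lambda>z. norm (C z * kern P R \<tau> t (of_int (fst z)) (of_int (snd z)))) summable_on UNIV"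
proof -
  obtain B where B: "B \<ge> 0" "\<And>z. cmod (C z) \<le> B" using periodic2_bounded[OF assms(1-3)] by metis
  have "(\<lambda>z::int\<times>int. norm (kern P R \<tau> t (of_int (fst z)) (of_int (snd z)))) summable_on UNIV"
    using summable_on_kern[of P R \<tau> t] assms by (simp add: case_prod_unfold)
  then have "(\<lambda>z::int\<times>int. B * norm (kern P R \<tau> t (of_int (fst z)) (of_int (snd z)))) summable_on UNIV"
    by (rule summable_on_cmult_right)
  then show ?thesis
    by (rule summable_on_comparison_test) (use B in \<open>auto simp: norm_mult intro!: mult_right_mono\<close>)
qed

text \<open>The numbers (m + P)^2 / (2 P) and m^2 / (2 P) differ by m + P / 2, an integer exactly
  because P is even; likewise for R.\<close>

lemma periodic2_weil_T:
  assumes "P > 0" "R > 0" "even P" "even R" "periodic2 P R C"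
  shows "periodic2 P R (weil_T P R k C)"
proof -
  define p r where "p = P div 2" and "r = R div 2"
  have p: "P = 2 * p" "R = 2 * r" using assms by (auto simp: p_def r_def)
  have 1: "ex (of_int k * ((of_int (m + int P))\<^sup>2 / (2 * real P) - y)) = ex (of_int k * ((of_int m)\<^sup>2 / (2 * real P) - y))" for m y
  proof (rule ex_int_cancel)
    have "of_int k * ((of_int (m + int P))\<^sup>2 / (2 * real P) - y) - of_int k * ((of_int m)\<^sup>2 / (2 * real P) - y) = real_of_int (k * (m + int p))"
      using assms p by (simp add: field_simps power2_eq_square)
    then show "of_int k * ((of_int (m + int P))\<^sup>2 / (2 * real P) - y) - of_int k * ((of_int m)\<^sup>2 / (2 * real P) - y) \<in> \<int>" by simp
  qed
  have 2: "ex (of_int k * (y - (of_int (m + int R))\<^sup>2 / (2 * real R))) = ex (of_int k * (y - (of_int m)\<^sup>2 / (2 * real R)))" for m y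
  proof (rule ex_int_cancel)
    have "of_int k * (y - (of_int (m + int R))\<^sup>2 / (2 * real R)) - of_int k * (y - (of_int m)\<^sup>2 / (2 * real R)) = real_of_int (- k * (m + int r))"
      using assms p by (simp add: field_simps power2_eq_square)
    then show "of_int k * (y - (of_int (m + int R))\<^sup>2 / (2 * real R)) - of_int k * (y - (of_int m)\<^sup>2 / (2 * real R)) \<in> \<int>" by simp
  qed
  show ?thesis using assms(5) unfolding periodic2_def weil_T_def fst_conv snd_conv 1 2 by (simp add: 1 2 del: of_int_add)
qed

lemma intertwiner_T:
  assumes PR: "P > 0" "R > 0" "even P" "even R"
  shows "intertwiner P R 1 k 0 1 (weil_T P R k)"
  unfolding intertwiner_def
proof (intro conjI allI impI)
  show "periodic2 P R (weil_T P R k C)" if "periodic2 P R C" for C by (rule periodic2_weil_T[OF PR that])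
  show "sqnorm P R (weil_T P R k C) = sqnorm P R C" for C by (simp add: sqnorm_def weil_T_def norm_mult)
next
  fix C \<tau> t assume C: "periodic2 P R C" and "Im \<tau> > (0::real)"
  have "kern P R (\<tau> + of_int k) t x y = ex (of_int k * (x\<^sup>2 / (2 * P) - y\<^sup>2 / (2 * R))) * kern P R \<tau> t x y" for x y
    using PR unfolding ex_def ee_def
    by (simp add: kern_eq exp_add[symmetric]) (simp add: algebra_simps)
  then have "C z * kern P R (\<tau> + of_int k) t (of_int (fst z)) (of_int (snd z)) = weil_T P R k C z * kern P R \<tau> t (of_int (fst z)) (of_int (snd z))" for z
    by (simp add: weil_T_def)
  then show "theta P R C (mob 1 k 0 1 \<tau>) t = theta P R (weil_T P R k C) \<tau> t"
    by (simp add: theta_def mob_def)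
next
  fix C x y x' y' assume C: "periodic2 P R C"
  show "weil_T P R k (heis P R (x, x') (y, y') C) =
     heis P R (1 * x - 0 * y, 1 * x' - 0 * y') (- k * x + 1 * y, - k * x' + 1 * y') (weil_T P R k C)"
    unfolding weil_T_def heis_def mult.assoc[symmetric] ex_add[symmetric] using PR
    by (intro ext arg_cong2[of _ _ _ _ "(*)"] arg_cong[of _ _ ex]) (auto simp: field_simps power2_eq_square)
qed (auto simp: weil_T_def distrib_left)

lemma norm_chi [simp]: "norm (chi P R z w) = 1" by (simp add: chi_def)

lemma cnj_chi: "cnj (chi P R z w) = chi P R (- fst z, - snd z) w"
  by (simp add: chi_def cnj_ex)

lemma rbox_dvd_iff:
  assumes "z \<in> rbox P R" "z' \<in> rbox P R"
  shows "int P dvd fst z - fst z' \<and> int R dvd snd z - snd z' \<longleftrightarrow> z = z'"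
proof
  assume "int P dvd fst z - fst z' \<and> int R dvd snd z - snd z'"
  then have "fst z mod int P = fst z' mod int P" "snd z mod int R = snd z' mod int R"
    by (auto simp: mod_eq_dvd_iff)
  then show "z = z'" using assms by (auto simp: rbox_def)
qed auto

lemma sum_chi_orthogonal:
  assumes "P > 0" "R > 0" "z \<in> rbox P R" "z' \<in> rbox P R"
  shows "(\<Sum>w\<in>rbox P R. chi P R z w * cnj (chi P R z' w)) = (if z = z' then of_nat (P * R) else 0)"
proof -
  have "chi P R z w * cnj (chi P R z' w) = chi P R (fst z - fst z', snd z - snd z') w" for w
    unfolding cnj_chi using chi_add[of P R "fst z" "- fst z'" "snd z" "- snd z'" w] by simp
  then have "(\<Sum>w\<in>rbox P R. chi P R z w * cnj (chi P R z' w)) = (\<Sum>w\<in>rbox P R. chi P R (fst z - fst z', snd z - snd z') w)" by simp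
  also have "\<dots> = (if z = z' then of_nat (P * R) else 0)"
    unfolding sum_chi[OF assms(1,2)] fst_conv snd_conv rbox_dvd_iff[OF assms(3,4)] ..
  finally show ?thesis .
qed

lemma sqnorm_complex: "complex_of_real (sqnorm P R C) = (\<Sum>z\<in>rbox P R. C z * cnj (C z))"
  by (simp add: sqnorm_def complex_norm_square[symmetric])

lemma sqnorm_weil_S:
  assumes "P > 0" "R > 0"
  shows "sqnorm P R (weil_S P R C) = sqnorm P R C"
proof -
  define s where "s = complex_of_real (sqrt (P * R))"
  have ss: "s * cnj s = of_nat (P * R)"
    unfolding s_def complex_cnj_complex_of_real of_real_mult[symmetric] real_sqrt_mult_self by simp
  have s0: "of_nat (P * R) \<noteq> (0::complex)" using assms by simp
  have "complex_of_real (sqnorm P R (weil_S P R C)) = (\<Sum>w\<in>rbox P R. (\<Sum>z\<in>rbox P R. C z * chi P R z w) * (\<Sum>z\<in>rbox P R. cnj (C z) * cnj (chi P R z w)) / of_nat (P * R))"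
    unfolding sqnorm_complex weil_S_def s_def[symmetric] complex_cnj_divide cnj_sum complex_cnj_mult times_divide_times_eq ss ..
  also have "\<dots> = (\<Sum>w\<in>rbox P R. \<Sum>z\<in>rbox P R. \<Sum>z'\<in>rbox P R. C z * cnj (C z') * (chi P R z w * cnj (chi P R z' w))) / of_nat (P * R)"
    unfolding sum_product sum_divide_distrib by (intro sum.cong refl) (simp add: mult_ac)
  also have "(\<Sum>w\<in>rbox P R. \<Sum>z\<in>rbox P R. \<Sum>z'\<in>rbox P R. C z * cnj (C z') * (chi P R z w * cnj (chi P R z' w)))
     = (\<Sum>z\<in>rbox P R. \<Sum>z'\<in>rbox P R. C z * cnj (C z') * (\<Sum>w\<in>rbox P R. chi P R z w * cnj (chi P R z' w)))"
    unfolding sum_distrib_left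
    by (rule trans[OF sum.swap], intro sum.cong refl sum.swap)
  also have "\<dots> = (\<Sum>z\<in>rbox P R. \<Sum>z'\<in>rbox P R. if z = z' then C z * cnj (C z') * of_nat (P * R) else 0)"
    using assms by (intro sum.cong refl) (simp add: sum_chi_orthogonal)
  also have "\<dots> = (\<Sum>z\<in>rbox P R. C z * cnj (C z)) * of_nat (P * R)"
    by (simp add: sum_distrib_right)
  finally have "complex_of_real (sqnorm P R (weil_S P R C)) = complex_of_real (sqnorm P R C)"
    using s0 by (simp add: sqnorm_complex del: of_nat_mult)
  then show ?thesis by simp
qed

lemma periodic2_weil_S:
  assumes "P > 0" "R > 0"
  shows "periodic2 P R (weil_S P R C)"
  unfolding periodic2_def weil_S_def chi_swap[of P R _ "(_, _)"] chi_periodic[OF assms] by simp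

text \<open>The Fourier transform exchanges translation and modulation. \<open>G\<close> is the
  summand with the translation undone; its periodicity allows the box of residues to be moved back,
  and the half-phases combine to those of the rotated pair.\<close>

lemma weil_S_heis:
  assumes PR: "P > 0" "R > 0" and C: "periodic2 P R C"
  shows "weil_S P R (heis P R (x, x') (y, y') C) = heis P R (y, y') (- x, - x') (weil_S P R C)"
proof
  fix w :: "int \<times> int"
  obtain m n where w: "w = (m, n)" by (cases w)
  define G where "G = (\<lambda>z. ex ((of_int x * of_int y / 2 + of_int y * (of_int (fst z) - of_int x)) / P - (of_int x' * of_int y' / 2 + of_int y' * (of_int (snd z) - of_int x')) / R)
     * chi P R (fst z - x, snd z - x') w * C z)"
  have G1: "G z = ex ((- (of_int x * of_int y) / 2 - of_int x * of_int m) / P - (- (of_int x' * of_int y') / 2 - of_int x' * of_int n) / R) * (C z * chi P R z (m + y, n + y'))" for z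
  proof -
    have "ex ((of_int x * of_int y / 2 + of_int y * (of_int (fst z) - of_int x)) / P - (of_int x' * of_int y' / 2 + of_int y' * (of_int (snd z) - of_int x')) / R) * chi P R (fst z - x, snd z - x') w
      = ex ((- (of_int x * of_int y) / 2 - of_int x * of_int m) / P - (- (of_int x' * of_int y') / 2 - of_int x' * of_int n) / R) * chi P R z (m + y, n + y')"
      unfolding chi_def ex_add[symmetric] w
      by (rule arg_cong[of _ _ ex]) (use PR in \<open>simp add: field_simps\<close>)
    then show ?thesis unfolding G_def by (simp only: mult_ac)
  qed
  have Gper: "G (i + int P, j) = G (i, j)" "G (i, j + int R) = G (i, j)" for i j
    unfolding G1 chi_periodic[OF PR] using C by (simp_all add: periodic2_def)
  have "(\<Sum>z\<in>rbox P R. heis P R (x, x') (y, y') C z * chi P R z w) = (\<Sum>z\<in>rbox P R. G (fst z + x, snd z + x'))"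
    by (intro sum.cong refl) (simp add: heis_def G_def)
  also have "\<dots> = (\<Sum>z\<in>rbox P R. G z)" by (rule sum_rbox_shift[OF PR Gper])
  also have "\<dots> = ex ((- (of_int x * of_int y) / 2 - of_int x * of_int m) / P - (- (of_int x' * of_int y') / 2 - of_int x' * of_int n) / R) * (\<Sum>z\<in>rbox P R. C z * chi P R z (m + y, n + y'))"
    unfolding G1 sum_distrib_left ..
  finally show "weil_S P R (heis P R (x, x') (y, y') C) w = heis P R (y, y') (- x, - x') (weil_S P R C) w"
    by (simp add: weil_S_def heis_def w mult.commute)
qed

text \<open>For a fixed residue class modulo (P, R), Poisson summation evaluates the kernel at
  \<open>- 1 / \<tau>\<close> summed over that class. The normalisation of \<open>weil_S\<close>
  cancels \<open>sqrt (P * R)\<close>, and the remaining \<open>cmod \<tau>\<close> is the quotient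
  of \<open>sqrt (Im \<tau>)\<close> by \<open>sqrt (Im (- 1 / \<tau>))\<close>.\<close>

lemma theta_weil_S:
  assumes PR: "P > 0" "R > 0" and C: "periodic2 P R C" and v: "Im \<tau> > 0"
  shows "theta P R C (- 1 / \<tau>) t = theta P R (weil_S P R C) \<tau> t"
proof -
  define k where "k = (\<lambda>\<tau> z. kern P R \<tau> t (of_int (fst z)) (of_int (snd z)))"
  have pr: "real P > 0" "real R > 0" using PR by auto
  have n0: "cmod \<tau> > 0" using v by auto
  have v': "Im (- 1 / \<tau>) = Im \<tau> / (cmod \<tau>)\<^sup>2" by (simp add: Im_divide cmod_power2)
  have v'0: "Im (- 1 / \<tau>) > 0" unfolding v' using v n0 by simp
  have ks: "(\<lambda>z. norm (k \<tau>' z)) summable_on UNIV" if "Im \<tau>' > 0" for \<tau>'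
    using summable_on_kern[OF pr that, of t] by (simp add: k_def case_prod_unfold)
  have poisson: "(\<Sum>\<^sub>\<infinity>w. chi P R z w * k \<tau> w) = (\<Sum>\<^sub>\<infinity>w. k (- 1 / \<tau>) (fst z + int P * fst w, snd z - int R * snd w)) * of_real (sqrt (P * R) / cmod \<tau>)" for z
    using kern_poisson[OF pr v, of t "of_int (fst z)" "of_int (snd z)"]
    by (simp add: k_def chi_def ex_def case_prod_unfold mult.commute)
  have chis: "(\<lambda>w. chi P R z w * k \<tau> w) summable_on UNIV" for z
    by (rule abs_summable_summable) (use ks[OF v] in \<open>simp add: norm_mult\<close>)
  have "(\<Sum>\<^sub>\<infinity>w. weil_S P R C w * k \<tau> w) = (\<Sum>\<^sub>\<infinity>w. (\<Sum>z\<in>rbox P R. C z * (chi P R z w * k \<tau> w)) * (1 / of_real (sqrt (P * R))))"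
    by (intro infsum_cong) (simp add: weil_S_def sum_distrib_right sum_divide_distrib mult.assoc)
  also have "\<dots> = (\<Sum>\<^sub>\<infinity>w. \<Sum>z\<in>rbox P R. C z * (chi P R z w * k \<tau> w)) * (1 / of_real (sqrt (P * R)))"
    by (rule infsum_cmult_left')
  also have "(\<Sum>\<^sub>\<infinity>w. \<Sum>z\<in>rbox P R. C z * (chi P R z w * k \<tau> w)) = (\<Sum>z\<in>rbox P R. C z * (\<Sum>\<^sub>\<infinity>w. chi P R z w * k \<tau> w))"
  proof -
    have "((\<lambda>w. \<Sum>z\<in>rbox P R. C z * (chi P R z w * k \<tau> w)) has_sum (\<Sum>z\<in>rbox P R. C z * (\<Sum>\<^sub>\<infinity>w. chi P R z w * k \<tau> w))) UNIV"
    proof (induction rule: finite_induct[OF finite_rbox[of P R]])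
      case (2 z F)
      then show ?case
        by (simp add: has_sum_add has_sum_cmult_right has_sum_infsum chis)
    qed simp
    then show ?thesis by (rule infsumI)
  qed
  also have "\<dots> = (\<Sum>z\<in>rbox P R. C z * (\<Sum>\<^sub>\<infinity>w. k (- 1 / \<tau>) (fst z + int P * fst w, snd z - int R * snd w))) * of_real (sqrt (P * R) / cmod \<tau>)"
    unfolding poisson sum_distrib_right mult.assoc ..
  also have "(\<Sum>z\<in>rbox P R. C z * (\<Sum>\<^sub>\<infinity>w. k (- 1 / \<tau>) (fst z + int P * fst w, snd z - int R * snd w))) = (\<Sum>\<^sub>\<infinity>z. C z * k (- 1 / \<tau>) z)"
  proof -
    \<comment> \<open>Division with remainder by (P, R); the minus sign in the second coordinate is
      the one in \<open>h' - r * of_int l\<close> of \<open>kern_poisson\<close>.\<close>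
    define g where "g = (\<lambda>(z, w). (fst z + int P * fst w, snd z - int R * snd w))"
    have bij: "bij_betw g (rbox P R \<times> UNIV) UNIV"
    proof (rule bij_betwI[where g="\<lambda>u. ((fst u mod int P, snd u mod int R), (fst u div int P, - (snd u div int R)))"])
      fix z assume "z \<in> rbox P R \<times> (UNIV :: (int \<times> int) set)"
      then obtain a b c d where z: "z = ((a, b), (c, d))" "0 \<le> a" "a < int P" "0 \<le> b" "b < int R"
        by (cases z) (auto simp: rbox_def)
      have "(b - int R * d) mod int R = b" "(b - int R * d) div int R = - d"
        using z(4,5) mod_mult_self2[of b "int R" "- d"] div_mult_self2[of "int R" b "- d"] by auto
      then show "((fst (g z) mod int P, snd (g z) mod int R), (fst (g z) div int P, - (snd (g z) div int R))) = z"
        using z by (simp add: g_def)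
    qed (use PR in \<open>auto simp: g_def rbox_def\<close>)
    have Cg: "C (g (z, w)) = C z" for z w
      using periodic2_mult[OF C, of "fst z" "fst w" "snd z" "- snd w"] by (simp add: g_def)
    have Cg': "C (g p) = C (fst p)" for p using Cg[of "fst p" "snd p"] by simp
    have sm: "(\<lambda>z. C z * k (- 1 / \<tau>) z) summable_on UNIV"
      using abs_summable_summable[OF abs_summable_theta[OF C PR v'0]] by (simp add: k_def)
    have sm': "(\<lambda>(z, w). C z * k (- 1 / \<tau>) (g (z, w))) summable_on rbox P R \<times> UNIV"
      using summable_on_reindex_bij_betw[OF bij, of "\<lambda>z. C z * k (- 1 / \<tau>) z"] sm by (simp add: case_prod_unfold Cg')
    have "(\<Sum>\<^sub>\<infinity>z. C z * k (- 1 / \<tau>) z) = (\<Sum>\<^sub>\<infinity>u\<in>rbox P R \<times> UNIV. C (g u) * k (- 1 / \<tau>) (g u))"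
      by (rule infsum_reindex_bij_betw[OF bij, symmetric])
    also have "\<dots> = (\<Sum>\<^sub>\<infinity>(z, w)\<in>rbox P R \<times> UNIV. C z * k (- 1 / \<tau>) (g (z, w)))"
      by (intro infsum_cong) (auto simp: Cg)
    also have "\<dots> = (\<Sum>\<^sub>\<infinity>z\<in>rbox P R. \<Sum>\<^sub>\<infinity>w. C z * k (- 1 / \<tau>) (g (z, w)))"
      by (rule infsum_Sigma'_banach[OF sm', symmetric])
    also have "\<dots> = (\<Sum>z\<in>rbox P R. C z * (\<Sum>\<^sub>\<infinity>w. k (- 1 / \<tau>) (g (z, w))))"
      by (simp add: infsum_cmult_right')
    finally show ?thesis by (simp add: g_def)
  qed
  finally have "(\<Sum>\<^sub>\<infinity>w. weil_S P R C w * k \<tau> w) = (\<Sum>\<^sub>\<infinity>z. C z * k (- 1 / \<tau>) z) / of_real (cmod \<tau>)"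
    using PR n0 by simp
  moreover have "sqrt (Im (- 1 / \<tau>)) = sqrt (Im \<tau>) / cmod \<tau>"
    unfolding v' using n0 by (simp add: real_sqrt_divide)
  ultimately show ?thesis unfolding theta_def k_def by simp
qed

lemma intertwiner_S:
  assumes PR: "P > 0" "R > 0"
  shows "intertwiner P R 0 1 (-1) 0 (weil_S P R)"
  unfolding intertwiner_def
proof (intro conjI allI impI)
  show "theta P R C (mob 0 1 (- 1) 0 \<tau>) t = theta P R (weil_S P R C) \<tau> t" if "periodic2 P R C" "0 < Im \<tau>" for C \<tau> t
    using theta_weil_S[OF PR that, of t] by (simp add: mob_def)
  show "weil_S P R (heis P R (x, x') (y, y') C) = heis P R (0 * x - - 1 * y, 0 * x' - - 1 * y') (- 1 * x + 0 * y, - 1 * x' + 0 * y') (weil_S P R C)"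
    if "periodic2 P R C" for C x y x' y'
    using weil_S_heis[OF PR that, of x x' y y'] by simp
  show "weil_S P R (\<lambda>w. C w + D w) = (\<lambda>w. weil_S P R C w + weil_S P R D w)" for C D
    by (simp add: weil_S_def distrib_right sum.distrib add_divide_distrib)
  show "weil_S P R (\<lambda>w. k * C w) = (\<lambda>w. k * weil_S P R C w)" for k C
    by (simp add: weil_S_def sum_distrib_left mult.assoc)
qed (use PR in \<open>auto simp: sqnorm_weil_S periodic2_weil_S\<close>)

section \<open>From the two generators to all of SL_2(Z)\<close>

lemma mob_in_uhp:
  assumes det: "a * d - b * c = 1" and v: "Im \<tau> > 0"
  shows "of_int c * \<tau> + of_int d \<noteq> 0" "Im (mob a b c d \<tau>) = Im \<tau> / (cmod (of_int c * \<tau> + of_int d))\<^sup>2" "Im (mob a b c d \<tau>) > 0"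
proof -
  show n0: "of_int c * \<tau> + of_int d \<noteq> 0"
  proof
    assume eq: "of_int c * \<tau> + of_int d = 0"
    have "real_of_int c * Im \<tau> = Im (of_int c * \<tau> + of_int d)" by simp
    with eq v have c: "c = 0" by simp
    with eq have "d = 0" by simp
    with det c show False by simp
  qed
  have "Im (mob a b c d \<tau>) = Im ((of_int a * \<tau> + of_int b) * cnj (of_int c * \<tau> + of_int d)) / (cmod (of_int c * \<tau> + of_int d))\<^sup>2"
    unfolding mob_def by (subst complex_div_cnj) (simp add: Im_divide_of_real flip: of_real_power)
  also have "Im ((of_int a * \<tau> + of_int b) * cnj (of_int c * \<tau> + of_int d)) = of_int (a * d - b * c) * Im \<tau>"
    by (simp add: algebra_simps)
  finally show eq: "Im (mob a b c d \<tau>) = Im \<tau> / (cmod (of_int c * \<tau> + of_int d))\<^sup>2" using det by simp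
  show "Im (mob a b c d \<tau>) > 0" unfolding eq using n0 v by simp
qed

lemma mob_mob:
  assumes det: "a' * d' - b' * c' = 1" and v: "Im \<tau> > 0"
  shows "mob a b c d (mob a' b' c' d' \<tau>) = mob (a * a' + b * c') (a * b' + b * d') (c * a' + d * c') (c * b' + d * d') \<tau>"
proof -
  define N where "N = of_int c' * \<tau> + of_int d'"
  have N: "N \<noteq> 0" using mob_in_uhp(1)[OF assms] by (simp add: N_def)
  have m: "mob a' b' c' d' \<tau> = (of_int a' * \<tau> + of_int b') / N" by (simp add: mob_def N_def)
  have "mob a b c d (mob a' b' c' d' \<tau>) = ((of_int a * (of_int a' * \<tau> + of_int b') + of_int b * N) / N) / ((of_int c * (of_int a' * \<tau> + of_int b') + of_int d * N) / N)"
  proof -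
    have "x * (y / N) + z = (x * y + z * N) / N" for x y z using N by (simp add: field_simps)
    then show ?thesis unfolding mob_def[of a b c d] m by (simp only:)
  qed
  also have "\<dots> = (of_int a * (of_int a' * \<tau> + of_int b') + of_int b * N) / (of_int c * (of_int a' * \<tau> + of_int b') + of_int d * N)"
    using N by simp
  finally show ?thesis by (simp add: mob_def N_def algebra_simps)
qed

text \<open>Operators compose in the order opposite to matrices: moving the outer matrix to the
  coefficient function by \<open>U\<close> leaves the inner one acting on \<open>\<tau>\<close>, and
  \<open>U'\<close> then acts on \<open>U C\<close>.\<close>

lemma intertwiner_comp:
  assumes U: "intertwiner P R a b c d U" and U': "intertwiner P R a' b' c' d' U'"
  shows "intertwiner P R (a * a' + b * c') (a * b' + b * d') (c * a' + d * c') (c * b' + d * d') (\<lambda>C. U' (U C))"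
proof -
  have det: "a * d - b * c = 1" "a' * d' - b' * c' = 1" using U U' by (auto simp: intertwiner_def)
  have per: "periodic2 P R C \<Longrightarrow> periodic2 P R (U C)" for C using U by (simp add: intertwiner_def)
  have "(a * a' + b * c') * (c * b' + d * d') - (a * b' + b * d') * (c * a' + d * c') = (a * d - b * c) * (a' * d' - b' * c')"
    by (simp add: algebra_simps)
  then have 1: "(a * a' + b * c') * (c * b' + d * d') - (a * b' + b * d') * (c * a' + d * c') = 1" by (simp add: det)
  have 2: "theta P R C (mob (a * a' + b * c') (a * b' + b * d') (c * a' + d * c') (c * b' + d * d') \<tau>) t = theta P R (U' (U C)) \<tau> t"
    if "periodic2 P R C" "Im \<tau> > 0" for C \<tau> t
  proof -
    have "theta P R C (mob a b c d (mob a' b' c' d' \<tau>)) t = theta P R (U C) (mob a' b' c' d' \<tau>) t"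
      using U that(1) mob_in_uhp(3)[OF det(2) that(2)] by (simp add: intertwiner_def)
    also have "\<dots> = theta P R (U' (U C)) \<tau> t"
      using U' per[OF that(1)] that(2) by (simp add: intertwiner_def)
    finally show ?thesis unfolding mob_mob[OF det(2) that(2)] .
  qed
  have 3: "U' (U (heis P R (x, x') (y, y') C)) = heis P R ((a * a' + b * c') * x - (c * a' + d * c') * y, (a * a' + b * c') * x' - (c * a' + d * c') * y')
       (- (a * b' + b * d') * x + (c * b' + d * d') * y, - (a * b' + b * d') * x' + (c * b' + d * d') * y') (U' (U C))"
    if "periodic2 P R C" for C x y x' y'
  proof -
    have "U' (U (heis P R (x, x') (y, y') C)) = U' (heis P R (a * x - c * y, a * x' - c * y') (- b * x + d * y, - b * x' + d * y') (U C))"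
      using U that by (simp add: intertwiner_def)
    also have "\<dots> = heis P R (a' * (a * x - c * y) - c' * (- b * x + d * y), a' * (a * x' - c * y') - c' * (- b * x' + d * y'))
        (- b' * (a * x - c * y) + d' * (- b * x + d * y), - b' * (a * x' - c * y') + d' * (- b * x' + d * y')) (U' (U C))"
      using U' per[OF that] unfolding intertwiner_def by blast
    finally show ?thesis by (simp add: algebra_simps)
  qed
  show ?thesis
    using U U' 1 2 3 unfolding intertwiner_def by simp
qed

text \<open>Euclid's algorithm on the first column. \<open>step\<close> multiplies on the left by
  T^q S; the matrix fed into it has first column (- c, a mod c), hence a smaller lower left entry
  than c.\<close>

lemma intertwiner_exists:
  assumes PR: "P > 0" "R > 0" "even P" "even R" and det: "a * d - b * c = 1"
  shows "\<exists>U. intertwiner P R a b c d U"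
  using det
proof (induction "nat \<bar>c\<bar>" arbitrary: a b c d rule: less_induct)
  case less
  have step: "\<exists>U. intertwiner P R (c' - q * a') (d' - q * b') (- a') (- b') U"
    if ex: "\<exists>U. intertwiner P R a' b' c' d' U" for q a' b' c' d'
  proof -
    obtain U where U: "intertwiner P R a' b' c' d' U" using ex ..
    show ?thesis
      using intertwiner_comp[OF intertwiner_T[OF PR, of q] intertwiner_comp[OF intertwiner_S[OF PR(1,2)] U]]
      by (auto simp: algebra_simps)
  qed
  have T: "\<exists>U. intertwiner P R 1 k 0 1 U" for k by (rule exI) (rule intertwiner_T[OF PR])
  show ?case
  proof (cases "c = 0")
    case True
    with less.prems have "a * d = 1" by simp
    then consider "a = 1" "d = 1" | "a = -1" "d = -1" using zmult_eq_1_iff by auto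
    then show ?thesis
    proof cases
      case 1 then show ?thesis using True T by simp
    next
      case 2
      \<comment> \<open>Minus the identity is S^2, so two steps with q = 0 start from the
        translation by - b.\<close>
      have "\<exists>U. intertwiner P R 0 1 (- 1) b U" using step[OF T[of "-b"], of 0] by simp
      from step[OF this, of 0] show ?thesis using 2 True by simp
    qed
  next
    case False
    have mod: "\<bar>a mod c\<bar> < \<bar>c\<bar>" using False by (rule abs_mod_less)
    define q where "q = a div c"
    have aq: "a mod c = a - q * c" by (simp add: q_def minus_div_mult_eq_mod)
    have "(- c) * (b - q * d) - (- d) * (a mod c) = 1"
      using less.prems unfolding aq by (simp add: algebra_simps)
    with less.hyps[of "a mod c" "- c" "b - q * d" "- d"] mod
    have "\<exists>U. intertwiner P R (- c) (- d) (a mod c) (b - q * d) U" by simp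
    from step[OF this, of q] show ?thesis unfolding aq by simp
  qed
qed

text \<open>The origin of the level: PR clears both denominators and the extra 2 absorbs the halves
  in the symmetric phases, so such shifts change every phase by an integer; the translation part is
  absorbed by the periods of \<open>C\<close>.\<close>

lemma heis_cong_mod:
  assumes PR: "P > 0" "R > 0" and C: "periodic2 P R C"
  shows "heis P R (x + int (2 * P * R) * i, x' + int (2 * P * R) * i') (y + int (2 * P * R) * j, y' + int (2 * P * R) * j') C = heis P R (x, x') (y, y') C"
proof
  fix w :: "int \<times> int"
  have 1: "C (fst w + (x + int (2 * P * R) * i), snd w + (x' + int (2 * P * R) * i')) = C (fst w + x, snd w + x')"
    using periodic2_mult[OF C, of "fst w + x" "2 * R * i" "snd w + x'" "2 * P * i'"] by (simp add: mult_ac add_ac)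
  have shift: "((of_int (x + int (2 * P * R) * i) * of_int (y + int (2 * P * R) * j) / 2 + of_int (y + int (2 * P * R) * j) * of_int m) / p)
      = ((of_int x * of_int y / 2 + of_int y * of_int m) / p) + real_of_int (r * (x * j + y * i + int (2 * P * R) * i * j + 2 * j * m))"
    if "real P * real R = p * of_int r" "p > 0" for x y i j m r :: int and p
  proof -
    have e: "of_int (x + int (2 * P * R) * i) = of_int x + 2 * (p * of_int r) * real_of_int i" for x i :: int
      by (simp flip: that(1))
    have "real_of_int (r * (x * j + y * i + int (2 * P * R) * i * j + 2 * j * m)) = of_int r * (of_int x * of_int j + of_int y * of_int i + 2 * (p * of_int r) * of_int i * of_int j + 2 * of_int j * of_int m)"
      by (simp add: that(1))
    then show ?thesis unfolding e using that(2) by (auto simp add: field_simps)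
  qed
  have s1: "((of_int (x + int (2 * P * R) * i) * of_int (y + int (2 * P * R) * j) / 2 + of_int (y + int (2 * P * R) * j) * of_int (fst w)) / real P)
      = ((of_int x * of_int y / 2 + of_int y * of_int (fst w)) / P) + real_of_int (int R * (x * j + y * i + int (2 * P * R) * i * j + 2 * j * fst w))"
    by (rule shift) (use PR in auto)
  have s2: "((of_int (x' + int (2 * P * R) * i') * of_int (y' + int (2 * P * R) * j') / 2 + of_int (y' + int (2 * P * R) * j') * of_int (snd w)) / real R)
      = ((of_int x' * of_int y' / 2 + of_int y' * of_int (snd w)) / R) + real_of_int (int P * (x' * j' + y' * i' + int (2 * P * R) * i' * j' + 2 * j' * snd w))"
    by (rule shift) (use PR in auto)
  have "ex ((a + of_int k) - (b + of_int l)) = ex (a - b)" for a b and k l :: int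
    by (rule ex_int_cancel) simp
  then show "heis P R (x + int (2 * P * R) * i, x' + int (2 * P * R) * i') (y + int (2 * P * R) * j, y' + int (2 * P * R) * j') C w = heis P R (x, x') (y, y') C w"
    unfolding heis_def fst_conv snd_conv s1 s2 1 by (simp del: of_int_mult of_int_add)
qed

text \<open>Commuting with the multiplications by characters makes \<open>U\<close> a multiplication operator, and
  commuting with translations then makes the multiplier constant.\<close>

lemma intertwiner_scalar:
  assumes PR: "P > 0" "R > 0" and U: "intertwiner P R a b c d U"
    and cong: "int (2 * P * R) dvd a - 1" "int (2 * P * R) dvd b" "int (2 * P * R) dvd c" "int (2 * P * R) dvd d - 1"
  shows "\<exists>k. cmod k = 1 \<and> (\<forall>C. periodic2 P R C \<longrightarrow> U C = (\<lambda>z. k * C z))"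
proof -
  have Uper: "periodic2 P R C \<Longrightarrow> periodic2 P R (U C)" for C using U by (simp add: intertwiner_def)
  have Uadd: "U (\<lambda>w. C w + D w) = (\<lambda>w. U C w + U D w)" for C D using U by (simp add: intertwiner_def)
  have Umult: "U (\<lambda>w. k * C w) = (\<lambda>w. k * U C w)" for k C using U by (simp add: intertwiner_def)
  have Usum: "U (\<lambda>w. \<Sum>y\<in>S. f y * D y w) = (\<lambda>w. \<Sum>y\<in>S. f y * U (D y) w)" if "finite S"
    for S :: "(int \<times> int) set" and f and D
    using that
  proof (induction S)
    case empty
    show ?case using Umult[of 0] by simp
  next
    case (insert y S)
    then show ?case by (simp add: Uadd Umult)
  qed
  obtain a' b' c' d' where e: "a = 1 + int (2 * P * R) * a'" "b = int (2 * P * R) * b'" "c = int (2 * P * R) * c'" "d = 1 + int (2 * P * R) * d'"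
  proof -
    obtain a' b' c' d' where "a - 1 = int (2 * P * R) * a'" "b = int (2 * P * R) * b'" "c = int (2 * P * R) * c'" "d - 1 = int (2 * P * R) * d'"
      using cong by (elim dvdE)
    then show thesis by (intro that[of a' b' c' d']) linarith+
  qed
  have comm: "U (heis P R (x, x') (y, y') C) = heis P R (x, x') (y, y') (U C)" if C: "periodic2 P R C" for C x x' y y'
  proof -
    have "U (heis P R (x, x') (y, y') C) = heis P R (a * x - c * y, a * x' - c * y') (- b * x + d * y, - b * x' + d * y') (U C)"
      using U C by (simp add: intertwiner_def)
    also have "\<dots> = heis P R (x + int (2 * P * R) * (a' * x - c' * y), x' + int (2 * P * R) * (a' * x' - c' * y'))
        (y + int (2 * P * R) * (- b' * x + d' * y), y' + int (2 * P * R) * (- b' * x' + d' * y')) (U C)"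
      by (simp add: e algebra_simps)
    also have "\<dots> = heis P R (x, x') (y, y') (U C)" by (rule heis_cong_mod[OF PR Uper[OF C]])
    finally show ?thesis .
  qed
  \<comment> \<open>The indicator of the residue class of \<open>z\<close>, expanded in characters:
    multiplication by it is a linear combination of Heisenberg operators, hence commutes with
    \<open>U\<close>.\<close>
  define \<delta> where "\<delta> = (\<lambda>z w. \<Sum>y\<in>rbox P R. chi P R y (- fst z, - snd z) / of_nat (P * R) * chi P R y w)"
  have PR0: "of_nat (P * R) \<noteq> (0::complex)" using PR by simp
  have \<delta>: "\<delta> z w = (if int P dvd fst w - fst z \<and> int R dvd snd w - snd z then (1::complex) else 0)" for z w
  proof -
    have "\<delta> z w = (\<Sum>y\<in>rbox P R. chi P R (fst w + - fst z, snd w + - snd z) y) / of_nat (P * R)"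
      unfolding \<delta>_def chi_add sum_divide_distrib by (intro sum.cong refl) (simp add: chi_swap[of P R _ "(_, _)"] chi_swap[of P R _ w] mult.commute)
    then show ?thesis using PR0 by (simp add: sum_chi[OF PR] del: of_nat_mult)
  qed
  have mult_chi: "heis P R (0, 0) y C w = chi P R y w * C w" for y C w
    by (simp add: heis_def chi_def)
  have U\<delta>: "U (\<lambda>w. \<delta> z w * C w) = (\<lambda>w. \<delta> z w * U C w)" if C: "periodic2 P R C" for z C
  proof -
    have "(\<lambda>w. \<delta> z w * D w) = (\<lambda>w. \<Sum>y\<in>rbox P R. chi P R y (- fst z, - snd z) / of_nat (P * R) * heis P R (0, 0) y D w)" for D
      by (simp add: \<delta>_def sum_distrib_right mult_chi mult.assoc)
    moreover have "U (heis P R (0, 0) y C) = heis P R (0, 0) y (U C)" for y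
      using comm[OF C, of 0 0 "fst y" "snd y"] by simp
    ultimately show ?thesis by (simp only: Usum[OF finite_rbox])
  qed
  define one where "one = (\<lambda>_::int\<times>int. 1::complex)"
  have one: "periodic2 P R one" by (simp add: one_def periodic2_def)
  define k where "k = U one (0, 0)"
  have const: "U one (m, n) = k" for m n
  proof -
    have "heis P R (m, n) (0, 0) C w = C (fst w + m, snd w + n)" for C w by (simp add: heis_def)
    then have h: "heis P R (m, n) (0, 0) one = one" "heis P R (m, n) (0, 0) (U one) (0, 0) = U one (m, n)"
      by (auto simp: one_def)
    show ?thesis using comm[OF one, of m n 0 0] h by (simp add: k_def)
  qed
  have UC: "U C = (\<lambda>z. k * C z)" if C: "periodic2 P R C" for C
  proof
    fix z
    have *: "(\<lambda>w. \<delta> z w * C w) = (\<lambda>w. C z * (\<delta> z w * one w))"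
    proof
      fix w
      show "\<delta> z w * C w = C z * (\<delta> z w * one w)"
      proof (cases "int P dvd fst w - fst z \<and> int R dvd snd w - snd z")
        case True
        then obtain i j where "fst w - fst z = int P * i" "snd w - snd z = int R * j" by (elim conjE dvdE)
        then have "fst z + int P * i = fst w" "snd z + int R * j = snd w" by linarith+
        then have "C w = C z" using periodic2_mult[OF C, of "fst z" i "snd z" j] by simp
        then show ?thesis using True by (simp add: one_def)
      next
        case False
        then have "\<delta> z w = 0" unfolding \<delta> by (rule if_not_P)
        then show ?thesis by simp
      qed
    qed
    have "U C z = \<delta> z z * U C z" by (simp add: \<delta>)
    also have "\<dots> = U (\<lambda>w. \<delta> z w * C w) z" by (simp add: U\<delta>[OF C])
    also have "\<dots> = C z * (\<delta> z z * U one z)" unfolding * Umult U\<delta>[OF one] ..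
    also have "\<dots> = k * C z" using const[of "fst z" "snd z"] by (simp add: \<delta>)
    finally show "U C z = k * C z" .
  qed
  \<comment> \<open>Unitarity, tested on the constant function, forces the scalar to have modulus
    one.\<close>
  have "sqnorm P R (U one) = sqnorm P R one" using U one by (simp add: intertwiner_def)
  then have "(cmod k)\<^sup>2 * (real P * real R) = real P * real R"
    unfolding UC[OF one] by (simp add: sqnorm_def one_def card_rbox mult.commute)
  then have "(cmod k)\<^sup>2 = 1" using PR by simp
  then have "cmod k = 1" using norm_ge_zero[of k] by (simp add: power2_eq_1_iff del: norm_ge_zero)
  then show ?thesis using UC by blast
qed

section \<open>Laplacians of exponential integrals\<close>

text \<open>The lattice sum and the integral over t are treated as one integral over a product
  measure, so that differentiation under it is justified once. There \<open>d\<close> is the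
  indefinite form and \<open>r\<close> its majorant.\<close>

definition lap_int :: "'a measure \<Rightarrow> ('a \<Rightarrow> real) \<Rightarrow> ('a \<Rightarrow> real) \<Rightarrow> ('a \<Rightarrow> complex) \<Rightarrow> complex \<Rightarrow> complex" where
  "lap_int M d r c \<tau> = (\<integral>x. c x * exp (\<i> * of_real (pi * Re \<tau> * d x) - of_real (pi * Im \<tau> * r x)) \<partial>M)"

text \<open>Decay at every rate \<open>e > 0\<close>, together with
  \<open>\<bar>d x\<bar> \<le> r x\<close>, makes the class stable under multiplying
  \<open>c\<close> by \<open>d\<close> or \<open>r\<close>, which is what the partial derivatives
  do.\<close>

definition lap_admissible :: "'a measure \<Rightarrow> ('a \<Rightarrow> real) \<Rightarrow> ('a \<Rightarrow> real) \<Rightarrow> ('a \<Rightarrow> complex) \<Rightarrow> bool" where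
  "lap_admissible M d r c \<longleftrightarrow> c \<in> borel_measurable M \<and> d \<in> borel_measurable M \<and> r \<in> borel_measurable M \<and>
     (\<forall>x. \<bar>d x\<bar> \<le> r x) \<and> (\<forall>e>0. integrable M (\<lambda>x. norm (c x) * exp (- e * r x)))"

lemma linear_times_exp_le:
  fixes e y :: real
  assumes "e > 0" "y \<ge> 0"
  shows "y * exp (- e * y) \<le> 2 / e * exp (- (e / 2) * y)"
proof -
  have "e / 2 * y \<le> exp (e / 2 * y)" using exp_ge_add_one_self[of "e / 2 * y"] by linarith
  then have "y \<le> 2 / e * exp (e / 2 * y)" using assms by (simp add: field_simps)
  then have "y * exp (- e * y) \<le> 2 / e * exp (e / 2 * y) * exp (- e * y)"
    by (rule mult_right_mono) simp
  also have "\<dots> = 2 / e * exp (- (e / 2) * y)"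
    by (simp add: exp_add[symmetric] mult.assoc)
  finally show ?thesis .
qed

lemma norm_integral_le:
  fixes f :: "'a \<Rightarrow> 'b::{banach, second_countable_topology}"
  assumes "integrable M f" "integrable M g" "\<And>x. norm (f x) \<le> g x"
  shows "norm (\<integral>x. f x \<partial>M) \<le> (\<integral>x. g x \<partial>M)"
  by (rule order_trans[OF integral_norm_bound]) (intro integral_mono integrable_norm assms)

lemma lap_admissible_mult_r:
  assumes "lap_admissible M d r c" and f: "f \<in> borel_measurable M" "\<And>x. \<bar>f x\<bar> \<le> r x"
  shows "lap_admissible M d r (\<lambda>x. of_real (f x) * c x)"
  unfolding lap_admissible_def
proof (intro conjI allI impI)
  have A: "c \<in> borel_measurable M" "d \<in> borel_measurable M" "r \<in> borel_measurable M" "\<And>x. \<bar>d x\<bar> \<le> r x"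
    and I: "\<And>e. e > 0 \<Longrightarrow> integrable M (\<lambda>x. norm (c x) * exp (- e * r x))"
    using assms(1) by (auto simp: lap_admissible_def)
  note [measurable] = A(1-3) f(1)
  show "d \<in> borel_measurable M" "r \<in> borel_measurable M" by fact+
  show "\<bar>d x\<bar> \<le> r x" for x by fact
  show "(\<lambda>x. complex_of_real (f x) * c x) \<in> borel_measurable M" by measurable
  fix e :: real assume e: "e > 0"
  have "integrable M (\<lambda>x. 2 / e * (norm (c x) * exp (- (e / 2) * r x)))"
    using I[of "e / 2"] e by simp
  then show "integrable M (\<lambda>x. norm (complex_of_real (f x) * c x) * exp (- e * r x))"
  proof (rule Bochner_Integration.integrable_bound)
    show "AE x in M. norm (norm (complex_of_real (f x) * c x) * exp (- e * r x)) \<le> norm (2 / e * (norm (c x) * exp (- (e / 2) * r x)))"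
    proof (rule AE_I2)
      fix x
      have "\<bar>f x\<bar> * exp (- e * r x) \<le> r x * exp (- e * r x)" using f(2) by (intro mult_right_mono) auto
      also have "\<dots> \<le> 2 / e * exp (- (e / 2) * r x)"
        using e A(4)[of x] by (intro linear_times_exp_le) auto
      finally have "norm (c x) * (\<bar>f x\<bar> * exp (- e * r x)) \<le> norm (c x) * (2 / e * exp (- (e / 2) * r x))"
        by (intro mult_left_mono) auto
      then show "norm (norm (complex_of_real (f x) * c x) * exp (- e * r x)) \<le> norm (2 / e * (norm (c x) * exp (- (e / 2) * r x)))"
        using e by (simp add: norm_mult abs_mult mult_ac)
    qed
  qed measurable
qed

lemma lap_admissible_cmult:
  assumes "lap_admissible M d r c"
  shows "lap_admissible M d r (\<lambda>x. k * c x)"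
  using assms unfolding lap_admissible_def by (auto simp: norm_mult mult.assoc)

lemma lap_integrable:
  assumes "lap_admissible M d r c" "Im \<tau> > 0"
  shows "integrable M (\<lambda>x. c x * exp (\<i> * of_real (pi * Re \<tau> * d x) - of_real (pi * Im \<tau> * r x)))"
proof -
  have [measurable]: "c \<in> borel_measurable M" "d \<in> borel_measurable M" "r \<in> borel_measurable M"
    and I: "integrable M (\<lambda>x. norm (c x) * exp (- (pi * Im \<tau>) * r x))"
    using assms pi_gt_zero by (auto simp: lap_admissible_def)
  show ?thesis
    by (rule Bochner_Integration.integrable_bound[OF I]) (auto simp: norm_mult)
qed

lemma lap_int_cmult: "lap_int M d r (\<lambda>x. k * c x) \<tau> = k * lap_int M d r c \<tau>"
  by (simp add: lap_int_def mult.assoc)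

lemma lap_int_minus: "lap_int M d r (\<lambda>x. - c x) \<tau> = - lap_int M d r c \<tau>"
  by (simp add: lap_int_def)

text \<open>The remainder exp w - 1 - w is at most exp of the absolute value of Re w, times the
  square of \<open>norm w\<close>. For \<open>norm h < Im \<tau> / 2\<close> this costs half of the
  decay and a factor r^2, both covered by admissibility, so the error is quadratic in h and the
  derivative follows straight from its definition.\<close>

lemma lap_int_has_derivative:
  assumes adm: "lap_admissible M d r c" and v: "Im \<tau> > 0"
  shows "(lap_int M d r c has_derivative
     (\<lambda>h. of_real (Re h) * (\<i> * of_real pi * lap_int M d r (\<lambda>x. of_real (d x) * c x) \<tau>)
        - of_real (Im h) * (of_real pi * lap_int M d r (\<lambda>x. of_real (r x) * c x) \<tau>))) (at \<tau>)"
proof -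
  define Ld where "Ld = lap_int M d r (\<lambda>x. of_real (d x) * c x) \<tau>"
  define Lr where "Lr = lap_int M d r (\<lambda>x. of_real (r x) * c x) \<tau>"
  define D where "D = (\<lambda>h. of_real (Re h) * (\<i> * of_real pi * Ld) - of_real (Im h) * (of_real pi * Lr))"
  have meas: "c \<in> borel_measurable M" "d \<in> borel_measurable M" "r \<in> borel_measurable M"
    and dr: "\<And>x. \<bar>d x\<bar> \<le> r x" using adm by (auto simp: lap_admissible_def)
  note [measurable] = meas
  have r0: "r x \<ge> 0" for x using dr[of x] by linarith
  have admd: "lap_admissible M d r (\<lambda>x. of_real (d x) * c x)" by (rule lap_admissible_mult_r[OF adm meas(2) dr])
  have admr: "lap_admissible M d r (\<lambda>x. of_real (r x) * c x)"
    by (rule lap_admissible_mult_r[OF adm meas(3)]) (use r0 in auto)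
  have admrr: "lap_admissible M d r (\<lambda>x. of_real (r x) * (of_real (r x) * c x))"
    by (rule lap_admissible_mult_r[OF admr meas(3)]) (use r0 in auto)
  define E where "E = (\<lambda>x. exp (\<i> * of_real (pi * Re \<tau> * d x) - of_real (pi * Im \<tau> * r x)))"
  define w where "w = (\<lambda>h x. \<i> * of_real (pi * Re h * d x) - of_real (pi * Im h * r x))"
  define C where "C = (\<integral>x. 4 * pi\<^sup>2 * (norm (of_real (r x) * (of_real (r x) * c x)) * exp (- (pi * Im \<tau> / 2) * r x)) \<partial>M)"
  have IC: "integrable M (\<lambda>x. 4 * pi\<^sup>2 * (norm (of_real (r x) * (of_real (r x) * c x)) * exp (- (pi * Im \<tau> / 2) * r x)))"
  proof -
    have "pi * Im \<tau> / 2 > 0" using v by simp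
    then show ?thesis using admrr unfolding lap_admissible_def by (intro integrable_mult_right) blast
  qed
  have bound: "norm (lap_int M d r c (\<tau> + h) - lap_int M d r c \<tau> - D h) \<le> C * (norm h)\<^sup>2" if h: "norm h < Im \<tau> / 2" for h
  proof -
    have vh: "Im (\<tau> + h) > 0" using h v abs_Im_le_cmod[of h] by simp
    have I1: "integrable M (\<lambda>x. c x * (E x * exp (w h x)))"
      using lap_integrable[OF adm vh] by (simp add: E_def w_def exp_add[symmetric] algebra_simps)
    have I2: "integrable M (\<lambda>x. c x * E x)" using lap_integrable[OF adm v] by (simp add: E_def)
    have I3: "integrable M (\<lambda>x. of_real (d x) * c x * E x)" using lap_integrable[OF admd v] by (simp add: E_def)
    have I4: "integrable M (\<lambda>x. of_real (r x) * c x * E x)" using lap_integrable[OF admr v] by (simp add: E_def)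
    have I5: "integrable M (\<lambda>x. c x * E x * w h x)"
    proof -
      have "integrable M (\<lambda>x. \<i> * of_real (pi * Re h) * (of_real (d x) * c x * E x) - of_real (pi * Im h) * (of_real (r x) * c x * E x))"
        using I3 I4 by (intro Bochner_Integration.integrable_diff integrable_mult_right)
      then show ?thesis by (simp add: w_def algebra_simps)
    qed
    have "D h = (\<integral>x. \<i> * of_real (pi * Re h) * (of_real (d x) * c x * E x) - of_real (pi * Im h) * (of_real (r x) * c x * E x) \<partial>M)"
      using I3 I4 by (subst Bochner_Integration.integral_diff) (auto simp: D_def Ld_def Lr_def lap_int_def E_def)
    also have "\<dots> = (\<integral>x. c x * E x * w h x \<partial>M)"
      by (intro Bochner_Integration.integral_cong) (auto simp: w_def algebra_simps)
    finally have Dh: "D h = (\<integral>x. c x * E x * w h x \<partial>M)" .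
    have L1: "lap_int M d r c (\<tau> + h) = (\<integral>x. c x * (E x * exp (w h x)) \<partial>M)"
      unfolding lap_int_def by (intro Bochner_Integration.integral_cong) (auto simp: E_def w_def exp_add[symmetric] algebra_simps)
    have L2: "lap_int M d r c \<tau> = (\<integral>x. c x * E x \<partial>M)" by (simp add: lap_int_def E_def)
    have "lap_int M d r c (\<tau> + h) - lap_int M d r c \<tau> - D h = (\<integral>x. c x * (E x * exp (w h x)) - c x * E x - c x * E x * w h x \<partial>M)"
      unfolding L1 L2 Dh using I1 I2 I5 by simp
    also have "norm \<dots> \<le> (\<integral>x. (norm h)\<^sup>2 * (4 * pi\<^sup>2 * (norm (of_real (r x) * (of_real (r x) * c x)) * exp (- (pi * Im \<tau> / 2) * r x))) \<partial>M)"
    proof (rule norm_integral_le)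
      fix x
      have "norm (exp (w h x) - 1 - w h x) \<le> exp \<bar>Re (w h x)\<bar> * (norm (w h x))\<^sup>2"
        using Taylor_exp[of "w h x" 1] by (simp add: power2_eq_square diff_diff_eq)
      also have "\<dots> \<le> exp (pi * (Im \<tau> / 2) * r x) * (2 * pi * norm h * r x)\<^sup>2"
      proof (intro mult_mono power_mono)
        have "\<bar>Re (w h x)\<bar> = pi * \<bar>Im h\<bar> * r x" using r0[of x] by (simp add: w_def abs_mult)
        also have "\<dots> \<le> pi * (Im \<tau> / 2) * r x"
          using h abs_Im_le_cmod[of h] r0[of x] by (intro mult_right_mono mult_left_mono) auto
        finally show "exp \<bar>Re (w h x)\<bar> \<le> exp (pi * (Im \<tau> / 2) * r x)" by simp
        have "norm (w h x) \<le> norm (\<i> * of_real (pi * Re h * d x)) + norm (complex_of_real (pi * Im h * r x))"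
          unfolding w_def by (rule norm_triangle_ineq4)
        also have "\<dots> = pi * \<bar>Re h\<bar> * \<bar>d x\<bar> + pi * \<bar>Im h\<bar> * r x"
          using r0[of x] by (simp add: norm_mult abs_mult)
        also have "\<dots> \<le> pi * norm h * r x + pi * norm h * r x"
          using dr[of x] abs_Re_le_cmod[of h] abs_Im_le_cmod[of h] r0[of x]
          by (intro add_mono mult_mono) auto
        finally show "norm (w h x) \<le> 2 * pi * norm h * r x" by simp
      qed auto
      finally have B: "norm (exp (w h x) - 1 - w h x) \<le> exp (pi * (Im \<tau> / 2) * r x) * (2 * pi * norm h * r x)\<^sup>2" .
      have "norm (c x * (E x * exp (w h x)) - c x * E x - c x * E x * w h x) = norm (c x) * norm (E x) * norm (exp (w h x) - 1 - w h x)"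
        by (simp add: norm_mult[symmetric] algebra_simps)
      also have "\<dots> \<le> norm (c x) * norm (E x) * (exp (pi * (Im \<tau> / 2) * r x) * (2 * pi * norm h * r x)\<^sup>2)"
        by (intro mult_left_mono B) auto
      also have "\<dots> = norm (c x) * (exp (- (pi * Im \<tau> * r x)) * exp (pi * (Im \<tau> / 2) * r x)) * (2 * pi * norm h * r x)\<^sup>2"
        by (simp add: E_def)
      also have "exp (- (pi * Im \<tau> * r x)) * exp (pi * (Im \<tau> / 2) * r x) = exp (- (pi * Im \<tau> / 2) * r x)"
        by (simp add: exp_add[symmetric])
      also have "norm (c x) * exp (- (pi * Im \<tau> / 2) * r x) * (2 * pi * norm h * r x)\<^sup>2 = (norm h)\<^sup>2 * (4 * pi\<^sup>2 * (norm (of_real (r x) * (of_real (r x) * c x)) * exp (- (pi * Im \<tau> / 2) * r x)))"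
        using r0[of x] by (simp add: norm_mult power2_eq_square)
      finally show "norm (c x * (E x * exp (w h x)) - c x * E x - c x * E x * w h x) \<le> (norm h)\<^sup>2 * (4 * pi\<^sup>2 * (norm (of_real (r x) * (of_real (r x) * c x)) * exp (- (pi * Im \<tau> / 2) * r x)))" .
    qed (use I1 I2 I5 IC in auto)
    also have "\<dots> = C * (norm h)\<^sup>2" unfolding C_def by (simp add: mult.commute)
    finally show ?thesis .
  qed
  have "(lap_int M d r c has_derivative D) (at \<tau>)"
    unfolding has_derivative_at
  proof
    show "bounded_linear D"
      unfolding D_def by (intro bounded_linear_sub bounded_linear_compose[OF bounded_linear_mult_left]
        bounded_linear_compose[OF bounded_linear_of_real] bounded_linear_Re bounded_linear_Im)
    show "(\<lambda>h. norm (lap_int M d r c (\<tau> + h) - lap_int M d r c \<tau> - D h) / norm h) \<midarrow>0\<rightarrow> 0"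
    proof (rule tendsto_0_le[where K = 1])
      show "((\<lambda>h::complex. C * norm h) \<longlongrightarrow> 0) (at 0)"
        by (rule tendsto_eq_intros refl | simp)+
      have "\<forall>\<^sub>F h in at (0::complex). norm h < Im \<tau> / 2 \<and> h \<noteq> 0"
        unfolding eventually_at using v by (intro exI[of _ "Im \<tau> / 2"]) auto
      then show "\<forall>\<^sub>F h in at 0. norm (norm (lap_int M d r c (\<tau> + h) - lap_int M d r c \<tau> - D h) / norm h) \<le> norm (C * norm h) * 1"
      proof eventually_elim
        case (elim h)
        then have "norm (lap_int M d r c (\<tau> + h) - lap_int M d r c \<tau> - D h) / norm h \<le> C * norm h"
          using bound[of h] by (simp add: pos_divide_le_eq power2_eq_square mult.assoc)
        then show ?case by simp
      qed
    qed
  qed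
  then show ?thesis by (simp add: D_def Ld_def Lr_def)
qed

section \<open>Smoothness and the eigenvalue equation under the integral\<close>

lemma open_uhp: "open upper_half_plane"
  unfolding upper_half_plane_def by (rule open_halfspace_Im_gt)

lemma partials_of_has_derivative:
  assumes "(F has_derivative (\<lambda>h. of_real (Re h) * a + of_real (Im h) * b)) (at \<tau>)"
  shows "partial_u F \<tau> = a" "partial_v F \<tau> = b"
  using frechet_derivative_at[OF assms, symmetric] by (simp_all add: partial_u_def partial_v_def)

lemma partial_cong:
  assumes "\<And>\<tau>. \<tau> \<in> upper_half_plane \<Longrightarrow> F \<tau> = G \<tau>" "\<tau> \<in> upper_half_plane"
  shows "partial_u F \<tau> = partial_u G \<tau>" "partial_v F \<tau> = partial_v G \<tau>"
proof -
  have "(F has_derivative D) (at \<tau>) \<longleftrightarrow> (G has_derivative D) (at \<tau>)" for D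
    using has_derivative_transform_within_open[OF _ open_uhp assms(2)] assms(1) by metis
  then have "frechet_derivative F (at \<tau>) = frechet_derivative G (at \<tau>)"
    by (simp add: frechet_derivative_def)
  then show "partial_u F \<tau> = partial_u G \<tau>" "partial_v F \<tau> = partial_v G \<tau>"
    by (simp_all add: partial_u_def partial_v_def)
qed

lemma Ck_cong:
  assumes "\<And>\<tau>. \<tau> \<in> upper_half_plane \<Longrightarrow> F \<tau> = G \<tau>"
  shows "Ck_on_uhp k F \<longleftrightarrow> Ck_on_uhp k G"
  using assms
proof (induction k arbitrary: F G)
  case 0 then show ?case by (auto intro: continuous_on_cong)
next
  case (Suc k)
  have "F differentiable_on upper_half_plane \<longleftrightarrow> G differentiable_on upper_half_plane"
    unfolding differentiable_on_def differentiable_def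
    using has_derivative_transform[of _ upper_half_plane F G] has_derivative_transform[of _ upper_half_plane G F] Suc.prems
    by metis
  then show ?case using Suc.IH[of "partial_u F" "partial_u G"] Suc.IH[of "partial_v F" "partial_v G"] partial_cong[OF Suc.prems]
    by simp
qed

text \<open>Since membership passes to both partial derivatives, one induction over the whole class
  gives all orders of differentiability.\<close>

lemma smooth_closed_class:
  assumes "\<C> F" and closed: "\<And>F. \<C> F \<Longrightarrow> \<exists>Fu Fv. \<C> Fu \<and> \<C> Fv \<and>
     (\<forall>\<tau>\<in>upper_half_plane. (F has_derivative (\<lambda>h. of_real (Re h) * Fu \<tau> + of_real (Im h) * Fv \<tau>)) (at \<tau>))"
  shows "smooth_on_uhp F"
proof -
  have "Ck_on_uhp k F" if "\<C> F" for k F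
    using that
  proof (induction k arbitrary: F)
    case 0
    from closed[OF 0] obtain Fu Fv where "\<forall>\<tau>\<in>upper_half_plane. (F has_derivative (\<lambda>h. of_real (Re h) * Fu \<tau> + of_real (Im h) * Fv \<tau>)) (at \<tau>)" by auto
    then show ?case by (auto intro!: continuous_at_imp_continuous_on has_derivative_continuous)
  next
    case (Suc k)
    from closed[OF Suc.prems] obtain Fu Fv where C: "\<C> Fu" "\<C> Fv"
      and D: "\<And>\<tau>. \<tau> \<in> upper_half_plane \<Longrightarrow> (F has_derivative (\<lambda>h. of_real (Re h) * Fu \<tau> + of_real (Im h) * Fv \<tau>)) (at \<tau>)" by auto
    have "F differentiable_on upper_half_plane"
      using D unfolding differentiable_on_def by (metis differentiable_def has_derivative_at_withinI)
    moreover have "Ck_on_uhp k (partial_u F) \<longleftrightarrow> Ck_on_uhp k Fu" "Ck_on_uhp k (partial_v F) \<longleftrightarrow> Ck_on_uhp k Fv"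
      using partials_of_has_derivative[OF D] by (intro Ck_cong; simp)+
    ultimately show ?case using Suc.IH C by simp
  qed
  then show ?thesis using assms(1) by (simp add: smooth_on_uhp_def)
qed

lemma powr_lap_has_derivative:
  assumes adm: "lap_admissible M d r c" and v: "\<tau> \<in> upper_half_plane"
  shows "((\<lambda>\<tau>. of_real (Im \<tau> powr s) * lap_int M d r c \<tau>) has_derivative
     (\<lambda>h. of_real (Re h) * (of_real (Im \<tau> powr s) * lap_int M d r (\<lambda>x. \<i> * of_real pi * (of_real (d x) * c x)) \<tau>)
        + of_real (Im h) * (of_real (Im \<tau> powr (s - 1)) * lap_int M d r (\<lambda>x. of_real s * c x) \<tau> + of_real (Im \<tau> powr s) * lap_int M d r (\<lambda>x. - of_real pi * (of_real (r x) * c x)) \<tau>))) (at \<tau>)"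
proof -
  have v: "Im \<tau> > 0" using v by (simp add: upper_half_plane_def)
  have 1: "((\<lambda>\<tau>. complex_of_real (Im \<tau> powr s)) has_derivative (\<lambda>h. of_real (Im h * (s * Im \<tau> powr (s - 1))))) (at \<tau>)"
    using v by (auto intro!: derivative_eq_intros simp: powr_diff field_simps)
  show ?thesis unfolding lap_int_cmult
    by (rule has_derivative_eq_rhs[OF has_derivative_mult[OF 1 lap_int_has_derivative[OF adm v]]])
       (simp add: fun_eq_iff algebra_simps)
qed

text \<open>A power of \<open>Im \<tau>\<close> times an admissible integral has a v-derivative with
  two terms, one from each factor; sums of such products, with arbitrary real exponents, are
  stable.\<close>

inductive lap_span :: "'a measure \<Rightarrow> ('a \<Rightarrow> real) \<Rightarrow> ('a \<Rightarrow> real) \<Rightarrow> (complex \<Rightarrow> complex) \<Rightarrow> bool" for M d r where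
  base: "lap_admissible M d r c \<Longrightarrow> lap_span M d r (\<lambda>\<tau>. of_real (Im \<tau> powr s) * lap_int M d r c \<tau>)"
| add: "lap_span M d r F \<Longrightarrow> lap_span M d r G \<Longrightarrow> lap_span M d r (\<lambda>\<tau>. F \<tau> + G \<tau>)"

lemma lap_admissible_derivs:
  assumes "lap_admissible M d r c"
  shows "lap_admissible M d r (\<lambda>x. of_real (d x) * c x)" "lap_admissible M d r (\<lambda>x. of_real (r x) * c x)"
proof -
  have "d \<in> borel_measurable M" "r \<in> borel_measurable M" "\<And>x. \<bar>d x\<bar> \<le> r x" using assms by (auto simp: lap_admissible_def)
  moreover from this(3) have "\<bar>r x\<bar> \<le> r x" for x by (metis abs_ge_zero abs_of_nonneg order_refl order_trans)
  ultimately show "lap_admissible M d r (\<lambda>x. of_real (d x) * c x)" "lap_admissible M d r (\<lambda>x. of_real (r x) * c x)"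
    using lap_admissible_mult_r[OF assms] by auto
qed

lemma smooth_powr_lap:
  assumes "lap_admissible M d r c"
  shows "smooth_on_uhp (\<lambda>\<tau>. of_real (Im \<tau> powr s) * lap_int M d r c \<tau>)"
proof (rule smooth_closed_class[of "lap_span M d r"])
  show "lap_span M d r (\<lambda>\<tau>. of_real (Im \<tau> powr s) * lap_int M d r c \<tau>)" by (rule lap_span.base[OF assms])
  fix F assume "lap_span M d r F"
  then show "\<exists>Fu Fv. lap_span M d r Fu \<and> lap_span M d r Fv \<and>
     (\<forall>\<tau>\<in>upper_half_plane. (F has_derivative (\<lambda>h. of_real (Re h) * Fu \<tau> + of_real (Im h) * Fv \<tau>)) (at \<tau>))"
  proof induction
    case (base c s)
    show ?case
      by (intro exI conjI ballI, rule_tac[3] powr_lap_has_derivative[OF base])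
         (intro lap_span.intros lap_admissible_cmult lap_admissible_derivs base)+
  next
    case (add F G)
    then obtain Fu Fv Gu Gv where *: "lap_span M d r Fu" "lap_span M d r Fv" "lap_span M d r Gu" "lap_span M d r Gv"
      "\<forall>\<tau>\<in>upper_half_plane. (F has_derivative (\<lambda>h. of_real (Re h) * Fu \<tau> + of_real (Im h) * Fv \<tau>)) (at \<tau>)"
      "\<forall>\<tau>\<in>upper_half_plane. (G has_derivative (\<lambda>h. of_real (Re h) * Gu \<tau> + of_real (Im h) * Gv \<tau>)) (at \<tau>)" by auto
    show ?case
    proof (intro exI conjI ballI)
      fix \<tau> assume t: "\<tau> \<in> upper_half_plane"
      show "((\<lambda>\<tau>. F \<tau> + G \<tau>) has_derivative (\<lambda>h. of_real (Re h) * (Fu \<tau> + Gu \<tau>) + of_real (Im h) * (Fv \<tau> + Gv \<tau>))) (at \<tau>)"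
        by (rule has_derivative_eq_rhs[OF has_derivative_add[OF *(5)[rule_format, OF t] *(6)[rule_format, OF t]]])
           (simp add: fun_eq_iff algebra_simps)
    qed (intro lap_span.add *)+
  qed
qed

text \<open>The power v^s alone contributes s (1 - s), which is 1/4 at s = 1/2. The cross term from
  v^s and the second derivatives of the integral must then cancel, and \<open>eq\<close> is exactly
  this cancellation at the point \<open>\<tau>\<close>.\<close>

lemma laplacian_sqrt_lap:
  assumes adm: "lap_admissible M d r c" and v: "\<tau> \<in> upper_half_plane"
    and eq: "lap_int M d r (\<lambda>x. of_real (r x) * c x) \<tau> = of_real (pi * Im \<tau>) *
       (lap_int M d r (\<lambda>x. of_real (r x) * (of_real (r x) * c x)) \<tau> - lap_int M d r (\<lambda>x. of_real (d x) * (of_real (d x) * c x)) \<tau>)"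
  shows "hyperbolic_laplacian (\<lambda>\<tau>. of_real (Im \<tau> powr (1/2)) * lap_int M d r c \<tau>) \<tau> = 1 / 4 * (of_real (Im \<tau> powr (1/2)) * lap_int M d r c \<tau>)"
proof -
  define F where "F = (\<lambda>s c \<tau>. complex_of_real (Im \<tau> powr s) * lap_int M d r c \<tau>)"
  define dm where "dm = (\<lambda>c x. of_real (d x) * (c x :: complex))"
  define rm where "rm = (\<lambda>c x. of_real (r x) * (c x :: complex))"
  have pu: "partial_u (F s c) \<tau> = \<i> * of_real pi * F s (dm c) \<tau>"
    and pv: "partial_v (F s c) \<tau> = of_real s * F (s - 1) c \<tau> - of_real pi * F s (rm c) \<tau>"
    if "lap_admissible M d r c" "\<tau> \<in> upper_half_plane" for s c \<tau>
    using partials_of_has_derivative[OF powr_lap_has_derivative[OF that, of s]]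
    by (simp_all add: F_def dm_def rm_def lap_int_cmult lap_int_minus)
  have admd: "lap_admissible M d r (dm c)" and admr: "lap_admissible M d r (rm c)"
    using lap_admissible_derivs[OF adm] by (auto simp: dm_def rm_def)
  have der: "((\<lambda>\<tau>. k * F s c \<tau>) has_derivative (\<lambda>h. of_real (Re h) * (k * partial_u (F s c) \<tau>) + of_real (Im h) * (k * partial_v (F s c) \<tau>))) (at \<tau>)"
    if a: "lap_admissible M d r c" for k s c
  proof -
    have "(F s c has_derivative (\<lambda>h. of_real (Re h) * partial_u (F s c) \<tau> + of_real (Im h) * partial_v (F s c) \<tau>)) (at \<tau>)"
      using powr_lap_has_derivative[OF a v, of s] partials_of_has_derivative[OF powr_lap_has_derivative[OF a v, of s]]
      by (simp add: F_def)
    from has_derivative_mult_right[OF this, of k] show ?thesis by (simp add: algebra_simps)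
  qed
  have uu: "partial_u (partial_u (F (1/2) c)) \<tau> = - of_real (pi\<^sup>2) * F (1/2) (dm (dm c)) \<tau>"
  proof -
    have "partial_u (partial_u (F (1/2) c)) \<tau> = partial_u (\<lambda>\<tau>. \<i> * of_real pi * F (1/2) (dm c) \<tau>) \<tau>"
      by (rule partial_cong[OF pu[OF adm] v])
    also have "\<dots> = \<i> * of_real pi * partial_u (F (1/2) (dm c)) \<tau>"
      by (rule partials_of_has_derivative[OF der[OF admd]])
    also have "\<dots> = (\<i> * \<i>) * (of_real (pi\<^sup>2) * F (1/2) (dm (dm c)) \<tau>)"
      by (simp only: pu[OF admd v] power2_eq_square of_real_mult mult_ac)
    finally show ?thesis by simp
  qed
  have vv: "partial_v (partial_v (F (1/2) c)) \<tau> = - 1/4 * F (-3/2) c \<tau> - of_real pi * F (-1/2) (rm c) \<tau> + of_real (pi\<^sup>2) * F (1/2) (rm (rm c)) \<tau>"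
  proof -
    have "partial_v (partial_v (F (1/2) c)) \<tau> = partial_v (\<lambda>\<tau>. 1/2 * F (-1/2) c \<tau> - of_real pi * F (1/2) (rm c) \<tau>) \<tau>"
      by (rule partial_cong[OF _ v]) (simp add: pv[OF adm])
    also have "\<dots> = 1/2 * partial_v (F (-1/2) c) \<tau> - of_real pi * partial_v (F (1/2) (rm c)) \<tau>"
      by (rule partials_of_has_derivative(2)[where a="1/2 * partial_u (F (-1/2) c) \<tau> - of_real pi * partial_u (F (1/2) (rm c)) \<tau>", OF has_derivative_eq_rhs[OF has_derivative_diff[OF der[OF adm] der[OF admr]]]])
         (simp add: fun_eq_iff algebra_simps)
    finally show ?thesis by (simp add: pv[OF adm v] pv[OF admr v] power2_eq_square algebra_simps)
  qed
  have v0: "Im \<tau> > 0" using v by (simp add: upper_half_plane_def)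
  define y where "y = Im \<tau> powr (1/2)"
  have y0: "y > 0" "Im \<tau> = y\<^sup>2" using v0 by (auto simp: y_def powr_half_sqrt)
  have pw: "Im \<tau> powr (-1/2) = 1 / y" "Im \<tau> powr (-3/2) = 1 / (y * y\<^sup>2)"
  proof -
    have "Im \<tau> powr (-1/2) = y / Im \<tau>" "Im \<tau> powr (-3/2) = y / (Im \<tau>)\<^sup>2"
      using v0 powr_diff[of "Im \<tau>" "1/2" 1] powr_diff[of "Im \<tau>" "1/2" 2] by (simp_all add: y_def)
    then show "Im \<tau> powr (-1/2) = 1 / y" "Im \<tau> powr (-3/2) = 1 / (y * y\<^sup>2)"
      using y0 by (simp_all add: power2_eq_square field_simps)
  qed
  define L Lr Lrr Ldd where "L = lap_int M d r c \<tau>" and "Lr = lap_int M d r (rm c) \<tau>"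
    and "Lrr = lap_int M d r (rm (rm c)) \<tau>" and "Ldd = lap_int M d r (dm (dm c)) \<tau>"
  have eq': "Lr = of_real pi * (of_real y)\<^sup>2 * (Lrr - Ldd)"
    using eq by (simp add: Lr_def Lrr_def Ldd_def rm_def dm_def y0)
  have "hyperbolic_laplacian (F (1/2) c) \<tau> = - (of_real (y\<^sup>2))\<^sup>2 * (- of_real (pi\<^sup>2) * (of_real y * Ldd) + (- 1/4 * (of_real (1 / (y * y\<^sup>2)) * L) - of_real pi * (of_real (1 / y) * Lr) + of_real (pi\<^sup>2) * (of_real y * Lrr)))"
    unfolding hyperbolic_laplacian_def uu vv unfolding F_def pw L_def[symmetric] Lr_def[symmetric] Lrr_def[symmetric] Ldd_def[symmetric] y_def[symmetric] unfolding y0(2) ..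
  also have "\<dots> = 1 / 4 * (of_real y * L)"
    unfolding eq' using y0 by (simp add: field_simps power2_eq_square)
  finally show ?thesis by (simp add: F_def y_def L_def)
qed

section \<open>The lift of an invariant function\<close>

text \<open>A pair \<open>(m, n)\<close> encodes the vector \<open>(m / ((M + 1) K), n / ((M - 1) K))\<close>, on which \<open>2 Q\<close> takes the
  value \<open>m\<^sup>2 / P - n\<^sup>2 / R\<close>; in these coordinates \<open>\<gamma>\<^sub>M\<close> is \<open>gam\<close>.\<close>

locale hyperbolic_lattice =
  fixes M K :: nat
  assumes M: "M \<ge> 2" and K: "K > 0" "even K"
begin

definition P where "P = (M + 1) * K\<^sup>2"
definition R where "R = (M - 1) * K\<^sup>2"
definition T where "T = arcosh (real M)"

abbreviation X1 where "X1 t z \<equiv> boost1 (real P) (real R) t (of_int (fst z)) (of_int (snd z))"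
abbreviation X2 where "X2 t z \<equiv> boost2 (real P) (real R) t (of_int (fst z)) (of_int (snd z))"
abbreviation kn where "kn \<tau> t z \<equiv> kern (real P) (real R) \<tau> t (of_int (fst z)) (of_int (snd z))"

definition gam :: "int \<times> int \<Rightarrow> int \<times> int" where
  "gam z = (int M * fst z + int (M + 1) * snd z, int (M - 1) * fst z + int M * snd z)"

definition gam_inv :: "int \<times> int \<Rightarrow> int \<times> int" where
  "gam_inv z = (int M * fst z - int (M + 1) * snd z, - int (M - 1) * fst z + int M * snd z)"

lemma PR: "P > 0" "R > 0" "even P" "even R" using M K by (auto simp: P_def R_def)
lemma PR': "real P > 0" "real R > 0" using PR by auto

lemma cosh_T: "cosh T = M" and sinh_T: "sinh T = sqrt (real M + 1) * sqrt (real M - 1)" and T_pos: "T > 0"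
proof -
  show "cosh T = M" using M by (simp add: T_def)
  have "T \<ge> 0" using M by (simp add: T_def)
  moreover have "T \<noteq> 0" using \<open>cosh T = M\<close> M by auto
  ultimately show T: "T > 0" by simp
  have "(sinh T)\<^sup>2 = (real M)\<^sup>2 - 1" using \<open>cosh T = M\<close> by (simp add: sinh_square_eq)
  also have "\<dots> = (sqrt (real M + 1) * sqrt (real M - 1))\<^sup>2" using M by (simp add: power_mult_distrib power2_eq_square algebra_simps)
  finally show "sinh T = sqrt (real M + 1) * sqrt (real M - 1)"
    by (rule power2_eq_imp_eq) (use T M in auto)
qed

lemma gam_gam_inv [simp]: "gam (gam_inv z) = z" "gam_inv (gam z) = z"
proof -
  have m: "int (M - 1) = int M - 1" using M by simp
  show "gam (gam_inv z) = z" "gam_inv (gam z) = z"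
    unfolding gam_def gam_inv_def m by (simp_all add: prod_eq_iff algebra_simps)
qed

lemma bij_gam: "bij gam" "bij gam_inv"
  by (rule o_bij[of gam_inv], simp_all add: fun_eq_iff, rule o_bij[of gam], simp_all add: fun_eq_iff)

lemma sqrt_PR: "sqrt (real P) = sqrt (real M + 1) * K" "sqrt (real R) = sqrt (real M - 1) * K"
proof -
  have "real P = (real M + 1) * (real K)\<^sup>2" "real R = (real M - 1) * (real K)\<^sup>2"
    using M by (auto simp: P_def R_def of_nat_diff algebra_simps)
  then show "sqrt (real P) = sqrt (real M + 1) * K" "sqrt (real R) = sqrt (real M - 1) * K"
    by (simp_all add: real_sqrt_mult)
qed

text \<open>In the coordinates m / sqrt P and n / sqrt R the matrix of \<open>gam\<close> has
  diagonal entries M = cosh T and off-diagonal entries sqrt (M^2 - 1) = sinh T.\<close>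

lemma boost_gam: "X1 t (gam z) = X1 (t + T) z" "X2 t (gam z) = X2 (t + T) z"
proof -
  define a b where "a = sqrt (real M + 1)" and "b = sqrt (real M - 1)"
  have ab: "a > 0" "b > 0" "a\<^sup>2 = real M + 1" "b\<^sup>2 = real M - 1" using M by (auto simp: a_def b_def)
  define m n where "m = real_of_int (fst z)" and "n = real_of_int (snd z)"
  have g: "real_of_int (fst (gam z)) = real M * m + a\<^sup>2 * n" "real_of_int (snd (gam z)) = b\<^sup>2 * m + real M * n"
    using M by (auto simp: gam_def ab m_def n_def of_nat_diff)
  have k0: "real K \<noteq> 0" using K by simp
  have c: "real_of_int (fst (gam z)) / (a * K) = m / (a * K) * cosh T + n / (b * K) * sinh T"
    "real_of_int (snd (gam z)) / (b * K) = m / (a * K) * sinh T + n / (b * K) * cosh T"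
    unfolding g cosh_T sinh_T a_def[symmetric] b_def[symmetric] using ab(1,2) k0
    by (simp_all add: field_simps power2_eq_square)
  show "X1 t (gam z) = X1 (t + T) z" "X2 t (gam z) = X2 (t + T) z"
    unfolding boost1_def boost2_def sqrt_PR a_def[symmetric] b_def[symmetric] c m_def[symmetric] n_def[symmetric]
    by (simp_all add: cosh_add sinh_add algebra_simps)
qed

lemma kn_gam: "kn \<tau> t (gam z) = kn \<tau> (t + T) z"
  unfolding kern_def boost_gam ..

definition majorant :: "(int \<times> int) \<times> real \<Rightarrow> real" where "majorant = (\<lambda>(z, t). (X1 t z)\<^sup>2 + (X2 t z)\<^sup>2)"
definition diff_form :: "(int \<times> int) \<times> real \<Rightarrow> real" where "diff_form = (\<lambda>(z, t). (X1 t z)\<^sup>2 - (X2 t z)\<^sup>2)"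
definition \<mu> :: "((int \<times> int) \<times> real) measure" where "\<mu> = count_space UNIV \<Otimes>\<^sub>M lborel"
text \<open>The restriction to one period sits in the coefficient, so that the integral defining
  \<open>lift\<close> runs over the whole product space and the results on \<open>lap_int\<close>
  apply.\<close>

definition window :: "(int \<times> int \<Rightarrow> complex) \<Rightarrow> (int \<times> int) \<times> real \<Rightarrow> complex" where
  "window C = (\<lambda>(z, t). indicat_real {-(T/2)..T/2} t *\<^sub>R C z)"

definition lift :: "(int \<times> int \<Rightarrow> complex) \<Rightarrow> complex \<Rightarrow> complex" where
  "lift C \<tau> = of_real (Im \<tau> powr (1/2)) * lap_int \<mu> diff_form majorant (window C) \<tau>"

text \<open>A boost scales the light-cone coordinates by exp t and exp (- t), so it shrinks the
  squared length at most by \<open>exp (- 2 * \<bar>t\<bar>)\<close>.\<close>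

lemma majorant_ge: "(X1 t z)\<^sup>2 + (X2 t z)\<^sup>2 \<ge> exp (- 2 * \<bar>t\<bar>) * ((of_int (fst z))\<^sup>2 / P + (of_int (snd z))\<^sup>2 / R)"
proof -
  define x y where "x = real_of_int (fst z) / sqrt P" and "y = real_of_int (snd z) / sqrt R"
  have xy: "(of_int (fst z))\<^sup>2 / P = x\<^sup>2" "(of_int (snd z))\<^sup>2 / R = y\<^sup>2"
    using PR by (auto simp: x_def y_def power_divide)
  have b: "of_int (fst z) * of_int (snd z) / sqrt (real P * real R) = x * y"
    by (simp add: x_def y_def real_sqrt_mult)
  have ab: "2 * \<bar>x * y\<bar> \<le> x\<^sup>2 + y\<^sup>2"
  proof -
    have "0 \<le> (\<bar>x\<bar> - \<bar>y\<bar>)\<^sup>2" by simp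
    then show ?thesis by (simp add: power2_diff abs_mult)
  qed
  have "\<bar>2 * (x * y) * sinh (2 * t)\<bar> = 2 * \<bar>x * y\<bar> * sinh (2 * \<bar>t\<bar>)"
    by (cases "t \<ge> 0") (auto simp: abs_mult)
  also have "\<dots> \<le> (x\<^sup>2 + y\<^sup>2) * sinh (2 * \<bar>t\<bar>)" using ab by (intro mult_right_mono) auto
  finally have s: "2 * (x * y) * sinh (2 * t) \<ge> - ((x\<^sup>2 + y\<^sup>2) * sinh (2 * \<bar>t\<bar>))" by linarith
  have c: "cosh (2 * t) = cosh (2 * \<bar>t\<bar>)" by (cases "t \<ge> 0") auto
  have "exp (- 2 * \<bar>t\<bar>) = cosh (2 * \<bar>t\<bar>) - sinh (2 * \<bar>t\<bar>)"
    using cosh_minus_sinh[of "2 * \<bar>t\<bar>"] by simp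
  then have "exp (- 2 * \<bar>t\<bar>) * (x\<^sup>2 + y\<^sup>2) = (x\<^sup>2 + y\<^sup>2) * cosh (2 * \<bar>t\<bar>) - (x\<^sup>2 + y\<^sup>2) * sinh (2 * \<bar>t\<bar>)"
    by (simp only: left_diff_distrib mult.commute[of "x\<^sup>2 + y\<^sup>2"])
  with s show ?thesis
    unfolding boost_sum_squares[OF PR'] xy b c by linarith
qed

lemma summable_exp_majorant:
  assumes "e > 0"
  shows "(\<lambda>z::int \<times> int. exp (- e * ((of_int (fst z))\<^sup>2 / P + (of_int (snd z))\<^sup>2 / R))) summable_on UNIV"
proof -
  have "(\<lambda>(m::int, n::int). exp (- (e / P) * (of_int m + 0)\<^sup>2) * exp (- (e / R) * (of_int n + 0)\<^sup>2)) summable_on UNIV"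
    using assms PR' by (intro summable_on_pair_prod summable_on_gaussian_int_shift) auto
  then show ?thesis by (simp add: case_prod_unfold exp_add[symmetric] algebra_simps add_divide_distrib)
qed

lemma continuous_boost: "continuous_on A (\<lambda>t. X1 t z)" "continuous_on A (\<lambda>t. X2 t z)"
  unfolding boost1_def boost2_def by (intro continuous_intros)+

lemma measurable_boost [measurable]: "(\<lambda>t. X1 t z) \<in> borel_measurable borel" "(\<lambda>t. X2 t z) \<in> borel_measurable borel"
  by (intro borel_measurable_continuous_onI continuous_boost)+

lemma admissible:
  assumes C: "periodic2 P R C"
  shows "lap_admissible \<mu> diff_form majorant (window C)"
  unfolding lap_admissible_def
proof (intro conjI allI impI)
  show "window C \<in> borel_measurable \<mu>" "diff_form \<in> borel_measurable \<mu>" "majorant \<in> borel_measurable \<mu>"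
    unfolding \<mu>_def window_def diff_form_def majorant_def
    by (intro measurable_pair_measure_countable1; simp)+
  show "\<bar>diff_form x\<bar> \<le> majorant x" for x
    by (cases x) (auto simp: diff_form_def majorant_def abs_le_iff)
  fix e :: real assume e: "e > 0"
  obtain B where B: "B \<ge> 0" "\<And>z. cmod (C z) \<le> B" using periodic2_bounded[OF C PR(1,2)] by metis
  \<comment> \<open>The value of the contraction factor in \<open>majorant_ge\<close> at the ends of
    the period, where the absolute value of t is T / 2.\<close>
  define E where "E = exp (- T)"
  have E: "E > 0" by (simp add: E_def)
  define f where "f = (\<lambda>z t. indicat_real {-(T/2)..T/2} t * (norm (C z) * exp (- e * ((X1 t z)\<^sup>2 + (X2 t z)\<^sup>2))))"
  have intf: "integrable lborel (f z)" for z
  proof -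
    have "set_integrable lborel {-(T/2)..T/2} (\<lambda>t. norm (C z) * exp (- e * ((X1 t z)\<^sup>2 + (X2 t z)\<^sup>2)))"
      by (intro borel_integrable_atLeastAtMost' continuous_intros continuous_boost)
    then show ?thesis by (simp add: set_integrable_def f_def)
  qed
  have le: "(\<integral>t. norm (f z t) \<partial>lborel) \<le> T * B * exp (- (e * E) * ((of_int (fst z))\<^sup>2 / P + (of_int (snd z))\<^sup>2 / R))" for z
  proof -
    define q where "q = B * exp (- (e * E) * ((of_int (fst z))\<^sup>2 / P + (of_int (snd z))\<^sup>2 / R))"
    have "(\<integral>t. norm (f z t) \<partial>lborel) \<le> (\<integral>t. indicat_real {-(T/2)..T/2} t * q \<partial>lborel)"
    proof (rule integral_mono)
      show "norm (f z t) \<le> indicat_real {-(T/2)..T/2} t * q" for t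
      proof (cases "t \<in> {-(T/2)..T/2}")
        case True
        then have "2 * \<bar>t\<bar> \<le> T" by (auto simp: abs_if)
        then have "exp (- 2 * \<bar>t\<bar>) \<ge> E" by (simp add: E_def)
        then have "E * ((of_int (fst z))\<^sup>2 / P + (of_int (snd z))\<^sup>2 / R) \<le> (X1 t z)\<^sup>2 + (X2 t z)\<^sup>2"
          by (intro order_trans[OF mult_right_mono majorant_ge]) auto
        then have "exp (- e * ((X1 t z)\<^sup>2 + (X2 t z)\<^sup>2)) \<le> exp (- (e * E) * ((of_int (fst z))\<^sup>2 / P + (of_int (snd z))\<^sup>2 / R))"
          using e by (simp add: mult.assoc)
        then have "norm (C z) * exp (- e * ((X1 t z)\<^sup>2 + (X2 t z)\<^sup>2)) \<le> q"
          unfolding q_def using B by (intro mult_mono) auto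
        then show ?thesis using True by (simp add: f_def)
      qed (simp add: f_def)
      show "integrable lborel (\<lambda>t. indicat_real {-(T/2)..T/2} t * q)"
        by (intro integrable_mult_left) (simp add: integrable_indicator_iff emeasure_lborel_Icc_eq)
    qed (use intf in auto)
    also have "\<dots> = T * q" using T_pos by simp
    finally show ?thesis by (simp add: q_def mult.assoc)
  qed
  have sm: "(\<lambda>z. \<integral>t. norm (f z t) \<partial>lborel) summable_on UNIV"
    by (rule summable_on_comparison_test[OF summable_on_cmult_right[OF summable_exp_majorant[of "e * E"], of "T * B"]])
       (use le e E in auto)
  have "integrable \<mu> (\<lambda>(z, t). f z t)"
    unfolding \<mu>_def by (rule integrable_count_space_pair[OF lborel.sigma_finite_measure_axioms intf sm])
  then show "integrable \<mu> (\<lambda>x. norm (window C x) * exp (- e * majorant x))"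
    by (simp add: f_def window_def majorant_def case_prod_unfold mult_ac)
qed

lemma lap_int_terms:
  assumes C: "periodic2 P R C" and v: "Im \<tau> > 0"
  defines "f \<equiv> \<lambda>z t. indicat_real {-(T/2)..T/2} t *\<^sub>R (C z * kn \<tau> t z)"
  shows "integrable lborel (f z)" "(\<lambda>z. \<integral>t. norm (f z t) \<partial>lborel) summable_on UNIV"
    "lap_int \<mu> diff_form majorant (window C) \<tau> = (\<integral>x. (\<lambda>(z, t). f z t) x \<partial>\<mu>)"
proof -
  have kn: "exp (\<i> * of_real (pi * Re \<tau> * diff_form (z, t)) - of_real (pi * Im \<tau> * majorant (z, t))) = kn \<tau> t z" for z t
    unfolding kern_eq[OF PR'] diff_form_def majorant_def by (simp only: prod.case boost_diff_squares[OF PR'])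
  have eq: "window C x * exp (\<i> * of_real (pi * Re \<tau> * diff_form x) - of_real (pi * Im \<tau> * majorant x)) = (\<lambda>(z, t). f z t) x" for x
    by (cases x) (simp only: kn prod.case window_def f_def, simp)
  show "lap_int \<mu> diff_form majorant (window C) \<tau> = (\<integral>x. (\<lambda>(z, t). f z t) x \<partial>\<mu>)"
    unfolding lap_int_def eq ..
  show "integrable lborel (f z)" for z
  proof -
    have "set_integrable lborel {-(T/2)..T/2} (\<lambda>t. C z * kn \<tau> t z)"
      unfolding kern_def by (intro borel_integrable_atLeastAtMost' continuous_intros continuous_boost)
    then show ?thesis by (simp add: set_integrable_def f_def)
  qed
  have I: "integrable \<mu> (\<lambda>x. norm ((\<lambda>(z, t). f z t) x))"
    using lap_integrable[OF admissible[OF C] v] unfolding eq by (rule integrable_norm)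
  interpret C: sigma_finite_measure "count_space (UNIV :: (int \<times> int) set)" by (rule sigma_finite_measure_count_space)
  interpret PP: pair_sigma_finite "count_space (UNIV :: (int \<times> int) set)" lborel ..
  have "integrable (count_space UNIV) (\<lambda>z. \<integral>t. norm (f z t) \<partial>lborel)"
    using PP.integrable_fst'[OF I[unfolded \<mu>_def]] by simp
  then show "(\<lambda>z. \<integral>t. norm (f z t) \<partial>lborel) summable_on UNIV"
    by (simp add: integrable_count_space_iff)
qed

text \<open>The same double integral is used in both orders: with the sum outside for the unfolding,
  and with the integral outside, in \<open>lift_theta\<close>, for the modular
  transformation.\<close>

lemma lift_infsum:
  assumes C: "periodic2 P R C" and v: "Im \<tau> > 0"
  shows "(\<lambda>z. norm (C z * (LINT t:{-(T/2)..T/2}|lborel. kn \<tau> t z))) summable_on UNIV"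
    and "lift C \<tau> = of_real (sqrt (Im \<tau>)) * (\<Sum>\<^sub>\<infinity>z. C z * (LINT t:{-(T/2)..T/2}|lborel. kn \<tau> t z))"
proof -
  have eq: "(\<integral>t. indicat_real {-(T/2)..T/2} t *\<^sub>R (C z * kn \<tau> t z) \<partial>lborel) = C z * (LINT t:{-(T/2)..T/2}|lborel. kn \<tau> t z)" for z
    unfolding set_lebesgue_integral_def integral_mult_right_zero[symmetric]
    by (intro Bochner_Integration.integral_cong) auto
  note L = lborel.sigma_finite_measure_axioms lap_int_terms(1,2)[OF C v]
  show "(\<lambda>z. norm (C z * (LINT t:{-(T/2)..T/2}|lborel. kn \<tau> t z))) summable_on UNIV"
    using summable_integrals[OF L] unfolding eq .
  show "lift C \<tau> = of_real (sqrt (Im \<tau>)) * (\<Sum>\<^sub>\<infinity>z. C z * (LINT t:{-(T/2)..T/2}|lborel. kn \<tau> t z))"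
  proof -
    have "lap_int \<mu> diff_form majorant (window C) \<tau> = (\<Sum>\<^sub>\<infinity>z. C z * (LINT t:{-(T/2)..T/2}|lborel. kn \<tau> t z))"
      unfolding lap_int_terms(3)[OF C v] unfolding \<mu>_def eq[symmetric] by (rule integral_count_space_pair[OF L])
    then show ?thesis using v by (simp add: lift_def powr_half_sqrt)
  qed
qed

lemma lift_theta:
  assumes C: "periodic2 P R C" and v: "Im \<tau> > 0"
  shows "lift C \<tau> = (LINT t:{-(T/2)..T/2}|lborel. theta P R C \<tau> t)"
proof -
  note L = lborel.sigma_finite_measure_axioms lap_int_terms(1,2)[OF C v]
  have pw: "(\<lambda>z. norm (indicat_real {-(T/2)..T/2} t *\<^sub>R (C z * kn \<tau> t z))) summable_on UNIV" for t
    unfolding norm_scaleR by (intro summable_on_cmult_right abs_summable_theta[OF C PR(1,2) v])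
  have "lap_int \<mu> diff_form majorant (window C) \<tau> = (\<integral>t. (\<Sum>\<^sub>\<infinity>z. indicat_real {-(T/2)..T/2} t *\<^sub>R (C z * kn \<tau> t z)) \<partial>lborel)"
    unfolding lap_int_terms(3)[OF C v] unfolding \<mu>_def
    by (rule trans[OF integral_count_space_pair[OF L] infsum_integral_swap[OF L pw]])
  also have "\<dots> = (LINT t:{-(T/2)..T/2}|lborel. \<Sum>\<^sub>\<infinity>z. C z * kn \<tau> t z)"
    unfolding set_lebesgue_integral_def infsum_scaleR_right ..
  finally show ?thesis
    using v by (simp add: lift_def theta_def powr_half_sqrt)
qed

lemma lift_modular:
  assumes "intertwiner P R a b c d U" "periodic2 P R C" "Im \<tau> > 0"
  shows "lift C (mob a b c d \<tau>) = lift (U C) \<tau>"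
proof -
  have det: "a * d - b * c = 1" and U: "periodic2 P R (U C)" and th: "theta P R C (mob a b c d \<tau>) t = theta P R (U C) \<tau> t" for t
    using assms by (auto simp: intertwiner_def)
  show ?thesis
    unfolding lift_theta[OF assms(2) mob_in_uhp(3)[OF det assms(3)]] lift_theta[OF U assms(3)] th ..
qed

lemma smooth_lift: "periodic2 P R C \<Longrightarrow> smooth_on_uhp (lift C)"
  unfolding lift_def[abs_def] by (rule smooth_powr_lap[OF admissible])

text \<open>Stated for every periodic function rather than for \<open>gam\<close>-invariant ones: at
  another cusp the lift of \<open>C\<close> becomes the lift of \<open>U C\<close>, of which only
  periodicity is known.\<close>

lemma lift_growth:
  assumes C: "periodic2 P R C"
  shows "\<exists>B. \<forall>\<tau>. Im \<tau> \<ge> 1 \<longrightarrow> cmod (lift C \<tau>) \<le> B * Im \<tau> ^ 1"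
proof (intro exI allI impI)
  define B where "B = (\<integral>x. norm (window C x) * exp (- pi * majorant x) \<partial>\<mu>)"
  fix \<tau> :: complex assume v: "Im \<tau> \<ge> 1"
  then have v0: "Im \<tau> > 0" by simp
  have I: "integrable \<mu> (\<lambda>x. norm (window C x) * exp (- pi * majorant x))"
    using admissible[OF C] pi_gt_zero unfolding lap_admissible_def by blast
  have "cmod (lap_int \<mu> diff_form majorant (window C) \<tau>) \<le> B"
    unfolding lap_int_def B_def
  proof (rule norm_integral_le[OF lap_integrable[OF admissible[OF C] v0] I])
    fix x
    have "majorant x \<ge> 0" by (cases x) (auto simp: majorant_def)
    then have "majorant x * 1 \<le> majorant x * Im \<tau>" using v by (intro mult_left_mono) auto
    then have "norm (window C x) * exp (- (pi * Im \<tau> * majorant x)) \<le> norm (window C x) * exp (- pi * majorant x)"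
      by (intro mult_left_mono) (auto simp: mult_ac)
    then show "cmod (window C x * exp (\<i> * of_real (pi * Re \<tau> * diff_form x) - of_real (pi * Im \<tau> * majorant x))) \<le> cmod (window C x) * exp (- pi * majorant x)"
      by (simp add: norm_mult)
  qed
  moreover have "Im \<tau> powr (1/2) \<le> Im \<tau> powr 1" using v by (intro powr_mono) auto
  moreover have "B \<ge> 0" unfolding B_def by (intro Bochner_Integration.integral_nonneg) auto
  ultimately have "Im \<tau> powr (1/2) * cmod (lap_int \<mu> diff_form majorant (window C) \<tau>) \<le> Im \<tau> powr 1 * B"
    using v0 by (intro mult_mono) auto
  then show "cmod (lift C \<tau>) \<le> B * Im \<tau> ^ 1"
    using v0 by (simp add: lift_def norm_mult mult.commute)
qed

end

section \<open>A telescoping weight and the Bessel integral\<close>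

text \<open>If y is an integer, the two tiles that meet at y contribute one half each; otherwise the
  tile that contains y contributes 1.\<close>

lemma has_sum_sgn_telescope:
  fixes y :: real
  shows "((\<lambda>k::int. (sgn (of_int k + 1 - y) - sgn (of_int k - y)) / 2) has_sum 1) UNIV"
proof (rule has_sum_finite_neutralI[of "{\<lfloor>y\<rfloor> - 1, \<lfloor>y\<rfloor>}"])
  fix k :: int assume k: "k \<in> UNIV - {\<lfloor>y\<rfloor> - 1, \<lfloor>y\<rfloor>}"
  then have "k \<le> \<lfloor>y\<rfloor> - 2 \<or> k \<ge> \<lfloor>y\<rfloor> + 1" by auto
  then have "of_int k + 1 - y < 0 \<or> of_int k - y > 0" by linarith
  then show "(sgn (of_int k + 1 - y) - sgn (of_int k - y)) / 2 = 0" by (auto simp: sgn_if)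
next
  show "1 = (\<Sum>k\<in>{\<lfloor>y\<rfloor> - 1, \<lfloor>y\<rfloor>}. (sgn (of_int k + 1 - y) - sgn (of_int k - y)) / 2)"
  proof -
    have "of_int \<lfloor>y\<rfloor> + 1 - y > 0" "of_int \<lfloor>y\<rfloor> - 1 - y < 0" by linarith+
    then show ?thesis by (simp add: diff_divide_distrib)
  qed
qed auto

text \<open>Evenness of cosh doubles the integral that defines K_0, and the substitution 2 (t - s)
  halves it again.\<close>

lemma
  fixes y s :: real
  assumes y: "y > 0"
  shows integrable_exp_cosh: "integrable lborel (\<lambda>t. exp (- y * cosh (2 * (t - s))))"
    and integral_exp_cosh: "(LINT t|lborel. exp (- y * cosh (2 * (t - s)))) = bessel_K0 y"
proof -
  define f where "f = (\<lambda>t. exp (- y * cosh t))"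
  have fm [measurable]: "f \<in> borel_measurable borel"
    unfolding f_def by (intro borel_measurable_continuous_onI continuous_intros)
  have gauss: "integrable lborel (\<lambda>t. exp (- (y / 4) * t\<^sup>2))"
    using integrable_norm[OF integrable_gaussian_fourier[of "4 * pi / y" 0 0]] y by (simp add: norm_mult mult.commute)
  \<comment> \<open>This crude bound suffices for a comparison with a Gaussian.\<close>
  have cosh_ge: "cosh t \<ge> t\<^sup>2 / 4" for t :: real
  proof -
    have "1 + \<bar>t\<bar> + \<bar>t\<bar>\<^sup>2 / 2 \<le> exp \<bar>t\<bar>" by (rule exp_lower_Taylor_quadratic) simp
    then have "t\<^sup>2 / 2 \<le> exp \<bar>t\<bar>" by simp
    also have "exp \<bar>t\<bar> \<le> 2 * cosh t" by (cases "t \<ge> 0") (simp_all add: cosh_def)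
    finally show ?thesis by simp
  qed
  have f: "integrable lborel f"
  proof (rule Bochner_Integration.integrable_bound[OF gauss])
    show "AE t in lborel. norm (f t) \<le> norm (exp (- (y / 4) * t\<^sup>2))"
    proof (rule AE_I2)
      fix t :: real
      have "y * (t\<^sup>2 / 4) \<le> y * cosh t" using y by (intro mult_left_mono cosh_ge) auto
      then show "norm (f t) \<le> norm (exp (- (y / 4) * t\<^sup>2))" by (simp add: f_def)
    qed
  qed simp
  have shift: "(\<lambda>t. exp (- y * cosh (2 * (t - s)))) = (\<lambda>t. f (- 2 * s + 2 * t))"
    by (simp add: f_def fun_eq_iff algebra_simps)
  show "integrable lborel (\<lambda>t. exp (- y * cosh (2 * (t - s))))"
    unfolding shift by (rule lborel_integrable_real_affine[OF f]) simp
  have "(LINT t|lborel. f t) = 2 * (LINT t|lborel. f (- 2 * s + 2 * t))"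
    using lborel_integral_real_affine[of 2 f "- 2 * s"] by simp
  then have 1: "(LINT t|lborel. exp (- y * cosh (2 * (t - s)))) = (LINT t|lborel. f t) / 2"
    unfolding shift by simp
  have I1: "integrable lborel (\<lambda>t. indicat_real {0..} t * f t)" and I2: "integrable lborel (\<lambda>t. indicat_real {..0} t * f t)"
    using integrable_mult_indicator[OF _ f, of "{0..}"] integrable_mult_indicator[OF _ f, of "{..0}"] by auto
  have "(LINT t|lborel. f t) = (LINT t|lborel. indicat_real {0..} t * f t + indicat_real {..0} t * f t)"
  proof (rule integral_cong_AE)
    have "AE t in lborel. t \<noteq> (0::real)" by (rule AE_lborel_singleton)
    then show "AE t in lborel. f t = indicat_real {0..} t * f t + indicat_real {..0} t * f t"
      by eventually_elim (auto simp: indicator_def)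
  qed auto
  also have "\<dots> = (LINT t|lborel. indicat_real {0..} t * f t) + (LINT t|lborel. indicat_real {..0} t * f t)"
    by (rule Bochner_Integration.integral_add[OF I1 I2])
  also have "(LINT t|lborel. indicat_real {..0} t * f t) = (LINT t|lborel. indicat_real {0..} t * f t)"
    by (subst lborel_integral_real_affine[of "-1" _ 0])
       (auto intro!: Bochner_Integration.integral_cong simp: f_def indicator_def)
  also have "(LINT t|lborel. indicat_real {0..} t * f t) = bessel_K0 y"
    by (simp add: bessel_K0_def set_lebesgue_integral_def f_def)
  finally show "(LINT t|lborel. exp (- y * cosh (2 * (t - s)))) = bessel_K0 y" unfolding 1 by simp
qed

section \<open>The eigenvalue equation for the lift\<close>

context hyperbolic_lattice
begin

lemma boost_deriv:
  "((\<lambda>t. X1 t z) has_real_derivative X2 t z) (at t within A)"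
  "((\<lambda>t. X2 t z) has_real_derivative X1 t z) (at t within A)"
proof -
  have "((\<lambda>t. x * cosh t + y * sinh t) has_real_derivative (x * sinh t + y * cosh t)) (at t within A)"
    "((\<lambda>t. x * sinh t + y * cosh t) has_real_derivative (x * cosh t + y * sinh t)) (at t within A)" for x y :: real
    by (auto intro!: derivative_eq_intros)
  then show "((\<lambda>t. X1 t z) has_real_derivative X2 t z) (at t within A)"
    "((\<lambda>t. X2 t z) has_real_derivative X1 t z) (at t within A)"
    unfolding boost1_def boost2_def by blast+
qed

text \<open>Up to a factor independent of \<open>t\<close>, a primitive in \<open>t\<close> of \<open>\<Delta> - 1/4\<close> applied to the theta kernel.\<close>

definition bdry_term :: "complex \<Rightarrow> real \<Rightarrow> int \<times> int \<Rightarrow> complex" where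
  "bdry_term \<tau> t z = of_real (X1 t z * X2 t z) * kn \<tau> t z"

text \<open>Each of X1 and X2 is the derivative of the other. So the derivative of X1 X2 is the
  majorant, that of the majorant is 4 X1 X2, and 4 X1^2 X2^2 is the difference of the squares of
  majorant and form: the integrand is the derivative of \<open>bdry_term\<close>.\<close>

lemma integral_bdry_term:
  "(LINT t:{-(T/2)..T/2}|lborel. of_real (majorant (z, t) - pi * Im \<tau> * ((majorant (z, t))\<^sup>2 - (diff_form (z, t))\<^sup>2)) * kn \<tau> t z)
     = bdry_term \<tau> (T/2) z - bdry_term \<tau> (-(T/2)) z"
proof -
  define k where "k = exp (\<i> * of_real (pi * Re \<tau> * ((of_int (fst z))\<^sup>2 / P - (of_int (snd z))\<^sup>2 / R)))"
  define e where "e = (\<lambda>t. exp (- pi * Im \<tau> * ((X1 t z)\<^sup>2 + (X2 t z)\<^sup>2)))"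
  define b where "b = (\<lambda>t. X1 t z * X2 t z * e t)"
  define b' where "b' = (\<lambda>t. (majorant (z, t) - pi * Im \<tau> * ((majorant (z, t))\<^sup>2 - (diff_form (z, t))\<^sup>2)) * e t)"
  have kn: "kn \<tau> t z = k * of_real (e t)" for t
    unfolding kern_eq[OF PR'] k_def e_def exp_of_real[symmetric] exp_add[symmetric]
    by (rule arg_cong[of _ _ exp]) simp
  have sq: "(majorant (z, t))\<^sup>2 - (diff_form (z, t))\<^sup>2 = 4 * (X1 t z)\<^sup>2 * (X2 t z)\<^sup>2" for t
    by (simp add: majorant_def diff_form_def power2_eq_square algebra_simps)
  have de: "(e has_real_derivative (- 4 * pi * Im \<tau> * (X1 t z * X2 t z) * e t)) (at t within A)" for t A
    unfolding e_def by (rule derivative_eq_intros boost_deriv refl)+ (simp add: algebra_simps)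
  have der: "(b has_real_derivative b' t) (at t within A)" for t A
    unfolding b_def
    by (rule derivative_eq_intros boost_deriv de refl)+
       (unfold b'_def sq, simp add: majorant_def power2_eq_square algebra_simps)
  have cont: "continuous_on {-(T/2)..T/2} b'"
    unfolding b'_def e_def majorant_def diff_form_def prod.case by (intro continuous_intros continuous_boost)
  have "(LINT t:{-(T/2)..T/2}|lborel. b' t) = integral {-(T/2)..T/2} b'"
    by (rule set_borel_integral_eq_integral(2)[OF borel_integrable_atLeastAtMost'[OF cont]])
  also have "\<dots> = b (T/2) - b (-(T/2))"
    using T_pos der by (intro integral_unique fundamental_theorem_of_calculus) (auto simp: has_real_derivative_iff_has_vector_derivative)
  finally have 1: "(LINT t:{-(T/2)..T/2}|lborel. b' t) = b (T/2) - b (-(T/2))" .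
  have "(LINT t:{-(T/2)..T/2}|lborel. of_real (majorant (z, t) - pi * Im \<tau> * ((majorant (z, t))\<^sup>2 - (diff_form (z, t))\<^sup>2)) * kn \<tau> t z)
     = (LINT t|lborel. k * complex_of_real (indicat_real {-(T/2)..T/2} t *\<^sub>R b' t))"
    unfolding set_lebesgue_integral_def
    by (intro Bochner_Integration.integral_cong) (auto simp: kn b'_def indicator_def)
  also have "\<dots> = k * of_real (LINT t:{-(T/2)..T/2}|lborel. b' t)"
    unfolding set_lebesgue_integral_def integral_mult_right_zero integral_complex_of_real ..
  finally show ?thesis unfolding 1 by (simp add: bdry_term_def kn b_def algebra_simps)
qed

lemma summable_bdry_term:
  assumes C: "periodic2 P R C" and v: "Im \<tau> > 0"
  shows "(\<lambda>z. C z * bdry_term \<tau> t z) summable_on UNIV"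
proof (rule abs_summable_summable)
  obtain B where B: "B \<ge> 0" "\<And>z. cmod (C z) \<le> B" using periodic2_bounded[OF C PR(1,2)] by metis
  \<comment> \<open>Half of the height pays for the polynomial factor of \<open>bdry_term\<close>;
    the other half keeps the series summable.\<close>
  have sm: "(\<lambda>z::int\<times>int. norm (kn (Complex 0 (Im \<tau> / 2)) t z)) summable_on UNIV"
    using summable_on_kern[OF PR', of "Complex 0 (Im \<tau> / 2)" t] v by (simp add: case_prod_unfold)
  show "(\<lambda>z. norm (C z * bdry_term \<tau> t z)) summable_on UNIV"
  proof (rule summable_on_comparison_test[OF summable_on_cmult_right[OF sm, of "B * (2 / (pi * Im \<tau>))"]])
    fix z :: "int \<times> int"
    define \<rho> where "\<rho> = (X1 t z)\<^sup>2 + (X2 t z)\<^sup>2"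
    have \<rho>: "\<rho> \<ge> 0" by (simp add: \<rho>_def)
    have "0 \<le> (\<bar>X1 t z\<bar> - \<bar>X2 t z\<bar>)\<^sup>2" by simp
    then have "2 * \<bar>X1 t z * X2 t z\<bar> \<le> \<rho>" by (simp add: \<rho>_def power2_diff abs_mult)
    then have le: "\<bar>X1 t z * X2 t z\<bar> \<le> \<rho>" by linarith
    have "norm (bdry_term \<tau> t z) = \<bar>X1 t z * X2 t z\<bar> * exp (- (pi * Im \<tau>) * \<rho>)"
      by (simp add: bdry_term_def norm_mult norm_kern[OF PR'] \<rho>_def abs_mult)
    also have "\<dots> \<le> \<rho> * exp (- (pi * Im \<tau>) * \<rho>)" using le by (intro mult_right_mono) auto
    also have "\<dots> \<le> 2 / (pi * Im \<tau>) * exp (- (pi * Im \<tau> / 2) * \<rho>)"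
      using v \<rho> by (intro linear_times_exp_le) auto
    also have "exp (- (pi * Im \<tau> / 2) * \<rho>) = norm (kn (Complex 0 (Im \<tau> / 2)) t z)"
      by (simp add: norm_kern[OF PR'] \<rho>_def)
    finally have "norm (C z) * norm (bdry_term \<tau> t z) \<le> B * (2 / (pi * Im \<tau>) * norm (kn (Complex 0 (Im \<tau> / 2)) t z))"
      using B by (intro mult_mono) auto
    then show "norm (C z * bdry_term \<tau> t z) \<le> B * (2 / (pi * Im \<tau>)) * norm (kn (Complex 0 (Im \<tau> / 2)) t z)"
      by (simp add: norm_mult mult.assoc)
  qed auto
qed

lemma lift_laplacian:
  assumes C: "periodic2 P R C" and inv: "\<And>z. C (gam z) = C z" and \<tau>: "\<tau> \<in> upper_half_plane"
  shows "hyperbolic_laplacian (lift C) \<tau> = 1 / 4 * lift C \<tau>"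
proof -
  have v: "Im \<tau> > 0" using \<tau> by (simp add: upper_half_plane_def)
  define E where "E = (\<lambda>x. exp (\<i> * of_real (pi * Re \<tau> * diff_form x) - of_real (pi * Im \<tau> * majorant x)))"
  note adm = admissible[OF C]
  note admr = lap_admissible_derivs(2)[OF adm] and admd = lap_admissible_derivs(1)[OF adm]
  have I1: "integrable \<mu> (\<lambda>x. of_real (majorant x) * window C x * E x)"
    and I2: "integrable \<mu> (\<lambda>x. of_real (majorant x) * (of_real (majorant x) * window C x) * E x)"
    and I3: "integrable \<mu> (\<lambda>x. of_real (diff_form x) * (of_real (diff_form x) * window C x) * E x)"
    using lap_integrable[OF admr v] lap_integrable[OF lap_admissible_derivs(2)[OF admr] v] lap_integrable[OF lap_admissible_derivs(1)[OF admd] v]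
    unfolding E_def by simp_all
  define g where "g = (\<lambda>(z, t). indicat_real {-(T/2)..T/2} t *\<^sub>R (C z * (of_real (majorant (z, t) - pi * Im \<tau> * ((majorant (z, t))\<^sup>2 - (diff_form (z, t))\<^sup>2)) * kn \<tau> t z)))"
  have gE: "of_real (majorant x) * window C x * E x - of_real (pi * Im \<tau>) * (of_real (majorant x) * (of_real (majorant x) * window C x) * E x - of_real (diff_form x) * (of_real (diff_form x) * window C x) * E x) = g x" for x
  proof -
    obtain z t where x: "x = (z, t)" by (cases x)
    have kn: "E (z, t) = kn \<tau> t z"
      unfolding kern_eq[OF PR'] E_def diff_form_def majorant_def by (simp only: prod.case boost_diff_squares[OF PR'])
    have "of_real a * (i *\<^sub>R c) * k - of_real w * (of_real a * (of_real a * (i *\<^sub>R c)) * k - of_real b * (of_real b * (i *\<^sub>R c)) * k)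
       = i *\<^sub>R (c * (of_real (a - w * (a\<^sup>2 - b\<^sup>2)) * k))" for a b w i :: real and c k :: complex
      by (simp add: scaleR_conv_of_real power2_eq_square algebra_simps)
    then show ?thesis unfolding x g_def window_def prod.case kn .
  qed
  have Ig: "integrable \<mu> g"
    using Bochner_Integration.integrable_diff[OF I1 integrable_mult_right[OF Bochner_Integration.integrable_diff[OF I2 I3], of "of_real (pi * Im \<tau>)"]]
    unfolding gE by simp
  have "lap_int \<mu> diff_form majorant (\<lambda>x. of_real (majorant x) * window C x) \<tau> - of_real (pi * Im \<tau>) *
       (lap_int \<mu> diff_form majorant (\<lambda>x. of_real (majorant x) * (of_real (majorant x) * window C x)) \<tau> - lap_int \<mu> diff_form majorant (\<lambda>x. of_real (diff_form x) * (of_real (diff_form x) * window C x)) \<tau>)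
     = (\<integral>x. g x \<partial>\<mu>)"
  proof -
    have "lap_int \<mu> diff_form majorant c \<tau> = (\<integral>x. c x * E x \<partial>\<mu>)" for c
      by (simp add: lap_int_def E_def)
    then show ?thesis unfolding gE[symmetric] using I1 I2 I3 by (simp del: of_real_mult)
  qed
  also have "\<dots> = 0"
  proof -
    interpret C: sigma_finite_measure "count_space (UNIV :: (int \<times> int) set)" by (rule sigma_finite_measure_count_space)
    interpret PP: pair_sigma_finite "count_space (UNIV :: (int \<times> int) set)" lborel ..
    have inner: "(\<integral>t. g (z, t) \<partial>lborel) = C z * bdry_term \<tau> (T/2) z - C z * bdry_term \<tau> (-(T/2)) z" for z
    proof -
      have "(\<integral>t. g (z, t) \<partial>lborel) = (\<integral>t. C z * (indicat_real {-(T/2)..T/2} t *\<^sub>R (of_real (majorant (z, t) - pi * Im \<tau> * ((majorant (z, t))\<^sup>2 - (diff_form (z, t))\<^sup>2)) * kn \<tau> t z)) \<partial>lborel)"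
        by (intro Bochner_Integration.integral_cong) (auto simp: g_def)
      also have "\<dots> = C z * (bdry_term \<tau> (T/2) z - bdry_term \<tau> (-(T/2)) z)"
        unfolding integral_mult_right_zero integral_bdry_term[unfolded set_lebesgue_integral_def] ..
      finally show ?thesis by (simp add: right_diff_distrib)
    qed
    have "(\<integral>x. g x \<partial>\<mu>) = (\<integral>z. (\<integral>t. g (z, t) \<partial>lborel) \<partial>count_space UNIV)"
      unfolding \<mu>_def by (rule PP.integral_fst'[OF Ig[unfolded \<mu>_def], symmetric])
    also have "\<dots> = (\<Sum>\<^sub>\<infinity>z. \<integral>t. g (z, t) \<partial>lborel)"
      using PP.integrable_fst'[OF Ig[unfolded \<mu>_def]] by (intro integral_count_space_infsum) (simp add: integrable_count_space_iff)
    also have "\<dots> = (\<Sum>\<^sub>\<infinity>z. C z * bdry_term \<tau> (T/2) z) - (\<Sum>\<^sub>\<infinity>z. C z * bdry_term \<tau> (-(T/2)) z)"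
      unfolding inner using infsum_add[OF summable_bdry_term[OF C v, of "T/2"] summable_on_uminus[THEN iffD2, OF summable_bdry_term[OF C v, of "-(T/2)"]]]
      by (simp add: infsum_uminus)
    \<comment> \<open>\<open>gam\<close> moves the lower end of the period to the upper end, so by
      invariance of \<open>C\<close> the two boundary sums agree term by term after
      reindexing.\<close>
    also have "(\<Sum>\<^sub>\<infinity>z. C z * bdry_term \<tau> (-(T/2)) z) = (\<Sum>\<^sub>\<infinity>z. C (gam z) * bdry_term \<tau> (-(T/2)) (gam z))"
      by (rule infsum_reindex_bij_betw[OF bij_gam(1), symmetric])
    also have "\<dots> = (\<Sum>\<^sub>\<infinity>z. C z * bdry_term \<tau> (T/2) z)"
      unfolding inv bdry_term_def boost_gam kn_gam by simp
    finally show ?thesis by simp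
  qed
  finally have "lap_int \<mu> diff_form majorant (\<lambda>x. of_real (majorant x) * window C x) \<tau> = of_real (pi * Im \<tau>) *
       (lap_int \<mu> diff_form majorant (\<lambda>x. of_real (majorant x) * (of_real (majorant x) * window C x)) \<tau> - lap_int \<mu> diff_form majorant (\<lambda>x. of_real (diff_form x) * (of_real (diff_form x) * window C x)) \<tau>)"
    by simp
  from laplacian_sqrt_lap[OF adm \<tau> this] show ?thesis
    unfolding lift_def[abs_def] .
qed

section \<open>Fourier expansion of the lift\<close>

definition qnorm :: "int \<times> int \<Rightarrow> real" where
  "qnorm z = (of_int (fst z))\<^sup>2 / P - (of_int (snd z))\<^sup>2 / R"

lemma qnorm_eq: "qnorm z = of_int (int (M - 1) * (fst z)\<^sup>2 - int (M + 1) * (snd z)\<^sup>2) / ((real M + 1) * (real M - 1) * (real K)\<^sup>2)"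
proof -
  have "real P = (real M + 1) * (real K)\<^sup>2" "real R = (real M - 1) * (real K)\<^sup>2"
    using M by (auto simp: P_def R_def of_nat_diff algebra_simps)
  moreover have "x / (a * k) - y / (b * k) = (b * x - a * y) / (a * b * k)" if "a \<noteq> 0" "b \<noteq> 0" "k \<noteq> 0" for x y a b k :: real
    using that by (simp add: field_simps)
  ultimately show ?thesis using M K by (simp add: qnorm_def of_nat_diff)
qed

text \<open>A nontrivial zero would make (M - 1) (M + 1) = M^2 - 1 the square of an integer, but it
  lies strictly between (M - 1)^2 and M^2.\<close>

lemma qnorm_nonzero:
  assumes "z \<noteq> (0, 0)"
  shows "qnorm z \<noteq> 0"
proof
  assume "qnorm z = 0"
  define m n where "m = fst z" and "n = snd z"
  have "real_of_int (int (M - 1) * m\<^sup>2 - int (M + 1) * n\<^sup>2) = 0"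
    using \<open>qnorm z = 0\<close> M K unfolding qnorm_eq m_def n_def by simp
  then have e: "int (M - 1) * m\<^sup>2 = int (M + 1) * n\<^sup>2" by linarith
  have n0: "n \<noteq> 0"
  proof
    assume "n = 0"
    with e M have "m = 0" by simp
    with \<open>n = 0\<close> assms show False by (simp add: m_def n_def prod_eq_iff)
  qed
  have "(int (M - 1) * m)\<^sup>2 = int (M - 1) * (int (M - 1) * m\<^sup>2)" by (simp add: power2_eq_square)
  also have "\<dots> = int (M - 1) * int (M + 1) * n\<^sup>2" unfolding e by simp
  finally have sq: "(int (M - 1) * m)\<^sup>2 = int (M - 1) * int (M + 1) * n\<^sup>2" .
  then have "n\<^sup>2 dvd (int (M - 1) * m)\<^sup>2" by simp
  then have "n dvd int (M - 1) * m" by simp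
  then obtain k where k: "int (M - 1) * m = n * k" by (elim dvdE)
  have "n\<^sup>2 * k\<^sup>2 = n\<^sup>2 * (int (M - 1) * int (M + 1))" using sq unfolding k by (simp add: power_mult_distrib mult_ac)
  then have kk: "k\<^sup>2 = int (M - 1) * int (M + 1)" using n0 by simp
  have "int (M - 1) = int M - 1" using M by simp
  then have kk: "\<bar>k\<bar>\<^sup>2 = (int M)\<^sup>2 - 1" unfolding power2_abs kk by (simp add: power2_eq_square algebra_simps)
  then have "\<bar>k\<bar>\<^sup>2 < (int M)\<^sup>2" by simp
  then have "\<bar>k\<bar> < int M" by (rule power2_less_imp_less) simp
  then have "\<bar>k\<bar>\<^sup>2 \<le> (int M - 1)\<^sup>2" by (intro power_mono) auto
  also have "(int M - 1)\<^sup>2 = (int M)\<^sup>2 - 1 - 2 * (int M - 1)" by (simp add: power2_eq_square algebra_simps)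
  finally have "2 * (int M - 1) \<le> 0" using kk by linarith
  then show False using M by simp
qed

text \<open>With x and y the coordinates at t = 0 and Q the absolute value of x^2 - y^2, the
  identity (2 x y)^2 + Q^2 = (x^2 + y^2)^2 shows that (x^2 + y^2) / Q and 2 x y / Q are a cosh and a
  sinh of the same argument. This covers vectors of either sign of \<open>qnorm\<close> at
  once.\<close>

lemma boost_cosh:
  assumes "z \<noteq> (0, 0)"
  shows "\<exists>s. \<forall>t. (X1 t z)\<^sup>2 + (X2 t z)\<^sup>2 = \<bar>qnorm z\<bar> * cosh (2 * (t - s)) \<and> 2 * (X1 t z * X2 t z) = \<bar>qnorm z\<bar> * sinh (2 * (t - s))"
proof -
  define x y where "x = X1 0 z" and "y = X2 0 z"
  have X: "X1 t z = x * cosh t + y * sinh t" "X2 t z = x * sinh t + y * cosh t" for t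
    by (simp_all add: x_def y_def boost1_def boost2_def)
  have q: "qnorm z = x\<^sup>2 - y\<^sup>2" unfolding x_def y_def boost_diff_squares[OF PR'] qnorm_def ..
  define Q where "Q = \<bar>qnorm z\<bar>"
  have Q: "Q > 0" using qnorm_nonzero[OF assms] by (simp add: Q_def)
  \<comment> \<open>Chosen so that the product X1 X2, and with it the derivative of the majorant,
    vanishes at t = s.\<close>
  define s where "s = - arsinh (2 * x * y / Q) / 2"
  have sh: "sinh (2 * s) = - (2 * x * y / Q)" by (simp add: s_def)
  have "(cosh (2 * s))\<^sup>2 = ((x\<^sup>2 + y\<^sup>2) / Q)\<^sup>2"
  proof -
    have "(cosh (2 * s))\<^sup>2 = (2 * x * y / Q)\<^sup>2 + 1" unfolding cosh_square_eq sh by simp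
    also have "\<dots> = ((2 * x * y)\<^sup>2 + Q\<^sup>2) / Q\<^sup>2" using Q by (simp add: field_simps)
    also have "(2 * x * y)\<^sup>2 + Q\<^sup>2 = (x\<^sup>2 + y\<^sup>2)\<^sup>2" unfolding Q_def power2_abs q by (simp add: power2_eq_square algebra_simps)
    finally show ?thesis by (simp add: power_divide)
  qed
  then have ch: "cosh (2 * s) = (x\<^sup>2 + y\<^sup>2) / Q" using Q by (subst (asm) power2_eq_iff_nonneg) auto
  have d: "cosh (2 * (t - s)) = cosh (2 * t) * cosh (2 * s) - sinh (2 * t) * sinh (2 * s)"
    "sinh (2 * (t - s)) = sinh (2 * t) * cosh (2 * s) - cosh (2 * t) * sinh (2 * s)" for t
    unfolding right_diff_distrib by (simp_all add: cosh_diff sinh_diff)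
  have "(X1 t z)\<^sup>2 + (X2 t z)\<^sup>2 = Q * cosh (2 * (t - s))" "2 * (X1 t z * X2 t z) = Q * sinh (2 * (t - s))" for t
    unfolding d sh ch X cosh_double[of t] sinh_double[of t] using Q
    by (simp_all add: power2_eq_square field_simps)
  then show ?thesis unfolding Q_def by blast
qed

text \<open>By \<open>boost_cosh\<close> the majorant is a translated cosh in 2 t, while the phase
  depends on \<open>qnorm z\<close> alone and leaves the integral.\<close>

lemma
  assumes z: "z \<noteq> (0, 0)" and v: "Im \<tau> > 0"
  shows integrable_kn: "integrable lborel (\<lambda>t. kn \<tau> t z)"
    and integral_kn: "(LINT t|lborel. kn \<tau> t z) = of_real (bessel_K0 (pi * Im \<tau> * \<bar>qnorm z\<bar>)) * ex (Re \<tau> * qnorm z / 2)"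
proof -
  obtain s where s: "\<And>t. (X1 t z)\<^sup>2 + (X2 t z)\<^sup>2 = \<bar>qnorm z\<bar> * cosh (2 * (t - s))" using boost_cosh[OF z] by auto
  define y where "y = pi * Im \<tau> * \<bar>qnorm z\<bar>"
  have y: "y > 0" using v qnorm_nonzero[OF z] by (simp add: y_def)
  have kn: "kn \<tau> t z = ex (Re \<tau> * qnorm z / 2) * of_real (exp (- y * cosh (2 * (t - s))))" for t
    unfolding kern_eq[OF PR'] s qnorm_def[symmetric] y_def ex_def ee_def
    by (simp add: exp_of_real[symmetric] exp_add[symmetric] algebra_simps)
  show "integrable lborel (\<lambda>t. kn \<tau> t z)"
    unfolding kn by (intro integrable_mult_right integrable_of_real integrable_exp_cosh y)
  show "(LINT t|lborel. kn \<tau> t z) = of_real (bessel_K0 (pi * Im \<tau> * \<bar>qnorm z\<bar>)) * ex (Re \<tau> * qnorm z / 2)"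
    unfolding kn integral_mult_right_zero integral_complex_of_real integral_exp_cosh[OF y] by (simp add: y_def)
qed

text \<open>\<open>2 X1 X2\<close> is the \<open>t\<close>-derivative of \<open>(X1\<^sup>2 + X2\<^sup>2) / 2\<close>, so for \<open>z \<noteq> 0\<close> this is \<open>1\<close>, \<open>1/2\<close> or \<open>0\<close>
  according as the boost minimising the majorant of \<open>z\<close> lies inside, on the boundary of, or outside the period.\<close>

definition wt :: "int \<times> int \<Rightarrow> real" where
  "wt z = (sgn (X1 (T/2) z * X2 (T/2) z) - sgn (X1 (-(T/2)) z * X2 (-(T/2)) z)) / 2"

definition gam_pow :: "int \<Rightarrow> int \<times> int \<Rightarrow> int \<times> int" where
  "gam_pow k = (if k \<ge> 0 then gam ^^ nat k else gam_inv ^^ nat (- k))"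

lemma boost_gam_inv: "X1 t (gam_inv z) = X1 (t - T) z" "X2 t (gam_inv z) = X2 (t - T) z"
  using boost_gam[of "t - T" "gam_inv z"] by auto

lemma boost_gam_pow: "X1 t (gam_pow k z) = X1 (t + of_int k * T) z" "X2 t (gam_pow k z) = X2 (t + of_int k * T) z"
proof -
  have 1: "X1 t ((gam ^^ n) z) = X1 (t + of_nat n * T) z \<and> X2 t ((gam ^^ n) z) = X2 (t + of_nat n * T) z" for n t
    by (induction n arbitrary: t) (auto simp: boost_gam algebra_simps)
  have 2: "X1 t ((gam_inv ^^ n) z) = X1 (t - of_nat n * T) z \<and> X2 t ((gam_inv ^^ n) z) = X2 (t - of_nat n * T) z" for n t
    by (induction n arbitrary: t) (auto simp: boost_gam_inv algebra_simps)
  show "X1 t (gam_pow k z) = X1 (t + of_int k * T) z" "X2 t (gam_pow k z) = X2 (t + of_int k * T) z"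
    using 1[of t "nat k"] 2[of t "nat (- k)"] by (auto simp: gam_pow_def)
qed

lemma invariant_gam_pow:
  assumes "\<And>z. C (gam z) = C z"
  shows "C (gam_pow k z) = C z"
proof -
  have i: "C (gam_inv z) = C z" for z using assms[of "gam_inv z"] by simp
  have "C ((gam ^^ n) z) = C z" "C ((gam_inv ^^ n) z) = C z" for n
    by (induction n) (auto simp: assms i)
  then show ?thesis by (simp add: gam_pow_def)
qed

lemma bij_gam_pow: "bij (gam_pow k)"
  unfolding gam_pow_def using bij_gam bij_fn by auto

lemma gam_pow_zero: "gam_pow k z = (0, 0) \<longleftrightarrow> z = (0, 0)"
proof -
  have "(gam ^^ n) (0, 0) = (0, 0)" "(gam_inv ^^ n) (0, 0) = (0, 0)" for n
    by (induction n) (auto simp: gam_def gam_inv_def)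
  then have "gam_pow k (0, 0) = (0, 0)" by (simp add: gam_pow_def)
  then show ?thesis using bij_is_inj[OF bij_gam_pow[of k]] by (metis injD)
qed

text \<open>The sign of X1 X2 at t is that of t - s. Passing from z to \<open>gam_pow k z\<close>
  moves the window by k T, so the weights along an orbit test in which tile of the line s
  lies.\<close>

lemma has_sum_wt:
  assumes z: "z \<noteq> (0, 0)"
  shows "((\<lambda>k. wt (gam_pow k z)) has_sum 1) UNIV" "wt z \<ge> 0"
proof -
  obtain s where s: "\<And>t. 2 * (X1 t z * X2 t z) = \<bar>qnorm z\<bar> * sinh (2 * (t - s))" using boost_cosh[OF z] by auto
  have sg: "sgn (X1 t z * X2 t z) = sgn (t - s)" for t
  proof -
    have "sgn (X1 t z * X2 t z) = sgn (2 * (X1 t z * X2 t z))" by (simp add: sgn_mult)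
    also have "\<dots> = sgn (sinh (2 * (t - s)))" unfolding s using qnorm_nonzero[OF z] by (simp add: sgn_mult)
    also have "\<dots> = sgn (t - s)" by (simp add: sgn_if)
    finally show ?thesis .
  qed
  \<comment> \<open>Position of s in units of the period, shifted so that the window centred at 0
    becomes the tile from 0 to 1.\<close>
  define y where "y = s / T + 1 / 2"
  have w: "wt (gam_pow k z) = (sgn (of_int k + 1 - y) - sgn (of_int k - y)) / 2" for k
  proof -
    have "T / 2 + of_int k * T - s = T * (of_int k + 1 - y)" "- (T / 2) + of_int k * T - s = T * (of_int k - y)"
      using T_pos by (simp_all add: y_def field_simps)
    then show ?thesis unfolding wt_def boost_gam_pow sg using T_pos by (simp add: sgn_mult)
  qed
  show "((\<lambda>k. wt (gam_pow k z)) has_sum 1) UNIV" unfolding w by (rule has_sum_sgn_telescope)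
  show "wt z \<ge> 0" unfolding wt_def sg using T_pos by (auto simp: sgn_if)
qed

text \<open>Unfolding without orbit representatives: 1 is expanded as the sum of
  \<open>wt (gam_pow k z)\<close> over k, and replacing z by \<open>gam_pow (- k) z\<close> makes
  the weight independent of k. What depends on k is then the integration window, and these windows
  tile the line. At the zero vector the weights sum to 0 instead of 1, which \<open>C0\<close> makes
  harmless.\<close>

lemma lift_unfold:
  assumes C: "periodic2 P R C" and inv: "\<And>z. C (gam z) = C z" and C0: "C (0, 0) = 0" and v: "Im \<tau> > 0"
  shows "((\<lambda>z. of_real (wt z) * C z * (LINT t|lborel. kn \<tau> t z)) has_sum
      (\<Sum>\<^sub>\<infinity>z. C z * (LINT t:{-(T/2)..T/2}|lborel. kn \<tau> t z))) UNIV"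
proof -
  define H where "H = (\<lambda>z. LINT t:{-(T/2)..T/2}|lborel. kn \<tau> t z)"
  define \<psi> where "\<psi> = (\<lambda>(z, k). of_real (wt (gam_pow k z)) * (C z * H z))"
  have sH: "(\<lambda>z. norm (C z * H z)) summable_on UNIV"
    unfolding H_def by (rule lift_infsum(1)[OF C v])
  have wnn: "C z = 0 \<or> wt (gam_pow k z) \<ge> 0" for z k
    using has_sum_wt(2)[of "gam_pow k z"] C0 gam_pow_zero[of k z] by auto
  have row: "((\<lambda>k. \<psi> (z, k)) has_sum (C z * H z)) UNIV" for z
  proof (cases "z = (0, 0)")
    case False
    have "((\<lambda>k. complex_of_real (wt (gam_pow k z))) has_sum of_real 1) UNIV"
      by (rule has_sum_of_real[OF has_sum_wt(1)[OF False]])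
    from has_sum_cmult_left[OF this, of "C z * H z"] show ?thesis by (simp add: \<psi>_def)
  qed (simp add: \<psi>_def C0)
  have rown: "((\<lambda>k. norm (\<psi> (z, k))) has_sum norm (C z * H z)) UNIV" for z
  proof (cases "z = (0, 0)")
    case False
    have "norm (\<psi> (z, k)) = wt (gam_pow k z) * norm (C z * H z)" for k
      using wnn[of z k] by (auto simp: \<psi>_def norm_mult)
    then show ?thesis using has_sum_cmult_left[OF has_sum_wt(1)[OF False], of "norm (C z * H z)"] by simp
  qed (simp add: \<psi>_def C0)
  have abs: "(\<lambda>x. norm (\<psi> x)) summable_on UNIV \<times> UNIV"
  proof (rule Infinite_Sum.abs_summable_on_Sigma_iff[THEN iffD2], intro conjI ballI)
    show "(\<lambda>k. norm (\<psi> (z, k))) summable_on UNIV" for z using rown has_sum_imp_summable by blast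
    show "(\<lambda>z. norm (\<Sum>\<^sub>\<infinity>k. norm (\<psi> (z, k)))) summable_on UNIV"
      using sH by (simp add: infsumI[OF rown])
  qed
  define \<phi> where "\<phi> = (\<lambda>(z, k). (gam_pow (- k) z, k))"
  have bij: "bij_betw \<phi> (UNIV \<times> UNIV) (UNIV \<times> UNIV)"
    unfolding bij_betw_def inj_on_def \<phi>_def
  proof (intro conjI ballI impI)
    show "x = y" if "(case x of (z, k) \<Rightarrow> (gam_pow (- k) z, k)) = (case y of (z, k) \<Rightarrow> (gam_pow (- k) z, k))" for x y :: "(int \<times> int) \<times> int"
      using that by (cases x; cases y) (auto simp: inj_eq[OF bij_is_inj[OF bij_gam_pow]])
    show "(\<lambda>(z, k). (gam_pow (- k) z, k)) ` (UNIV \<times> UNIV) = UNIV \<times> UNIV"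
    proof (intro equalityI subsetI)
      fix x :: "(int \<times> int) \<times> int"
      obtain z where "fst x = gam_pow (- snd x) z" using bij_is_surj[OF bij_gam_pow] by (meson surjE)
      then show "x \<in> (\<lambda>(z, k). (gam_pow (- k) z, k)) ` (UNIV \<times> UNIV)"
        by (intro image_eqI[of _ _ "(z, snd x)"]) (auto simp: prod_eq_iff)
    qed auto
  qed
  have gg: "X1 t (gam_pow k (gam_pow (- k) z)) = X1 t z" "X2 t (gam_pow k (gam_pow (- k) z)) = X2 t z" for t k z
    unfolding boost_gam_pow by simp_all
  have wt_gg: "wt (gam_pow k (gam_pow (- k) z)) = wt z" for k z unfolding wt_def gg ..
  have H_gam_pow: "H (gam_pow k z) = (LINT t:{-(T/2) + of_int k * T..-(T/2) + (of_int k + 1) * T}|lborel. kn \<tau> t z)" for k z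
  proof -
    have "(LINT t:{-(T/2) + of_int k * T..-(T/2) + (of_int k + 1) * T}|lborel. kn \<tau> t z)
      = (\<integral>t. indicat_real {-(T/2)..T/2} t *\<^sub>R kn \<tau> (t + of_int k * T) z \<partial>lborel)"
      unfolding set_lebesgue_integral_def
      by (subst lborel_integral_real_affine[of 1 _ "of_int k * T"])
         (auto intro!: Bochner_Integration.integral_cong simp: indicator_def algebra_simps)
    then show ?thesis unfolding H_def set_lebesgue_integral_def kern_def boost_gam_pow by simp
  qed
  have \<psi>\<phi>: "\<psi> (\<phi> (z, k)) = of_real (wt z) * C z * H (gam_pow (- k) z)" for z k
    by (simp add: \<psi>_def \<phi>_def wt_gg invariant_gam_pow[of C, OF inv])
  have abs': "(\<lambda>x. norm (\<psi> (\<phi> x))) summable_on UNIV \<times> UNIV"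
    using summable_on_reindex_bij_betw[OF bij, of "\<lambda>x. norm (\<psi> x)"] abs by simp
  have col: "((\<lambda>k. \<psi> (\<phi> (z, k))) has_sum (of_real (wt z) * C z * (LINT t|lborel. kn \<tau> t z))) UNIV" for z
  proof (cases "z = (0, 0)")
    case False
    note tiles = has_sum_integral_tiles[OF integrable_kn[OF False v] T_pos, of "-(T/2)"]
    have "((\<lambda>k. H (gam_pow k z)) has_sum (LINT t|lborel. kn \<tau> t z)) UNIV"
      unfolding H_gam_pow using has_sum_infsum[OF abs_summable_summable[OF tiles(1)]] unfolding tiles(2) .
    then have "((\<lambda>k. H (gam_pow (- k) z)) has_sum (LINT t|lborel. kn \<tau> t z)) UNIV"
      by (subst has_sum_reindex_bij_witness[of _ uminus uminus _ "\<lambda>k. H (gam_pow k z)" _ "LINT t|lborel. kn \<tau> t z"]) auto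
    then show ?thesis unfolding \<psi>\<phi> by (rule has_sum_cmult_right)
  qed (simp add: \<psi>\<phi> C0)
  have "(\<psi> has_sum (\<Sum>\<^sub>\<infinity>x. \<psi> x)) (UNIV \<times> UNIV)"
    using has_sum_infsum[OF abs_summable_summable[OF abs]] by simp
  then have tot: "((\<lambda>x. \<psi> (\<phi> x)) has_sum (\<Sum>\<^sub>\<infinity>x. \<psi> x)) (UNIV \<times> UNIV)"
    using has_sum_reindex_bij_betw[OF bij, of \<psi>] by simp
  have "(\<Sum>\<^sub>\<infinity>x. \<psi> x) = (\<Sum>\<^sub>\<infinity>z. C z * H z)"
    using infsum_Sigma'_banach[of "\<lambda>z k. \<psi> (z, k)" UNIV "\<lambda>_. UNIV"] abs_summable_summable[OF abs] infsumI[OF row] by simp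
  moreover have "((\<lambda>z. of_real (wt z) * C z * (LINT t|lborel. kn \<tau> t z)) has_sum (\<Sum>\<^sub>\<infinity>x. \<psi> x)) UNIV"
    by (rule has_sum_SigmaD[OF tot]) (rule col)
  ultimately show ?thesis by (simp only: H_def)
qed

end

section \<open>Fourier coefficients and the cone\<close>

lemma has_sum_by_value:
  fixes f :: "'a \<Rightarrow> 'c :: {banach}" and j :: "'a \<Rightarrow> 'b"
  assumes "(f has_sum S) {z. Q (j z)}"
  shows "((\<lambda>n. infsum f {z. j z = n}) has_sum S) {n. Q n}"
proof (rule has_sum_SigmaD)
  have bij: "bij_betw snd (SIGMA n:{n. Q n}. {z. j z = n}) {z. Q (j z)}"
    by (rule bij_betw_byWitness[where f'="\<lambda>z. (j z, z)"]) auto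
  show "((\<lambda>x. f (snd x)) has_sum S) (SIGMA n:{n. Q n}. {z. j z = n})"
    using has_sum_reindex_bij_betw[OF bij, of f S] assms by simp
  fix n assume "n \<in> {n. Q n}"
  then have "f summable_on {z. j z = n}"
    using has_sum_imp_summable[OF assms] by (rule_tac summable_on_subset_banach) auto
  then show "((\<lambda>z. f (snd (n, z))) has_sum infsum f {z. j z = n}) {z. j z = n}" by simp
qed

context hyperbolic_lattice
begin

text \<open>The denominator for which half of \<open>qnorm z\<close> is the integer
  \<open>nform z\<close> over \<open>N\<close>, so that the expansion runs over integers.\<close>

definition N where "N = 2 * (M + 1) * (M - 1) * K\<^sup>2"
definition nform :: "int \<times> int \<Rightarrow> int" where "nform z = int (M - 1) * (fst z)\<^sup>2 - int (M + 1) * (snd z)\<^sup>2"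
definition coef :: "(int \<times> int \<Rightarrow> complex) \<Rightarrow> int \<Rightarrow> complex" where
  "coef C n = (\<Sum>\<^sub>\<infinity>z\<in>{z. nform z = n}. of_real (wt z) * C z)"
text \<open>The cone has two descriptions: under \<open>emb\<close> its points satisfy
  \<open>\<bar>x $ 2\<bar> < \<bar>x $ 1\<bar>\<close>, which are the two sectors of Zwegers' sum;
  and it consists of the positive vectors whose minimising boost lies strictly inside the
  period.\<close>

definition cone :: "(int \<times> int) set" where
  "cone = {z. int (M + 1) * \<bar>snd z\<bar> < int (M - 1) * \<bar>fst z\<bar>}"

lemma N_pos: "N > 0" using M K by (simp add: N_def)

lemma M1: "real (M - 1) = real M - 1" "int (M - 1) = int M - 1" "real (M - Suc 0) = real M - 1" "int (M - Suc 0) = int M - 1"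
  using M by auto

lemma qnorm_nform: "qnorm z / 2 = of_int (nform z) / N"
proof -
  have "real N = 2 * ((real M + 1) * (real M - 1) * (real K)\<^sup>2)"
    by (simp only: N_def of_nat_mult of_nat_add of_nat_power M1 of_nat_1 of_nat_numeral mult.assoc)
  then show ?thesis unfolding qnorm_eq nform_def by simp
qed

lemma nform_zero_iff: "nform z = 0 \<longleftrightarrow> z = (0, 0)"
proof
  assume "nform z = 0"
  then have "qnorm z = 0" using qnorm_nform[of z] by simp
  then show "z = (0, 0)" using qnorm_nonzero by blast
qed (simp add: nform_def)

lemma lift_fourier:
  assumes C: "periodic2 P R C" and inv: "\<And>z. C (gam z) = C z" and C0: "C (0, 0) = 0"
  shows "cuspidal_fourier_expansion (lift C) N (coef C)"
  unfolding cuspidal_fourier_expansion_def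
proof (intro conjI ballI)
  show "N > 0" by (rule N_pos)
  fix \<tau> assume "\<tau> \<in> upper_half_plane"
  then have v: "Im \<tau> > 0" by (simp add: upper_half_plane_def)
  define e where "e = (\<lambda>n::int. of_real (bessel_K0 (2 * pi * \<bar>of_int n\<bar> * Im \<tau> / N)) * ee (of_real (of_int n * Re \<tau> / N)))"
  have int: "(LINT t|lborel. kn \<tau> t z) = e (nform z)" if "z \<noteq> (0, 0)" for z
  proof -
    have "qnorm z = 2 * of_int (nform z) / N" using qnorm_nform[of z] by simp
    then have "pi * Im \<tau> * \<bar>qnorm z\<bar> = 2 * pi * \<bar>of_int (nform z)\<bar> * Im \<tau> / N" "Re \<tau> * qnorm z / 2 = of_int (nform z) * Re \<tau> / N"
      by (simp_all add: abs_mult)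
    then show ?thesis unfolding integral_kn[OF that v] e_def ex_def by simp
  qed
  define S where "S = (\<Sum>\<^sub>\<infinity>z. C z * (LINT t:{-(T/2)..T/2}|lborel. kn \<tau> t z))"
  have "((\<lambda>z. of_real (wt z) * C z * (LINT t|lborel. kn \<tau> t z)) has_sum S) UNIV"
    unfolding S_def by (rule lift_unfold[OF C inv C0 v])
  also have "?this \<longleftrightarrow> ((\<lambda>z. of_real (wt z) * C z * e (nform z)) has_sum S) {z. nform z \<noteq> 0}"
    by (rule has_sum_cong_neutral) (auto simp: nform_zero_iff int C0)
  finally have "((\<lambda>n. \<Sum>\<^sub>\<infinity>z\<in>{z. nform z = n}. of_real (wt z) * C z * e (nform z)) has_sum S) {n. n \<noteq> 0}"
    by (rule has_sum_by_value)
  moreover have "(\<Sum>\<^sub>\<infinity>z\<in>{z. nform z = n}. of_real (wt z) * C z * e (nform z)) = coef C n * e n" for n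
    unfolding coef_def infsum_cmult_left'[symmetric] by (rule infsum_cong) simp
  ultimately have "((\<lambda>n. of_real (sqrt (Im \<tau>)) * (coef C n * e n)) has_sum (of_real (sqrt (Im \<tau>)) * S)) {n. n \<noteq> 0}"
    by (intro has_sum_cmult_right) simp
  then show "((\<lambda>n. of_real (sqrt (Im \<tau>)) * (coef C n * of_real (bessel_K0 (2 * pi * \<bar>real_of_int n\<bar> * Im \<tau> / real N)) *
        ee (of_real (real_of_int n * Re \<tau> / real N)))) has_sum lift C \<tau>) {n. n \<noteq> 0}"
    unfolding lift_infsum(2)[OF C v] S_def[symmetric] e_def by (simp add: mult.assoc)
qed

text \<open>On the cone (M + 1)^2 n^2 < (M - 1)^2 m^2, so (M + 1) \<open>nform\<close> exceeds 2 (M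
  - 1) m^2, and n^2 < m^2. The indefinite form thus dominates a definite one there, which is what
  makes the cone sum converge absolutely.\<close>

lemma cone_nform:
  assumes "z \<in> cone"
  shows "real_of_int (nform z) \<ge> (real M - 1) / (real M + 1) * ((of_int (fst z))\<^sup>2 + (of_int (snd z))\<^sup>2)" "nform z > 0"
proof -
  define m n where "m = real_of_int (fst z)" and "n = real_of_int (snd z)"
  have "real_of_int (int (M + 1) * \<bar>snd z\<bar>) < real_of_int (int (M - 1) * \<bar>fst z\<bar>)"
    using assms unfolding cone_def mem_Collect_eq of_int_less_iff .
  then have lt: "(real M + 1) * \<bar>n\<bar> < (real M - 1) * \<bar>m\<bar>" by (simp add: m_def n_def M1 add.commute)
  have m0: "m \<noteq> 0"
  proof
    assume "m = 0"
    with lt have "(real M + 1) * \<bar>n\<bar> < 0" by simp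
    moreover have "(real M + 1) * \<bar>n\<bar> \<ge> 0" by simp
    ultimately show False by linarith
  qed
  have "((real M + 1) * \<bar>n\<bar>)\<^sup>2 < ((real M - 1) * \<bar>m\<bar>)\<^sup>2"
    by (rule power_strict_mono[OF lt]) auto
  then have sq: "(real M + 1)\<^sup>2 * n\<^sup>2 < (real M - 1)\<^sup>2 * m\<^sup>2" by (simp add: power_mult_distrib)
  also have "(real M - 1)\<^sup>2 * m\<^sup>2 \<le> (real M + 1)\<^sup>2 * m\<^sup>2" using M by (intro mult_right_mono power_mono) auto
  finally have nm: "n\<^sup>2 < m\<^sup>2" using M by simp
  have "(real M + 1) * real_of_int (nform z) = (real M + 1) * (real M - 1) * m\<^sup>2 - (real M + 1)\<^sup>2 * n\<^sup>2"
    by (simp add: nform_def m_def n_def M1 power2_eq_square algebra_simps)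
  also have "\<dots> > (real M + 1) * (real M - 1) * m\<^sup>2 - (real M - 1)\<^sup>2 * m\<^sup>2" using sq by simp
  also have "(real M + 1) * (real M - 1) * m\<^sup>2 - (real M - 1)\<^sup>2 * m\<^sup>2 = (real M - 1) * (2 * m\<^sup>2)"
    by (simp add: power2_eq_square algebra_simps)
  finally have 1: "(real M + 1) * real_of_int (nform z) > (real M - 1) * (2 * m\<^sup>2)" .
  have "(real M - 1) * (m\<^sup>2 + n\<^sup>2) \<le> (real M - 1) * (2 * m\<^sup>2)" using nm M by (intro mult_left_mono) auto
  with 1 have 2: "(real M - 1) * (m\<^sup>2 + n\<^sup>2) < (real M + 1) * real_of_int (nform z)" by linarith
  then show "real_of_int (nform z) \<ge> (real M - 1) / (real M + 1) * ((of_int (fst z))\<^sup>2 + (of_int (snd z))\<^sup>2)"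
    unfolding m_def[symmetric] n_def[symmetric] by (simp add: field_simps)
  have "(real M - 1) * (2 * m\<^sup>2) > 0" using m0 M by simp
  with 1 have "(real M + 1) * real_of_int (nform z) > 0" by linarith
  then show "nform z > 0" by (simp add: zero_less_mult_iff)
qed

lemma summable_cone:
  assumes B: "\<And>z. cmod (c z) \<le> B" and v: "Im \<tau> > 0"
  shows "(\<lambda>z. norm (c z * ee (of_int (nform z) * \<tau> / of_nat N))) summable_on cone"
proof -
  define e where "e = 2 * pi * Im \<tau> / N * ((real M - 1) / (real M + 1))"
  have e: "e > 0" using v N_pos M by (simp add: e_def)
  have "(\<lambda>(m::int, n::int). exp (- e * (of_int m + 0)\<^sup>2) * exp (- e * (of_int n + 0)\<^sup>2)) summable_on UNIV"
    using e by (intro summable_on_pair_prod summable_on_gaussian_int_shift) auto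
  then have "(\<lambda>z::int \<times> int. B * exp (- e * ((of_int (fst z))\<^sup>2 + (of_int (snd z))\<^sup>2))) summable_on UNIV"
    by (intro summable_on_cmult_right) (simp add: case_prod_unfold exp_add[symmetric] algebra_simps)
  then have "(\<lambda>z::int \<times> int. B * exp (- e * ((of_int (fst z))\<^sup>2 + (of_int (snd z))\<^sup>2))) summable_on cone"
    by (rule summable_on_subset_banach) simp
  then show ?thesis
  proof (rule summable_on_comparison_test)
    fix z assume z: "z \<in> cone"
    have "e * ((of_int (fst z))\<^sup>2 + (of_int (snd z))\<^sup>2) = 2 * pi * Im \<tau> / N * ((real M - 1) / (real M + 1) * ((of_int (fst z))\<^sup>2 + (of_int (snd z))\<^sup>2))"
      by (simp add: e_def)
    also have "\<dots> \<le> 2 * pi * Im \<tau> / N * of_int (nform z)"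
      using v by (intro mult_left_mono[OF cone_nform(1)[OF z]]) auto
    finally have le: "e * ((of_int (fst z))\<^sup>2 + (of_int (snd z))\<^sup>2) \<le> 2 * pi * Im \<tau> / N * of_int (nform z)" .
    have "norm (ee (of_int (nform z) * \<tau> / of_nat N)) = exp (- (2 * pi * Im \<tau> / N * of_int (nform z)))"
      by (simp add: ee_def Re_divide_of_nat Im_divide_of_nat)
    also have "\<dots> \<le> exp (- e * ((of_int (fst z))\<^sup>2 + (of_int (snd z))\<^sup>2))" using le by simp
    finally have "norm (c z) * norm (ee (of_int (nform z) * \<tau> / of_nat N)) \<le> B * exp (- e * ((of_int (fst z))\<^sup>2 + (of_int (snd z))\<^sup>2))"
      using B[of z] order_trans[OF norm_ge_zero B[of z]] by (intro mult_mono) auto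
    then show "norm (c z * ee (of_int (nform z) * \<tau> / of_nat N)) \<le> B * exp (- e * ((of_int (fst z))\<^sup>2 + (of_int (snd z))\<^sup>2))"
      by (simp add: norm_mult)
  qed auto
qed

lemma cosh_half_T: "cosh (T / 2) = sqrt (real M + 1) / sqrt 2" and sinh_half_T: "sinh (T / 2) = sqrt (real M - 1) / sqrt 2"
proof -
  have d: "real M = (cosh (T / 2))\<^sup>2 + (sinh (T / 2))\<^sup>2" using cosh_double[of "T / 2"] cosh_T by simp
  have e: "(cosh (T / 2))\<^sup>2 = (sinh (T / 2))\<^sup>2 + 1" by (rule cosh_square_eq)
  have "(cosh (T / 2))\<^sup>2 = (sqrt (real M + 1) / sqrt 2)\<^sup>2" "(sinh (T / 2))\<^sup>2 = (sqrt (real M - 1) / sqrt 2)\<^sup>2"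
    using d e M by (simp_all add: power_divide)
  then show "cosh (T / 2) = sqrt (real M + 1) / sqrt 2" "sinh (T / 2) = sqrt (real M - 1) / sqrt 2"
    using T_pos M by (auto simp: power2_eq_iff_nonneg)
qed

text \<open>For a positive vector X1 keeps the sign of the first coordinate for all t, so only X2
  matters. By the half-argument values of cosh and sinh, X2 at T / 2 and - T / 2 is a positive
  multiple of (M - 1) m + (M + 1) n and of its counterpart - ((M - 1) m - (M + 1) n).\<close>

lemma wt_positive:
  assumes j: "nform z > 0"
  shows "wt z = of_int (sgn (fst z)) * (of_int (sgn (int (M - 1) * fst z + int (M + 1) * snd z)) + of_int (sgn (int (M - 1) * fst z - int (M + 1) * snd z))) / 2"
proof -
  define a b where "a = sqrt (real M + 1)" and "b = sqrt (real M - 1)"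
  have ab: "a > 0" "b > 0" "a\<^sup>2 = real M + 1" "b\<^sup>2 = real M - 1" using M by (auto simp: a_def b_def)
  define m n where "m = real_of_int (fst z)" and "n = real_of_int (snd z)"
  have k0: "real K > 0" using K by simp
  have X2: "X2 (T/2) z = (b\<^sup>2 * m + a\<^sup>2 * n) / (a * b * K * sqrt 2)" "X2 (-(T/2)) z = - (b\<^sup>2 * m - a\<^sup>2 * n) / (a * b * K * sqrt 2)"
    unfolding boost2_def sqrt_PR cosh_minus sinh_minus cosh_half_T sinh_half_T a_def[symmetric] b_def[symmetric] m_def[symmetric] n_def[symmetric]
    using ab(1,2) k0 by (simp_all add: field_simps power2_eq_square)
  have "qnorm z = 2 * of_int (nform z) / N" using qnorm_nform[of z] by simp
  then have q: "qnorm z > 0" using j N_pos by simp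
  have X1: "sgn (X1 t z) = sgn m" for t
  proof -
    define x y where "x = m / sqrt P" and "y = n / sqrt R"
    have "x\<^sup>2 - y\<^sup>2 > 0" using q PR unfolding qnorm_def x_def y_def m_def n_def by (simp add: power_divide)
    then have xy: "\<bar>y\<bar> < \<bar>x\<bar>" using abs_le_square_iff[of x y] by linarith
    have "\<bar>sinh t\<bar> < cosh t"
    proof -
      have "\<bar>sinh t\<bar>\<^sup>2 < (cosh t)\<^sup>2" by (simp add: cosh_square_eq)
      then show ?thesis by (rule power2_less_imp_less) simp
    qed
    then have "\<bar>y * sinh t\<bar> < \<bar>x\<bar> * cosh t"
      unfolding abs_mult using xy by (intro mult_strict_mono') auto
    moreover have "X1 t z = x * cosh t + y * sinh t" by (simp add: boost1_def x_def y_def m_def n_def)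
    moreover have "\<bar>x\<bar> * cosh t = \<bar>x * cosh t\<bar>" by (simp add: abs_mult)
    ultimately have "sgn (X1 t z) = sgn (x * cosh t)" by (auto simp: sgn_if)
    also have "\<dots> = sgn m" using PR by (simp add: sgn_mult x_def sgn_divide)
    finally show ?thesis .
  qed
  have D: "a * b * K * sqrt 2 > 0" using ab k0 by simp
  have s2: "sgn (X2 (T/2) z) = sgn (b\<^sup>2 * m + a\<^sup>2 * n)" "sgn (X2 (-(T/2)) z) = - sgn (b\<^sup>2 * m - a\<^sup>2 * n)"
    unfolding X2 sgn_divide using D by (simp_all add: sgn_minus[symmetric])
  have i: "b\<^sup>2 * m + a\<^sup>2 * n = of_int (int (M - 1) * fst z + int (M + 1) * snd z)" "b\<^sup>2 * m - a\<^sup>2 * n = of_int (int (M - 1) * fst z - int (M + 1) * snd z)"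
    using M by (simp_all add: ab m_def n_def M1)
  have so: "sgn (real_of_int x) = of_int (sgn x)" for x by (simp add: sgn_if)
  have "wt z = sgn m * (sgn (b\<^sup>2 * m + a\<^sup>2 * n) + sgn (b\<^sup>2 * m - a\<^sup>2 * n)) / 2"
    by (simp add: wt_def sgn_mult X1 s2 distrib_left)
  then show ?thesis unfolding i unfolding m_def so .
qed

lemma wt_cone:
  assumes "z \<in> cone"
  shows "wt z = 1"
proof -
  define x y where "x = int (M - 1) * fst z" and "y = int (M + 1) * snd z"
  have "\<bar>y\<bar> < \<bar>x\<bar>" using assms by (simp add: cone_def x_def y_def abs_mult)
  then have "x \<noteq> 0" "sgn (x + y) = sgn x" "sgn (x - y) = sgn x" by (auto simp: sgn_if)
  moreover have "sgn x = sgn (fst z)" using M by (simp add: x_def sgn_mult)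
  ultimately show ?thesis
    unfolding wt_positive[OF cone_nform(2)[OF assms]] x_def[symmetric] y_def[symmetric]
    by (cases "fst z" "0::int" rule: linorder_cases) (simp_all add: x_def)
qed

lemma wt_outside_cone:
  assumes "nform z > 0" "z \<notin> cone" "int (M + 1) * \<bar>snd z\<bar> \<noteq> int (M - 1) * \<bar>fst z\<bar>"
  shows "wt z = 0"
proof -
  define x y where "x = int (M - 1) * fst z" and "y = int (M + 1) * snd z"
  have "\<bar>x\<bar> < \<bar>y\<bar>" using assms by (simp add: cone_def x_def y_def abs_mult)
  then have "sgn (x + y) + sgn (x - y) = 0" by (auto simp: sgn_if)
  then have "real_of_int (sgn (x + y)) + of_int (sgn (x - y)) = 0" by (simp flip: of_int_add)
  then show ?thesis
    unfolding wt_positive[OF assms(1)] x_def[symmetric] y_def[symmetric] by simp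
qed

text \<open>Among positive vectors \<open>wt\<close> is 1 on the cone and 0 off its closure; on the
  boundary, where it is 1/2, the function \<open>C\<close> vanishes. So the weighted sum over
  positive vectors is the plain sum over the cone.\<close>

lemma plus_part:
  assumes C: "periodic2 P R C" and bdry: "\<And>z. int (M + 1) * \<bar>snd z\<bar> = int (M - 1) * \<bar>fst z\<bar> \<Longrightarrow> C z = 0"
    and S: "((\<lambda>z. C z * ee (of_int (nform z) * \<tau> / of_nat N)) has_sum S) cone"
  shows "((\<lambda>n. coef C n * ee (of_int n * \<tau> / of_nat N)) has_sum S) {n. n > 0}"
proof -
  have "((\<lambda>z. of_real (wt z) * C z * ee (of_int (nform z) * \<tau> / of_nat N)) has_sum S) {z. nform z > 0}
     \<longleftrightarrow> ((\<lambda>z. C z * ee (of_int (nform z) * \<tau> / of_nat N)) has_sum S) cone"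
  proof (rule has_sum_cong_neutral)
    fix z assume "z \<in> {z. nform z > 0} - cone"
    then show "of_real (wt z) * C z * ee (of_int (nform z) * \<tau> / of_nat N) = 0"
      using wt_outside_cone[of z] bdry[of z] by auto
  next
    fix z assume "z \<in> cone - {z. nform z > 0}"
    then show "C z * ee (of_int (nform z) * \<tau> / of_nat N) = 0" using cone_nform(2)[of z] by simp
  qed (simp add: wt_cone)
  then have "((\<lambda>n. \<Sum>\<^sub>\<infinity>z\<in>{z. nform z = n}. of_real (wt z) * C z * ee (of_int (nform z) * \<tau> / of_nat N)) has_sum S) {n. n > 0}"
    using has_sum_by_value[where S=S and j=nform and Q="\<lambda>n. n > 0"] S by blast
  moreover have "(\<Sum>\<^sub>\<infinity>z\<in>{z. nform z = n}. of_real (wt z) * C z * ee (of_int (nform z) * \<tau> / of_nat N)) = coef C n * ee (of_int n * \<tau> / of_nat N)" for n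
    unfolding coef_def infsum_cmult_left'[symmetric] by (rule infsum_cong) simp
  ultimately show ?thesis by simp
qed

end

section \<open>Zwegers' sum as a sum over a cone\<close>

unbundle no Formal_Power_Series.fps_syntax

lemma vec2_eq_iff: "x = y \<longleftrightarrow> x $ 1 = y $ 1 \<and> x $ 2 = (y :: 'a ^ 2) $ 2"
  by (simp add: vec_eq_iff forall_2)

lemma B_form_eq: "B_form M r \<mu> = (of_nat M + 1) * r $ 1 * \<mu> $ 1 - (of_nat M - 1) * r $ 2 * \<mu> $ 2"
  by (simp add: B_form_def A_mat_def matrix_vector_mult_def sum_2 algebra_simps)

lemma integral_vec_iff: "integral_vec x \<longleftrightarrow> x $ 1 \<in> \<int> \<and> x $ 2 \<in> \<int>"
  by (simp add: integral_vec_def forall_2)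

lemma gamma_mat_mult: "(gamma_mat M *v x) $ 1 = of_nat M * x $ 1 + (of_nat M - 1) * x $ 2"
  "(gamma_mat M *v x) $ 2 = (of_nat M + 1) * x $ 1 + of_nat M * x $ 2"
  by (simp_all add: gamma_mat_def matrix_vector_mult_def sum_2)

lemma star_vec_nth [simp]: "star_vec x $ 1 = - x $ 1" "star_vec x $ 2 = x $ 2"
  by (simp_all add: star_vec_def)

lemma ee_of_rat_cong: "x - y \<in> \<int> \<Longrightarrow> ee (of_rat x) = ee (of_rat y)"
proof -
  assume "x - y \<in> \<int>"
  then obtain n where "x - y = of_int n" by (elim Ints_cases)
  then have "x = y + of_int n" by (simp add: algebra_simps)
  then have "of_rat x = of_rat y + complex_of_real (of_int n)" by (simp add: of_rat_add)
  then show ?thesis using ex_eq_1_iff[of "of_int n"] by (simp add: ee_add ex_def)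
qed

text \<open>The function that Zwegers' sum attaches to \<open>(a, b)\<close>, as a function on \<open>\<rat>\<^sup>2\<close>.\<close>

definition coset_char :: "nat \<Rightarrow> rat ^ 2 \<Rightarrow> rat ^ 2 \<Rightarrow> rat ^ 2 \<Rightarrow> complex" where
  "coset_char M a b x = (if integral_vec (x - a) then ee (of_rat (B_form M x b)) else 0)"

text \<open>\<open>sim\<close> compares \<open>(a, b)\<close> up to a common sign only, so only the even part depends on its class.\<close>

definition even_char :: "nat \<Rightarrow> rat ^ 2 \<Rightarrow> rat ^ 2 \<Rightarrow> rat ^ 2 \<Rightarrow> complex" where
  "even_char M a b x = coset_char M a b x + coset_char M a b (- x)"

text \<open>In the second case of the hypothesis \<open>\<gamma>\<^sub>M\<close> exchanges the two summands.\<close>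

definition sym_char :: "nat \<Rightarrow> rat ^ 2 \<Rightarrow> rat ^ 2 \<Rightarrow> rat ^ 2 \<Rightarrow> complex" where
  "sym_char M a b x = even_char M a b x + even_char M a b (star_vec x)"

text \<open>\<open>gamma_mat M\<close> lies in SL_2(Z), so it permutes integral cosets, and it is an
  isometry of \<open>B_form M\<close>.\<close>

lemma coset_char_gamma:
  "coset_char M (gamma_mat M *v a) (gamma_mat M *v b) (gamma_mat M *v x) = coset_char M a b x"
proof -
  define y where "y = x - a"
  have y: "gamma_mat M *v x - gamma_mat M *v a = gamma_mat M *v y"
    by (simp add: y_def matrix_vector_mult_diff_distrib)
  \<comment> \<open>The inverse matrix is integral as well, the determinant being M^2 - (M^2 - 1) =
    1.\<close>
  have "y $ 1 = of_nat M * (gamma_mat M *v y) $ 1 - (of_nat M - 1) * (gamma_mat M *v y) $ 2"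
    "y $ 2 = of_nat M * (gamma_mat M *v y) $ 2 - (of_nat M + 1) * (gamma_mat M *v y) $ 1"
    by (simp_all add: gamma_mat_mult algebra_simps)
  then have "integral_vec (gamma_mat M *v y) \<Longrightarrow> integral_vec y"
    unfolding integral_vec_iff by (simp add: Ints_diff Ints_mult Ints_add)
  moreover have "integral_vec y \<Longrightarrow> integral_vec (gamma_mat M *v y)"
    unfolding integral_vec_iff gamma_mat_mult by simp
  ultimately have "integral_vec (gamma_mat M *v y) \<longleftrightarrow> integral_vec y" by blast
  moreover have "B_form M (gamma_mat M *v x) (gamma_mat M *v b) = B_form M x b"
    by (simp add: B_form_eq gamma_mat_mult algebra_simps)
  ultimately show ?thesis by (simp add: coset_char_def y y_def)
qed

lemma coset_char_star: "coset_char M (star_vec a) (star_vec b) x = coset_char M a b (star_vec x)"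
proof -
  have "integral_vec (x - star_vec a) \<longleftrightarrow> integral_vec (star_vec x - a)"
  proof -
    have "- (x $ 1) - a $ 1 = - (x $ 1 + a $ 1)" by simp
    then show ?thesis unfolding integral_vec_iff by (simp only: star_vec_nth vector_minus_component minus_in_Ints_iff diff_minus_eq_add)
  qed
  then show ?thesis by (simp add: coset_char_def B_form_eq)
qed

lemma integral_vec_add_iff:
  assumes "integral_vec y"
  shows "integral_vec (x + y) \<longleftrightarrow> integral_vec x"
proof -
  have "u + v \<in> \<int> \<longleftrightarrow> u \<in> \<int>" if "v \<in> \<int>" for u v :: rat
    using that Ints_diff[of "u + v" v] by (auto intro: Ints_add)
  then show ?thesis using assms by (simp add: integral_vec_iff)
qed
lemma integral_vec_minus: "integral_vec (- x) \<longleftrightarrow> integral_vec x"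
  by (simp add: integral_vec_iff)

text \<open>On the coset of \<open>a\<close> the two phases differ by B of an integral vector with
  \<open>b + s *s \<beta>\<close>, plus the value at the base point \<open>a\<close>; the first is
  an integer because both vectors are integral, the second by the last clause of \<open>sim\<close>.
  For s = 1 the cosets are opposite, so the argument changes sign, which the even part does not
  see.\<close>

lemma sim_even_char:
  assumes "sim M (a, b) (\<alpha>, \<beta>)"
  shows "even_char M a b = even_char M \<alpha> \<beta>"
proof -
  obtain s where s: "s = 1 \<or> s = -1" and i: "integral_vec (a + s *s \<alpha>)" "integral_vec (b + s *s \<beta>)" "B_form M a (b + s *s \<beta>) \<in> \<int>"
    using assms unfolding sim.simps Let_def by blast
  have key: "coset_char M a b x = coset_char M \<alpha> \<beta> (- (s *s x))" for x
  proof -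
    have ss: "s * s = 1" using s by auto
    have e: "- (s *s x) - \<alpha> = - (s *s ((x - a) + (a + s *s \<alpha>)))"
      using ss by (simp add: vec2_eq_iff algebra_simps flip: mult.assoc)
    have sv: "integral_vec (s *s y) \<longleftrightarrow> integral_vec y" for y
      using s integral_vec_minus[of y] by (auto simp: integral_vec_iff)
    have "integral_vec ((x - a) + (a + s *s \<alpha>)) \<longleftrightarrow> integral_vec (x - a)"
      by (rule integral_vec_add_iff[OF i(1)])
    then have int: "integral_vec (- (s *s x) - \<alpha>) \<longleftrightarrow> integral_vec (x - a)"
      unfolding e integral_vec_minus sv .
    show ?thesis
    proof (cases "integral_vec (x - a)")
      case True
      have "B_form M x b - B_form M (- (s *s x)) \<beta> = B_form M (x - a) (b + s *s \<beta>) + B_form M a (b + s *s \<beta>)"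
        by (simp add: B_form_eq algebra_simps)
      moreover have "B_form M (x - a) (b + s *s \<beta>) \<in> \<int>"
        using True i(2) unfolding B_form_eq integral_vec_iff by (intro Ints_diff Ints_mult Ints_add) auto
      ultimately have "B_form M x b - B_form M (- (s *s x)) \<beta> \<in> \<int>" using i(3) by simp
      from ee_of_rat_cong[OF this] show ?thesis using True int by (simp add: coset_char_def)
    next
      case False
      then show ?thesis using int by (simp add: coset_char_def)
    qed
  qed
  show ?thesis
    using s by (auto simp: even_char_def key fun_eq_iff add.commute)
qed

text \<open>The reflection conjugates \<open>gamma_mat M\<close> to its inverse; this is
  \<open>gs\<close>. Hence if the even part is invariant, so is its reflected copy. Under the second
  alternative the even part is carried to its reflected copy and back.\<close>

lemma sym_char_gamma:
  assumes "sim M (gamma_mat M *v a, gamma_mat M *v b) (a, b) \<or>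
         (sim M (gamma_mat M *v a, gamma_mat M *v b) (star_vec a, star_vec b) \<and>
          sim M (gamma_mat M *v star_vec a, gamma_mat M *v star_vec b) (a, b))"
  shows "sym_char M a b (gamma_mat M *v x) = sym_char M a b x"
proof -
  have gm: "gamma_mat M *v (- x) = - (gamma_mat M *v x)" for x by (simp add: vec2_eq_iff gamma_mat_mult algebra_simps)
  have eg: "even_char M (gamma_mat M *v a) (gamma_mat M *v b) (gamma_mat M *v x) = even_char M a b x" for a b x
    by (simp add: even_char_def coset_char_gamma flip: gm)
  have sm: "star_vec (- x) = - star_vec x" for x by (simp add: vec2_eq_iff)
  have es: "even_char M (star_vec a) (star_vec b) x = even_char M a b (star_vec x)" for x
    by (simp add: even_char_def coset_char_star sm)
  have gs: "gamma_mat M *v (star_vec (gamma_mat M *v x)) = star_vec x"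
    by (simp add: vec2_eq_iff gamma_mat_mult algebra_simps)
  from assms show ?thesis
  proof
    assume "sim M (gamma_mat M *v a, gamma_mat M *v b) (a, b)"
    from sim_even_char[OF this] have E: "even_char M a b (gamma_mat M *v x) = even_char M a b x" for x
      using eg[of a b x] by simp
    show ?thesis unfolding sym_char_def E using E[of "star_vec (gamma_mat M *v x)"] by (simp add: gs)
  next
    assume *: "sim M (gamma_mat M *v a, gamma_mat M *v b) (star_vec a, star_vec b) \<and>
          sim M (gamma_mat M *v star_vec a, gamma_mat M *v star_vec b) (a, b)"
    have 1: "even_char M a b (star_vec (gamma_mat M *v x)) = even_char M a b x"
      using eg[of a b x] sim_even_char[of M "gamma_mat M *v a" "gamma_mat M *v b" "star_vec a" "star_vec b"] * es by simp
    have 2: "even_char M a b (gamma_mat M *v x) = even_char M a b (star_vec x)"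
      using eg[of "star_vec a" "star_vec b" x] sim_even_char[of M "gamma_mat M *v star_vec a" "gamma_mat M *v star_vec b" a b] * es by simp
    show ?thesis by (simp add: sym_char_def 1 2)
  qed
qed

text \<open>Modulo integers, the sum and the difference of the coordinates are constant on the coset
  of \<open>a\<close>, and there they are not integral.\<close>

lemma coset_char_nonzero:
  fixes a b x :: "rat ^ 2"
  assumes "coset_char M a b x \<noteq> 0" "a $ 1 + a $ 2 \<notin> \<int>" "a $ 1 - a $ 2 \<notin> \<int>"
  shows "x $ 1 + x $ 2 \<noteq> 0" "x $ 1 - x $ 2 \<noteq> 0"
proof -
  have i: "x $ 1 - a $ 1 \<in> \<int>" "x $ 2 - a $ 2 \<in> \<int>"
    using assms(1) by (auto simp: coset_char_def integral_vec_iff split: if_splits)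
  show "x $ 1 + x $ 2 \<noteq> 0"
  proof
    assume "x $ 1 + x $ 2 = 0"
    then have "a $ 1 + a $ 2 = - ((x $ 1 - a $ 1) + (x $ 2 - a $ 2))" by simp
    also have "\<dots> \<in> \<int>" by (intro Ints_minus Ints_add i)
    finally show False using assms(2) by contradiction
  qed
  show "x $ 1 - x $ 2 \<noteq> 0"
  proof
    assume "x $ 1 - x $ 2 = 0"
    then have "a $ 1 - a $ 2 = - ((x $ 1 - a $ 1) - (x $ 2 - a $ 2))" by simp
    also have "\<dots> \<in> \<int>" by (intro Ints_minus Ints_diff i)
    finally show False using assms(3) by contradiction
  qed
qed

lemma sym_char_zero:
  fixes a b x :: "rat ^ 2"
  assumes "a $ 1 + a $ 2 \<notin> \<int>" "a $ 1 - a $ 2 \<notin> \<int>" and x: "x $ 1 + x $ 2 = 0 \<or> x $ 1 - x $ 2 = 0"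
  shows "sym_char M a b x = 0"
proof -
  have "coset_char M a b y = 0" if "(y :: rat ^ 2) $ 1 + y $ 2 = 0 \<or> y $ 1 - y $ 2 = 0" for y
    using coset_char_nonzero[OF _ assms(1,2), of M b y] that by blast
  then show ?thesis using x by (auto simp: sym_char_def even_char_def algebra_simps eq_neg_iff_add_eq_0)
qed

lemma norm_coset_char: "norm (coset_char M a b x) \<le> 1"
proof -
  have "norm (ee (of_rat q)) = 1" for q
  proof -
    have "complex_of_real (of_rat q) = of_rat q" by (cases q) (simp add: of_rat_rat)
    then show ?thesis using norm_ex[of "of_rat q"] by (simp add: ex_def)
  qed
  then show ?thesis by (simp add: coset_char_def)
qed

text \<open>\<open>K\<close> clears the denominators of \<open>b\<close>, so translation by
  \<open>K\<close> times an integral vector changes the phase by an integer. In the integer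
  coordinates the translations by \<open>K\<close> along the axes are those by \<open>P\<close> and
  \<open>R\<close>.\<close>

lemma coset_char_periodic:
  fixes a b x y :: "rat ^ 2"
  assumes y: "integral_vec y" and b: "of_nat K * b $ 1 \<in> \<int>" "of_nat K * b $ 2 \<in> \<int>"
  shows "coset_char M a b (x + of_nat K *s y) = coset_char M a b x"
proof -
  have iy: "integral_vec (of_nat K *s y)" using y by (simp add: integral_vec_iff)
  have "integral_vec (x + of_nat K *s y - a) \<longleftrightarrow> integral_vec (x - a)"
    using integral_vec_add_iff[OF iy, of "x - a"] by (simp add: add_diff_eq diff_add_eq)
  moreover have "B_form M (x + of_nat K *s y) b - B_form M x b = (of_nat M + 1) * y $ 1 * (of_nat K * b $ 1) - (of_nat M - 1) * y $ 2 * (of_nat K * b $ 2)"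
    by (simp add: B_form_eq algebra_simps)
  moreover have "\<dots> \<in> \<int>"
    using y b unfolding integral_vec_iff by (intro Ints_diff; intro Ints_mult[OF Ints_mult]) simp_all
  ultimately show ?thesis
    using ee_of_rat_cong[of "B_form M (x + of_nat K *s y) b" "B_form M x b"] by (simp add: coset_char_def)
qed

lemma sym_char_periodic:
  fixes a b x y :: "rat ^ 2"
  assumes y: "integral_vec y" and b: "of_nat K * b $ 1 \<in> \<int>" "of_nat K * b $ 2 \<in> \<int>"
  shows "sym_char M a b (x + of_nat K *s y) = sym_char M a b x"
proof -
  have e: "- (x + of_nat K *s y) = - x + of_nat K *s (- y)" "star_vec (x + of_nat K *s y) = star_vec x + of_nat K *s star_vec y" for x y
    by (simp_all add: vec2_eq_iff)
  have i: "integral_vec (star_vec y)" "integral_vec (- y)" "integral_vec (- star_vec y)"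
    using y by (simp_all add: integral_vec_iff)
  show ?thesis unfolding sym_char_def even_char_def e
    using coset_char_periodic[OF y b] coset_char_periodic[OF i(1) b] coset_char_periodic[OF i(2) b] coset_char_periodic[OF i(3) b] by simp
qed

section \<open>Cone sums in rational coordinates\<close>

context hyperbolic_lattice
begin

definition emb :: "int \<times> int \<Rightarrow> rat ^ 2" where
  "emb z = vector [of_int (fst z) / ((of_nat M + 1) * of_nat K), of_int (snd z) / ((of_nat M - 1) * of_nat K)]"

lemma emb_nth [simp]: "emb z $ 1 = of_int (fst z) / ((of_nat M + 1) * of_nat K)" "emb z $ 2 = of_int (snd z) / ((of_nat M - 1) * of_nat K)"
  by (simp_all add: emb_def)

lemma M1_rat: "of_nat (M - 1) = (of_nat M - 1 :: rat)" "of_nat (M - Suc 0) = (of_nat M - 1 :: rat)"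
  using M by (auto simp: of_nat_diff)

lemma pos_rat: "(of_nat K :: rat) \<noteq> 0" "(of_nat M + 1 :: rat) \<noteq> 0" "(of_nat M - 1 :: rat) \<noteq> 0" "(of_nat M - 1 :: rat) > 0"
proof -
  have "(of_nat M :: rat) \<ge> of_nat 2" using M by (simp only: of_nat_le_iff)
  then show "(of_nat M + 1 :: rat) \<noteq> 0" "(of_nat M - 1 :: rat) \<noteq> 0" "(of_nat M - 1 :: rat) > 0" by linarith+
  show "(of_nat K :: rat) \<noteq> 0" using K by simp
qed

lemma emb_gam: "emb (gam z) = gamma_mat M *v emb z"
proof -
  define a b k where "a = (of_nat M + 1 :: rat)" and "b = (of_nat M - 1 :: rat)" and "k = (of_nat K :: rat)"
  have nz: "a \<noteq> 0" "b \<noteq> 0" "k \<noteq> 0" using pos_rat by (auto simp: a_def b_def k_def)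
  have i: "of_int (int (M + 1)) = a" "of_int (int (M - 1)) = b" by (simp_all add: a_def b_def M1_rat)
  show ?thesis
    unfolding vec2_eq_iff gamma_mat_mult emb_nth gam_def fst_conv snd_conv of_int_add of_int_mult i
    unfolding a_def[symmetric] b_def[symmetric] k_def[symmetric] using nz by (simp add: field_simps)
qed

definition neg_int :: "int \<times> int \<Rightarrow> int \<times> int" where "neg_int z = (- fst z, - snd z)"
definition star_int :: "int \<times> int \<Rightarrow> int \<times> int" where "star_int z = (- fst z, snd z)"

lemma emb_neg_int: "emb (neg_int z) = - emb z" and emb_star_int: "emb (star_int z) = star_vec (emb z)"
  by (simp_all add: vec2_eq_iff neg_int_def star_int_def)

lemma bij_cone: "bij_betw neg_int cone cone" "bij_betw star_int cone cone"
  by (rule bij_betw_byWitness[where f'=neg_int], auto simp: neg_int_def cone_def)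
     (rule bij_betw_byWitness[where f'=star_int], auto simp: star_int_def cone_def)

lemma nform_sym: "nform (neg_int z) = nform z" "nform (star_int z) = nform z"
  by (simp_all add: nform_def neg_int_def star_int_def)

text \<open>Each of the four summands of \<open>sym_char\<close> has the same sum, by reindexing
  along symmetries that preserve both the cone and \<open>nform\<close>; hence the factor 4.\<close>

lemma coset_sum_symmetrize:
  assumes v: "Im \<tau> > 0"
  shows "((\<lambda>z. sym_char M a b (emb z) * ee (of_int (nform z) * \<tau> / of_nat N)) has_sum
    4 * (\<Sum>\<^sub>\<infinity>z\<in>cone. coset_char M a b (emb z) * ee (of_int (nform z) * \<tau> / of_nat N))) cone"
proof -
  define e where "e = (\<lambda>z. ee (of_int (nform z) * \<tau> / of_nat N))"
  define c where "c = (\<lambda>z. coset_char M a b (emb z))"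
  have e: "e (neg_int z) = e z" "e (star_int z) = e z" for z by (simp_all add: e_def nform_sym)
  have s: "(\<lambda>z. norm (c z * e z)) summable_on cone"
    unfolding c_def e_def by (rule summable_cone[OF norm_coset_char v])
  have 0: "((\<lambda>z. c z * e z) has_sum (\<Sum>\<^sub>\<infinity>z\<in>cone. c z * e z)) cone"
    by (rule has_sum_infsum[OF abs_summable_summable[OF s]])
  have 1: "((\<lambda>z. c (neg_int z) * e z) has_sum (\<Sum>\<^sub>\<infinity>z\<in>cone. c z * e z)) cone"
    using has_sum_reindex_bij_betw[OF bij_cone(1), of "\<lambda>z. c z * e z"] 0 by (simp add: e)
  have 2: "((\<lambda>z. c (star_int z) * e z) has_sum (\<Sum>\<^sub>\<infinity>z\<in>cone. c z * e z)) cone"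
    using has_sum_reindex_bij_betw[OF bij_cone(2), of "\<lambda>z. c z * e z"] 0 by (simp add: e)
  have 3: "((\<lambda>z. c (neg_int (star_int z)) * e z) has_sum (\<Sum>\<^sub>\<infinity>z\<in>cone. c z * e z)) cone"
    using has_sum_reindex_bij_betw[OF bij_cone(2), of "\<lambda>z. c (neg_int z) * e z"] 1 by (simp add: e)
  have "((\<lambda>z. c z * e z + c (neg_int z) * e z + (c (star_int z) * e z + c (neg_int (star_int z)) * e z)) has_sum
      ((\<Sum>\<^sub>\<infinity>z\<in>cone. c z * e z) + (\<Sum>\<^sub>\<infinity>z\<in>cone. c z * e z) + ((\<Sum>\<^sub>\<infinity>z\<in>cone. c z * e z) + (\<Sum>\<^sub>\<infinity>z\<in>cone. c z * e z)))) cone"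
    by (intro has_sum_add 0 1 2 3)
  then show ?thesis
    by (simp add: sym_char_def even_char_def c_def e_def emb_neg_int emb_star_int distrib_right)
qed

text \<open>Zwegers' phase pairs \<open>b\<close> with the integral part of a point,
  \<open>coset_char\<close> pairs it with the point itself; the quotient is the constant in front.
  As the sum and difference of the coordinates of \<open>a\<close> are not integral, the floor
  conditions say that x_1 + x_2 and x_1 - x_2 are both positive, or both negative, at the shifted
  point x, that is, \<open>\<bar>x $ 2\<bar> < \<bar>x $ 1\<bar>\<close>.\<close>

lemma S_series_eq:
  fixes a b :: "rat ^ 2"
  assumes v: "Im \<tau> > 0" and a: "a $ 1 + a $ 2 \<notin> \<int>" "a $ 1 - a $ 2 \<notin> \<int>"
    and Ka: "of_nat K * a $ 1 \<in> \<int>" "of_nat K * a $ 2 \<in> \<int>"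
  shows "S_series a b M \<tau> = ee (of_rat (- B_form M a b)) * (\<Sum>\<^sub>\<infinity>z\<in>cone. coset_char M a b (emb z) * ee (of_int (nform z) * \<tau> / of_nat N))"
proof -
  define Dp where "Dp = {(n, \<nu>). n + \<nu> \<ge> - \<lfloor>a $ 1 + a $ 2\<rfloor> \<and> n - \<nu> \<ge> - \<lfloor>a $ 1 - a $ 2\<rfloor>}"
  define Dm where "Dm = {(n, \<nu>). n + \<nu> < - \<lfloor>a $ 1 + a $ 2\<rfloor> \<and> n - \<nu> < - \<lfloor>a $ 1 - a $ 2\<rfloor>}"
  define g where "g = (\<lambda>z. coset_char M a b (emb z) * ee (of_int (nform z) * \<tau> / of_nat N))"
  define k where "k = ee (of_rat (- B_form M a b))"
  obtain p q where pq: "of_nat K * a $ 1 = of_int p" "of_nat K * a $ 2 = of_int q"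
    using Ka by (auto elim!: Ints_cases)
  \<comment> \<open>The integer pair that \<open>emb\<close> maps to the point (n, \<nu>) + a; it is
    integral because \<open>K\<close> clears the denominators of \<open>a\<close>.\<close>
  define \<zeta> where "\<zeta> = (\<lambda>(n, \<nu>). (int (M + 1) * (int K * n + p), int (M - 1) * (int K * \<nu> + q)))"
  define sh where "sh = (\<lambda>(n, \<nu>). vector [of_int n + a $ 1, of_int \<nu> + a $ 2] :: rat ^ 2)"
  have sh: "sh (n, \<nu>) $ 1 = of_int n + a $ 1" "sh (n, \<nu>) $ 2 = of_int \<nu> + a $ 2" for n \<nu>
    by (simp_all add: sh_def)
  have K0: "(of_nat K :: rat) \<noteq> 0" using K by simp
  have emb\<zeta>: "emb (\<zeta> x) = sh x" for x
  proof (cases x)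
    case (Pair n \<nu>)
    have f: "A * (c * x + c * y) / (A * c) = x + y" if "A \<noteq> 0" "c \<noteq> 0" for A c x y :: rat
      using that by (simp add: field_simps)
    have i: "of_int (int (M + 1)) = (of_nat M + 1 :: rat)" "of_int (int (M - 1)) = (of_nat M - 1 :: rat)"
      by (simp_all add: M1_rat)
    have "of_int (int (M + 1) * (int K * n + p)) / ((of_nat M + 1) * of_nat K) = of_int n + a $ 1"
      "of_int (int (M - 1) * (int K * \<nu> + q)) / ((of_nat M - 1) * of_nat K) = of_int \<nu> + a $ 2"
      unfolding of_int_mult of_int_add pq[symmetric] i unfolding of_int_of_nat_eq of_nat_add of_nat_1 M1_rat
      by - (rule f; use pos_rat in simp)+
    then show ?thesis by (simp add: Pair vec2_eq_iff sh \<zeta>_def)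
  qed
  have inj: "inj \<zeta>"
  proof (rule injI)
    fix x y :: "int \<times> int" assume "\<zeta> x = \<zeta> y"
    then have "sh x = sh y" unfolding emb\<zeta>[symmetric] by simp
    then show "x = y" by (cases x; cases y) (simp add: vec2_eq_iff sh)
  qed
  have emb_cone: "z \<in> cone \<longleftrightarrow> \<bar>emb z $ 2\<bar> < \<bar>emb z $ 1\<bar>" for z
  proof -
    have "\<bar>emb z $ 2\<bar> < \<bar>emb z $ 1\<bar> \<longleftrightarrow> \<bar>of_int (snd z)\<bar> / ((of_nat M - 1) * of_nat K) < \<bar>of_int (fst z)\<bar> / ((of_nat M + 1) * (of_nat K :: rat))"
      using pos_rat(4) by (simp add: abs_divide abs_mult)
    also have "\<dots> \<longleftrightarrow> (of_nat M + 1) * \<bar>of_int (snd z)\<bar> < (of_nat M - 1) * \<bar>of_int (fst z) :: rat\<bar>"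
    proof -
      have "y / (b * c) < x / (a * c) \<longleftrightarrow> a * y < b * x" if "a > 0" "b > 0" "c > 0" for x y a b c :: rat
        using that by (simp add: field_simps)
      then show ?thesis using pos_rat(4) K by (simp add: add_pos_nonneg)
    qed
    also have "\<dots> \<longleftrightarrow> of_int (int (M + 1) * \<bar>snd z\<bar>) < (of_int (int (M - 1) * \<bar>fst z\<bar>) :: rat)"
      by (simp add: M1_rat add.commute)
    also have "\<dots> \<longleftrightarrow> z \<in> cone" unfolding of_int_less_iff by (simp add: cone_def)
    finally show ?thesis ..
  qed
  have pos: "n \<ge> - \<lfloor>s\<rfloor> \<longleftrightarrow> of_int n + s > 0" "n < - \<lfloor>s\<rfloor> \<longleftrightarrow> of_int n + s < 0" if "s \<notin> \<int>" for n and s :: rat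
  proof -
    have "s \<noteq> of_int (- n)" using that by auto
    moreover have "n \<ge> - \<lfloor>s\<rfloor> \<longleftrightarrow> of_int (- n) \<le> s" by (simp only: le_floor_iff[symmetric]) linarith
    ultimately show "n \<ge> - \<lfloor>s\<rfloor> \<longleftrightarrow> of_int n + s > 0" "n < - \<lfloor>s\<rfloor> \<longleftrightarrow> of_int n + s < 0" by auto
  qed
  have D: "x \<in> Dp \<union> Dm \<longleftrightarrow> \<zeta> x \<in> cone" for x
  proof (cases x)
    case (Pair n \<nu>)
    have "x \<in> Dp \<longleftrightarrow> sh x $ 1 + sh x $ 2 > 0 \<and> sh x $ 1 - sh x $ 2 > 0"
      using pos(1)[OF a(1), of "n + \<nu>"] pos(1)[OF a(2), of "n - \<nu>"] by (simp add: Dp_def Pair sh algebra_simps)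
    moreover have "x \<in> Dm \<longleftrightarrow> sh x $ 1 + sh x $ 2 < 0 \<and> sh x $ 1 - sh x $ 2 < 0"
      using pos(2)[OF a(1), of "n + \<nu>"] pos(2)[OF a(2), of "n - \<nu>"] by (simp add: Dm_def Pair sh algebra_simps)
    ultimately show ?thesis unfolding emb_cone emb\<zeta> by auto
  qed
  have trm: "S_term a b M \<tau> x = k * g (\<zeta> x)" for x
  proof (cases x)
    case (Pair n \<nu>)
    have int: "integral_vec (sh x - a)" by (simp add: Pair integral_vec_iff sh)
    have "(of_nat M + 1) * b $ 1 * of_int n - (of_nat M - 1) * b $ 2 * of_int \<nu> = - B_form M a b + B_form M (sh x) b"
      by (simp add: B_form_eq Pair sh algebra_simps)
    then have 1: "ee (of_rat ((of_nat M + 1) * b $ 1 * of_int n - (of_nat M - 1) * b $ 2 * of_int \<nu>)) = k * coset_char M a b (sh x)"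
      using int by (simp only: of_rat_add ee_add coset_char_def k_def if_True)
    have "1 / 2 * ((of_nat M + 1) * (of_int n + a $ 1)\<^sup>2 - (of_nat M - 1) * (of_int \<nu> + a $ 2)\<^sup>2) = (of_int (nform (\<zeta> x)) / of_nat N :: rat)"
    proof -
      define A B c where "A = (of_nat M + 1 :: rat)" and "B = (of_nat M - 1 :: rat)" and "c = (of_nat K :: rat)"
      have nz: "A \<noteq> 0" "B \<noteq> 0" "c \<noteq> 0" using pos_rat by (auto simp: A_def B_def c_def)
      have N': "of_nat N = 2 * A * B * c\<^sup>2" by (simp only: N_def of_nat_mult of_nat_add of_nat_power of_nat_1 of_nat_numeral M1_rat A_def B_def c_def)
      have s: "emb (\<zeta> x) $ 1 = of_int (fst (\<zeta> x)) / (A * c)" "emb (\<zeta> x) $ 2 = of_int (snd (\<zeta> x)) / (B * c)"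
        by (simp_all add: A_def B_def c_def)
      have j: "of_int (nform (\<zeta> x)) = B * (of_int (fst (\<zeta> x)))\<^sup>2 - A * (of_int (snd (\<zeta> x)))\<^sup>2"
        by (simp add: nform_def A_def B_def M1_rat add.commute)
      have "1 / 2 * (A * (sh x $ 1)\<^sup>2 - B * (sh x $ 2)\<^sup>2) = of_int (nform (\<zeta> x)) / of_nat N"
        unfolding emb\<zeta>[symmetric] s j N' using nz by (simp add: field_simps power2_eq_square)
      then show ?thesis by (simp add: Pair sh A_def B_def)
    qed
    then have 2: "of_rat (1 / 2 * ((of_nat M + 1) * (of_int n + a $ 1)\<^sup>2 - (of_nat M - 1) * (of_int \<nu> + a $ 2)\<^sup>2)) * \<tau> = of_int (nform (\<zeta> x)) * \<tau> / of_nat N"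
      by (simp only: of_rat_divide of_rat_of_int_eq of_rat_of_nat_eq times_divide_eq_left)
    show ?thesis unfolding Pair S_term_def prod.case 1[unfolded Pair] 2[unfolded Pair] g_def emb\<zeta> by (simp add: mult.assoc)
  qed
  have img: "\<zeta> ` (Dp \<union> Dm) \<subseteq> cone" by (rule image_subsetI) (simp only: D)
  \<comment> \<open>Cone points off the coset of \<open>a\<close> carry the value zero, so the sum
    over the coset may be extended to the full cone.\<close>
  have g0: "g z = 0" if "z \<in> cone - \<zeta> ` (Dp \<union> Dm)" for z
  proof (rule ccontr)
    assume "g z \<noteq> 0"
    then have "integral_vec (emb z - a)" by (auto simp: g_def coset_char_def split: if_splits)
    then obtain n \<nu> where "emb z $ 1 - a $ 1 = of_int n" "emb z $ 2 - a $ 2 = of_int \<nu>"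
      by (auto simp: integral_vec_iff elim!: Ints_cases)
    then have "emb z = emb (\<zeta> (n, \<nu>))" unfolding emb\<zeta> by (simp add: vec2_eq_iff sh algebra_simps)
    then have "z = \<zeta> (n, \<nu>)" using pos_rat by (simp add: vec2_eq_iff prod_eq_iff)
    then show False using that D[of "(n, \<nu>)"] by auto
  qed
  have "(\<lambda>z. norm (g z)) summable_on cone"
    unfolding g_def by (rule summable_cone[OF norm_coset_char v])
  then have gs: "g summable_on cone" by (rule abs_summable_summable)
  have "g summable_on \<zeta> ` (Dp \<union> Dm)" by (rule summable_on_subset_banach[OF gs img])
  then have "(g \<circ> \<zeta>) summable_on (Dp \<union> Dm)"
    by (rule summable_on_reindex[OF inj_on_subset[OF inj subset_UNIV], THEN iffD1])
  then have sm: "S_term a b M \<tau> summable_on (Dp \<union> Dm)"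
    using summable_on_cmult_right[of "g \<circ> \<zeta>" "Dp \<union> Dm" k] by (simp add: trm o_def fun_eq_iff cong: summable_on_cong)
  have disj: "Dp \<inter> Dm = {}" by (auto simp: Dp_def Dm_def)
  have "S_series a b M \<tau> = (\<Sum>\<^sub>\<infinity>x\<in>Dp \<union> Dm. S_term a b M \<tau> x)"
    unfolding S_series_def Dp_def[symmetric] Dm_def[symmetric]
    by (rule infsum_Un_disjoint[symmetric]) (use sm disj summable_on_subset_banach in auto)
  also have "\<dots> = k * (\<Sum>\<^sub>\<infinity>x\<in>Dp \<union> Dm. g (\<zeta> x))"
    unfolding trm by (rule infsum_cmult_right')
  also have "(\<Sum>\<^sub>\<infinity>x\<in>Dp \<union> Dm. g (\<zeta> x)) = (\<Sum>\<^sub>\<infinity>z\<in>\<zeta> ` (Dp \<union> Dm). g z)"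
    using infsum_reindex[OF inj_on_subset[OF inj subset_UNIV], of g "Dp \<union> Dm"] by (simp add: o_def)
  also have "\<dots> = (\<Sum>\<^sub>\<infinity>z\<in>cone. g z)"
    by (rule infsum_cong_neutral) (use img g0 in auto)
  finally show ?thesis by (simp add: k_def g_def)
qed

end

section \<open>Congruence subgroups\<close>

lemma moebius_mob: "moebius g \<tau> = mob (g $ 1 $ 1) (g $ 1 $ 2) (g $ 2 $ 1) (g $ 2 $ 2) \<tau>"
  unfolding moebius_def mob_def ..

lemma SL2Z_carrier: "g \<in> carrier SL2Z \<longleftrightarrow> g $ 1 $ 1 * g $ 2 $ 2 - g $ 1 $ 2 * g $ 2 $ 1 = 1"
  unfolding SL2Z_def monoid.simps partial_object.simps mem_Collect_eq det_2 ..

lemma mat2_mult_nth: "((g :: int ^ 2 ^ 2) ** h) $ i $ j = g $ i $ 1 * h $ 1 $ j + g $ i $ 2 * h $ 2 $ j"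
  unfolding matrix_matrix_mult_def vec_lambda_beta sum_2 ..

lemma mat2_eq_iff: "g = h \<longleftrightarrow> g $ 1 $ 1 = h $ 1 $ 1 \<and> g $ 1 $ 2 = h $ 1 $ 2 \<and> g $ 2 $ 1 = h $ 2 $ 1 \<and> g $ 2 $ 2 = (h :: int ^ 2 ^ 2) $ 2 $ 2"
  unfolding vec2_eq_iff conj_assoc ..

definition adj2 :: "int ^ 2 ^ 2 \<Rightarrow> int ^ 2 ^ 2" where
  "adj2 g = vector [vector [g $ 2 $ 2, - g $ 1 $ 2], vector [- g $ 2 $ 1, g $ 1 $ 1]]"

lemma adj2_nth [simp]: "adj2 g $ 1 $ 1 = g $ 2 $ 2" "adj2 g $ 1 $ 2 = - g $ 1 $ 2" "adj2 g $ 2 $ 1 = - g $ 2 $ 1" "adj2 g $ 2 $ 2 = g $ 1 $ 1"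
  by (simp_all add: adj2_def)

lemma adj2_mult:
  assumes "g $ 1 $ 1 * g $ 2 $ 2 - g $ 1 $ 2 * g $ 2 $ 1 = 1"
  shows "adj2 g ** g = mat 1"
  using assms by (simp add: mat2_eq_iff mat2_mult_nth mat_def algebra_simps)

lemma group_SL2Z: "group SL2Z"
proof (rule groupI)
  show "x \<otimes>\<^bsub>SL2Z\<^esub> y \<in> carrier SL2Z" if "x \<in> carrier SL2Z" "y \<in> carrier SL2Z" for x y
    using that by (simp add: SL2Z_def det_mul)
  show "\<one>\<^bsub>SL2Z\<^esub> \<in> carrier SL2Z" by (simp add: SL2Z_def)
  show "x \<otimes>\<^bsub>SL2Z\<^esub> y \<otimes>\<^bsub>SL2Z\<^esub> z = x \<otimes>\<^bsub>SL2Z\<^esub> (y \<otimes>\<^bsub>SL2Z\<^esub> z)" for x y z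
    by (simp add: SL2Z_def matrix_mul_assoc)
  show "\<one>\<^bsub>SL2Z\<^esub> \<otimes>\<^bsub>SL2Z\<^esub> x = x" for x by (simp add: SL2Z_def)
  fix x assume x: "x \<in> carrier SL2Z"
  then have "adj2 x \<in> carrier SL2Z" by (simp add: SL2Z_carrier algebra_simps)
  moreover have "adj2 x \<otimes>\<^bsub>SL2Z\<^esub> x = \<one>\<^bsub>SL2Z\<^esub>"
    using adj2_mult x unfolding SL2Z_carrier by (simp add: SL2Z_def)
  ultimately show "\<exists>y\<in>carrier SL2Z. y \<otimes>\<^bsub>SL2Z\<^esub> x = \<one>\<^bsub>SL2Z\<^esub>" ..
qed

lemma principal_iff:
  "g \<in> principal_congruence_subgroup n \<longleftrightarrow> g \<in> carrier SL2Z \<and> int n dvd g $ 1 $ 1 - 1 \<and> int n dvd g $ 1 $ 2 \<and> int n dvd g $ 2 $ 1 \<and> int n dvd g $ 2 $ 2 - 1"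
  by (simp add: principal_congruence_subgroup_def forall_2 mat_def conj_ac)

lemma subgroup_principal: "subgroup (principal_congruence_subgroup n) SL2Z"
proof
  show "principal_congruence_subgroup n \<subseteq> carrier SL2Z" by (auto simp: principal_iff)
  show "\<one>\<^bsub>SL2Z\<^esub> \<in> principal_congruence_subgroup n"
    using group.is_monoid[OF group_SL2Z, THEN monoid.one_closed] unfolding principal_iff by (simp add: SL2Z_def mat_def)
  fix x assume x: "x \<in> principal_congruence_subgroup n"
  show "x \<otimes>\<^bsub>SL2Z\<^esub> y \<in> principal_congruence_subgroup n" if y: "y \<in> principal_congruence_subgroup n" for y
  proof -
    have "x \<otimes>\<^bsub>SL2Z\<^esub> y \<in> carrier SL2Z"
      using x y group.is_monoid[OF group_SL2Z, THEN monoid.m_closed] by (simp add: principal_iff)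
    moreover have e: "x \<otimes>\<^bsub>SL2Z\<^esub> y = x ** y" by (simp add: SL2Z_def)
    have eqs: "(x ** y) $ 1 $ 1 - 1 = (x $ 1 $ 1 - 1) * y $ 1 $ 1 + (y $ 1 $ 1 - 1) + x $ 1 $ 2 * y $ 2 $ 1"
      "(x ** y) $ 2 $ 2 - 1 = (x $ 2 $ 2 - 1) * y $ 2 $ 2 + (y $ 2 $ 2 - 1) + x $ 2 $ 1 * y $ 1 $ 2"
      "(x ** y) $ 1 $ 2 = x $ 1 $ 1 * y $ 1 $ 2 + x $ 1 $ 2 * y $ 2 $ 2"
      "(x ** y) $ 2 $ 1 = x $ 2 $ 1 * y $ 1 $ 1 + x $ 2 $ 2 * y $ 2 $ 1"
      by (simp_all add: mat2_mult_nth algebra_simps)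
    ultimately show ?thesis using x y unfolding principal_iff e eqs by (auto intro!: dvd_add dvd_mult dvd_mult2)
  qed
  show "inv\<^bsub>SL2Z\<^esub> x \<in> principal_congruence_subgroup n"
  proof -
    have xc: "x \<in> carrier SL2Z" using x by (simp add: principal_iff)
    then have ac: "adj2 x \<in> carrier SL2Z" by (simp add: SL2Z_carrier algebra_simps)
    have "adj2 x \<otimes>\<^bsub>SL2Z\<^esub> x = \<one>\<^bsub>SL2Z\<^esub>"
      using adj2_mult xc unfolding SL2Z_carrier by (simp add: SL2Z_def)
    then have "inv\<^bsub>SL2Z\<^esub> x = adj2 x" by (rule group.inv_equality[OF group_SL2Z _ xc ac])
    then show ?thesis using x ac by (simp add: principal_iff)
  qed
qed

lemma moebius_mult:
  assumes "h \<in> carrier SL2Z" "\<tau> \<in> upper_half_plane"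
  shows "moebius (g ** h) \<tau> = moebius g (moebius h \<tau>)" "moebius h \<tau> \<in> upper_half_plane"
  using assms mob_mob[of "h $ 1 $ 1" "h $ 2 $ 2" "h $ 1 $ 2" "h $ 2 $ 1" \<tau>] mob_in_uhp(3)[of "h $ 1 $ 1" "h $ 2 $ 2" "h $ 1 $ 2" "h $ 2 $ 1" \<tau>]
  by (simp_all add: SL2Z_carrier upper_half_plane_def moebius_mob mat2_mult_nth)

section \<open>The lift as a Maass waveform\<close>

context hyperbolic_lattice
begin

lemma lift_cmult: "lift (\<lambda>z. k * C z) \<tau> = k * lift C \<tau>"
proof -
  have "window (\<lambda>z. k * C z) = (\<lambda>x. k * window C x)" by (auto simp: window_def fun_eq_iff)
  then show ?thesis by (simp add: lift_def lap_int_cmult)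
qed

text \<open>Every element of SL_2(Z) has an intertwiner, so the growth at any cusp is the growth of
  another lift towards i infinity. On the level subgroup the intertwiner is a scalar, which yields
  the transformation law.\<close>

lemma lift_maass:
  assumes C: "periodic2 P R C" and inv: "\<And>z. C (gam z) = C z"
  shows "maass_waveform (principal_congruence_subgroup (2 * P * R)) (1/4) (lift C)"
  unfolding maass_waveform_def
proof (intro conjI ballI)
  define \<Gamma> where "\<Gamma> = principal_congruence_subgroup (2 * P * R)"
  show "smooth_on_uhp (lift C)" by (rule smooth_lift[OF C])
  show "hyperbolic_laplacian (lift C) \<tau> = 1 / 4 * lift C \<tau>" if "\<tau> \<in> upper_half_plane" for \<tau>
    by (rule lift_laplacian[OF C inv that])
  show "polynomial_growth_at_cusps (lift C)"
    unfolding polynomial_growth_at_cusps_def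
  proof
    fix g assume "g \<in> carrier SL2Z"
    then obtain U where U: "intertwiner P R (g $ 1 $ 1) (g $ 1 $ 2) (g $ 2 $ 1) (g $ 2 $ 2) U"
      using intertwiner_exists[OF PR] unfolding SL2Z_carrier by blast
    then have UC: "periodic2 P R (U C)" using C by (simp add: intertwiner_def)
    obtain B where B: "\<And>\<tau>. Im \<tau> \<ge> 1 \<Longrightarrow> cmod (lift (U C) \<tau>) \<le> B * Im \<tau> ^ 1" using lift_growth[OF UC] by blast
    have "cmod (lift C (moebius g \<tau>)) \<le> B * Im \<tau> ^ 1" if "Im \<tau> \<ge> 1" for \<tau>
      unfolding moebius_mob using B[OF that] lift_modular[OF U C, of \<tau>] that by simp
    then show "\<exists>C' y0. \<exists>k::nat. y0 > 0 \<and> (\<forall>\<tau>. Im \<tau> \<ge> y0 \<longrightarrow> cmod (lift C (moebius g \<tau>)) \<le> C' * Im \<tau> ^ k)"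
      by (intro exI[of _ B] exI[of _ 1]) auto
  qed
  have scalar: "\<exists>k. cmod k = 1 \<and> (\<forall>\<tau>\<in>upper_half_plane. lift C (moebius g \<tau>) = k * lift C \<tau>)" if g: "g \<in> \<Gamma>" for g
  proof -
    have det: "g $ 1 $ 1 * g $ 2 $ 2 - g $ 1 $ 2 * g $ 2 $ 1 = 1" using g by (simp add: \<Gamma>_def principal_iff SL2Z_carrier)
    obtain U where U: "intertwiner P R (g $ 1 $ 1) (g $ 1 $ 2) (g $ 2 $ 1) (g $ 2 $ 2) U"
      using intertwiner_exists[OF PR det] by blast
    obtain k where k: "cmod k = 1" "U C = (\<lambda>z. k * C z)"
      using intertwiner_scalar[OF PR(1,2) U] g C by (auto simp: \<Gamma>_def principal_iff)
    have "lift C (moebius g \<tau>) = k * lift C \<tau>" if "\<tau> \<in> upper_half_plane" for \<tau>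
      unfolding moebius_mob using lift_modular[OF U C, of \<tau>] that k(2) by (simp add: upper_half_plane_def lift_cmult)
    with k(1) show ?thesis by blast
  qed
  show "\<exists>\<epsilon>. multiplier (principal_congruence_subgroup (2 * P * R)) \<epsilon> \<and>
      (\<forall>g\<in>principal_congruence_subgroup (2 * P * R). \<forall>\<tau>\<in>upper_half_plane. lift C (moebius g \<tau>) = \<epsilon> g * lift C \<tau>)"
    unfolding \<Gamma>_def[symmetric]
  proof (cases "\<exists>\<tau>\<in>upper_half_plane. lift C \<tau> \<noteq> 0")
    case False
    then have F0: "lift C \<tau> = 0" if "\<tau> \<in> upper_half_plane" for \<tau> using that by blast
    have "lift C (moebius g \<tau>) = 0" if "g \<in> \<Gamma>" "\<tau> \<in> upper_half_plane" for g \<tau>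
      using moebius_mult(2)[of g \<tau>] that F0 by (simp add: \<Gamma>_def principal_iff)
    then show "\<exists>\<epsilon>. multiplier \<Gamma> \<epsilon> \<and> (\<forall>g\<in>\<Gamma>. \<forall>\<tau>\<in>upper_half_plane. lift C (moebius g \<tau>) = \<epsilon> g * lift C \<tau>)"
      using F0 by (intro exI[of _ "\<lambda>_. 1"]) (simp add: multiplier_def)
  next
    case True
    then obtain \<tau>0 where t0: "\<tau>0 \<in> upper_half_plane" "lift C \<tau>0 \<noteq> 0" by blast
    \<comment> \<open>The scalar attached to g is determined by the lift at a point where it does
      not vanish, and multiplicativity follows from composing Moebius maps; if there is no such
      point, the trivial multiplier has served.\<close>
    define \<epsilon> where "\<epsilon> = (\<lambda>g. lift C (moebius g \<tau>0) / lift C \<tau>0)"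
    have eps: "cmod (\<epsilon> g) = 1 \<and> (\<forall>\<tau>\<in>upper_half_plane. lift C (moebius g \<tau>) = \<epsilon> g * lift C \<tau>)" if g: "g \<in> \<Gamma>" for g
    proof -
      obtain k where k: "cmod k = 1" "\<forall>\<tau>\<in>upper_half_plane. lift C (moebius g \<tau>) = k * lift C \<tau>" using scalar[OF g] by blast
      then have "\<epsilon> g = k" using t0 by (simp add: \<epsilon>_def)
      with k show ?thesis by simp
    qed
    have "\<epsilon> (g ** h) = \<epsilon> g * \<epsilon> h" if g: "g \<in> \<Gamma>" and h: "h \<in> \<Gamma>" for g h
    proof -
      have hc: "h \<in> carrier SL2Z" using h by (simp add: \<Gamma>_def principal_iff)
      have "lift C (moebius (g ** h) \<tau>0) = \<epsilon> g * (\<epsilon> h * lift C \<tau>0)"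
        using moebius_mult(1)[OF hc t0(1), of g] moebius_mult(2)[OF hc t0(1)] eps[OF g] eps[OF h] t0(1) by simp
      moreover have "\<epsilon> (g ** h) = lift C (moebius (g ** h) \<tau>0) / lift C \<tau>0" by (simp add: \<epsilon>_def)
      ultimately show ?thesis using t0(2) by simp
    qed
    then have "multiplier \<Gamma> \<epsilon>" using eps by (simp add: multiplier_def)
    with eps show "\<exists>\<epsilon>. multiplier \<Gamma> \<epsilon> \<and> (\<forall>g\<in>\<Gamma>. \<forall>\<tau>\<in>upper_half_plane. lift C (moebius g \<tau>) = \<epsilon> g * lift C \<tau>)"
      by blast
  qed
qed

lemma congruence_principal: "n > 0 \<Longrightarrow> congruence_subgroup (principal_congruence_subgroup n)"
  unfolding congruence_subgroup_def using subgroup_principal by (metis Suc_leI One_nat_def order_refl)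

end

section \<open>From the rational data to a lattice function\<close>

lemma common_denominator:
  fixes x :: rat
  shows "\<exists>d::nat. d > 0 \<and> of_nat d * x \<in> \<int>"
proof (cases x)
  case (Fract p q)
  then have "of_nat (nat q) * x = of_int p" by (simp add: Fract_of_int_quotient)
  then show ?thesis using Fract by (intro exI[of _ "nat q"]) auto
qed

theorem theorem1p2:
  fixes M :: nat and a b :: "rat ^ 2"
  assumes "M \<ge> 2"
    and "a \<noteq> 0"
    and "a $ 1 + a $ 2 \<notin> \<int>" and "a $ 1 - a $ 2 \<notin> \<int>"
    and "sim M (gamma_mat M *v a, gamma_mat M *v b) (a, b) \<or>
         (sim M (gamma_mat M *v a, gamma_mat M *v b) (star_vec a, star_vec b) \<and>
          sim M (gamma_mat M *v star_vec a, gamma_mat M *v star_vec b) (a, b))"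
  shows "\<exists>\<Gamma> F. congruence_subgroup \<Gamma> \<and> maass_waveform \<Gamma> (1 / 4) F \<and>
               maass_plus_part F (S_series a b M)"
proof -
  obtain d1 d2 d3 d4 :: nat where d: "d1 > 0" "of_nat d1 * a $ 1 \<in> \<int>" "d2 > 0" "of_nat d2 * a $ 2 \<in> \<int>"
    "d3 > 0" "of_nat d3 * b $ 1 \<in> \<int>" "d4 > 0" "of_nat d4 * b $ 2 \<in> \<int>"
    using common_denominator by metis
  \<comment> \<open>A common denominator of all coordinates of \<open>a\<close> and
    \<open>b\<close>; the factor 2 makes \<open>P\<close> and \<open>R\<close> even.\<close>
  define K where "K = 2 * d1 * d2 * d3 * d4"
  have K: "K > 0" "even K" using d by (auto simp: K_def)
  have Kx: "of_nat K * x \<in> \<int>" if "of_nat e * x \<in> \<int>" "K = f * e" for x :: rat and e f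
    using Ints_mult[of "of_nat f" "of_nat e * x"] that by (simp add: mult.assoc)
  have Ka: "of_nat K * a $ 1 \<in> \<int>" "of_nat K * a $ 2 \<in> \<int>" and Kb: "of_nat K * b $ 1 \<in> \<int>" "of_nat K * b $ 2 \<in> \<int>"
    by (rule Kx[OF d(2), of "2 * d2 * d3 * d4"], simp add: K_def)
       (rule Kx[OF d(4), of "2 * d1 * d3 * d4"], simp add: K_def,
        rule Kx[OF d(6), of "2 * d1 * d2 * d4"], simp add: K_def,
        rule Kx[OF d(8), of "2 * d1 * d2 * d3"], simp add: K_def)
  interpret hyperbolic_lattice M K by unfold_locales (use assms(1) K in auto)
  \<comment> \<open>The constant of \<open>S_series_eq\<close>, divided by the 4 of
    \<open>coset_sum_symmetrize\<close>.\<close>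
  define k where "k = ee (of_rat (- B_form M a b)) / 4"
  define C where "C = (\<lambda>z. k * sym_char M a b (emb z))"
  have C: "periodic2 P R C"
    unfolding periodic2_def
  proof (intro allI)
    fix m n :: int
    \<comment> \<open>As P = (M + 1) K^2 and R = (M - 1) K^2, adding P or R to an integer coordinate
      shifts the rational one by exactly K.\<close>
    have f: "(x + A * (k * k)) / (A * k) = x / (A * k) + k" if "A \<noteq> 0" "k \<noteq> 0" for A k x :: rat
      using that by (simp add: field_simps)
    have "emb (m + int P, n) = emb (m, n) + of_nat K *s vector [1, 0]"
      "emb (m, n + int R) = emb (m, n) + of_nat K *s vector [0, 1]"
      using f[OF pos_rat(2,1), of "of_int m"] f[OF pos_rat(3,1), of "of_int n"]
      unfolding P_def R_def vec2_eq_iff emb_nth fst_conv snd_conv of_int_add of_int_of_nat_eq of_nat_mult of_nat_add of_nat_1 M1_rat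
      by (simp_all add: M1_rat power2_eq_square)
    moreover have "integral_vec (vector [1, 0] :: rat ^ 2)" "integral_vec (vector [0, 1] :: rat ^ 2)"
      by (simp_all add: integral_vec_iff)
    ultimately show "C (m + int P, n) = C (m, n) \<and> C (m, n + int R) = C (m, n)"
      unfolding C_def using sym_char_periodic[OF _ Kb] by simp
  qed
  have inv: "C (gam z) = C z" for z
    unfolding C_def emb_gam sym_char_gamma[OF assms(5)] ..
  have bdry: "C z = 0" if "int (M + 1) * \<bar>snd z\<bar> = int (M - 1) * \<bar>fst z\<bar>" for z
  proof -
    have r: "(of_nat M + 1) * \<bar>of_int (snd z) :: rat\<bar> = (of_nat M - 1) * \<bar>of_int (fst z)\<bar>"
      using arg_cong[OF that, of "of_int :: int \<Rightarrow> rat"] by (simp add: M1_rat add.commute)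
    have p: "\<bar>of_nat K\<bar> = (of_nat K :: rat)" "\<bar>of_nat M + 1\<bar> = (of_nat M + 1 :: rat)" "\<bar>of_nat M - 1\<bar> = (of_nat M - 1 :: rat)"
      using pos_rat(4) by simp_all
    have f: "x / (A * k) = y / (B * k)" if "A * y = B * x" "A \<noteq> 0" "B \<noteq> 0" "k \<noteq> 0" for A B k x y :: rat
      using that by (simp add: field_simps)
    have "\<bar>emb z $ 1\<bar> = \<bar>emb z $ 2\<bar>"
      unfolding emb_nth abs_divide abs_mult p by (rule f[OF r pos_rat(2,3,1)])
    then have "emb z $ 1 + emb z $ 2 = 0 \<or> emb z $ 1 - emb z $ 2 = 0"
      unfolding abs_eq_iff by linarith
    then show ?thesis unfolding C_def using sym_char_zero[OF assms(3,4)] by simp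
  qed
  have C0: "C (0, 0) = 0" by (rule bdry) simp
  have plus: "((\<lambda>n. coef C n * ee (of_int n * \<tau> / of_nat N)) has_sum S_series a b M \<tau>) {n. n > 0}"
    if "\<tau> \<in> upper_half_plane" for \<tau>
  proof (rule plus_part[OF C bdry])
    have v: "Im \<tau> > 0" using that by (simp add: upper_half_plane_def)
    show "((\<lambda>z. C z * ee (of_int (nform z) * \<tau> / of_nat N)) has_sum S_series a b M \<tau>) cone"
      using has_sum_cmult_right[OF coset_sum_symmetrize[OF v, of a b], of k]
      unfolding S_series_eq[OF v assms(3,4) Ka] by (simp add: C_def k_def mult.assoc)
  qed
  have "maass_plus_part (lift C) (S_series a b M)"
    unfolding maass_plus_part_def using lift_fourier[OF C inv C0] plus by blast
  moreover have "2 * P * R > 0" using PR by simp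
  ultimately show ?thesis
    using lift_maass[OF C inv] congruence_principal by blast
qed

end
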